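(* Let $M\ge 0$ be an integer and let $\mathcal K=\{k_1,\dots,k_M\}$ be a set of $M$ positive integers $k_1<k_2<\dots<k_M$ (with $\mathcal K=\emptyset$ if $M=0$). Let $H^1_{\mathcal K}=\{f\in H^1:\widehat f(k)=0 \text{ for all } k\in\mathcal K\}$, endowed with the norm $\|\cdot\|_1$. Suppose that $f\in H^1_{\mathcal K}$ and $\|f\|_1=1$. Assume further that $f=IF$, where $I$ is inner and $F\in H^1$ is outer. Then $f$ is an extreme point of $\mathrm{ball}(H^1_{\mathcal K})$ if and only if the following two conditions hold: (a) $I$ is a finite Blaschke product whose degree, say $m$, does not exceed $M$. (b) The $2M\times(2m+1)$ real matrix $\mathfrak M=\mathfrak M_{\mathcal K}\left(F,\{a_j\}_{j=1}^m\right)$ (defined in the context), built from $F$ and the zeros $\{a_j\}_{j=1}^m$ of $I$, has rank $2m$.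
   Context: Let $\mathbb T=\{\zeta\in\mathbb C:|\zeta|=1\}$ and $\mathbb D=\{z\in\mathbb C:|z|<1\}$. $L^1=L^1(\mathbb T)$ is the space of complex-valued integrable functions on $\mathbb T$ with norm $\|f\|_1=\frac1{2\pi}\int_{\mathbb T}|f(\zeta)|\,|d\zeta|$, and $\widehat f(k)=\frac1{2\pi}\int_{\mathbb T}\overline\zeta^{\,k}f(\zeta)\,|d\zeta|$ for $k\in\mathbb Z$. The Hardy space is $H^1=\{f\in L^1:\widehat f(k)=0\text{ for all }k<0\}$; its elements are also viewed as holomorphic functions on $\mathbb D$ via the Poisson integral. Put $H^\infty=H^1\cap L^\infty(\mathbb T)$. A non-null $F\in H^1$ is outer if $\log|F(0)|=\frac1{2\pi}\int_{\mathbb T}\log|F(\zeta)|\,|d\zeta|$. A function $I\in H^\infty$ is inner if $|I|=1$ a.e. on $\mathbb T$. For a Banach space $X$, $\mathrm{ball}(X)=\{x\in X:\|x\|\le1\}$; an element of $\mathrm{ball}(X)$ is an extreme point if it is not an interior point of any (nondegenerate) line segment contained in $\mathrm{ball}(X)$. A finite Blaschke product of degree $m\ge0$ is a function that equals, possibly after multiplication by a unimodular constant, $\prod_{j=1}^m\frac{z-a_j}{1-\overline{a_j}z}$ with $a_1,\dots,a_m\in\mathbb D$ (its zeros, listed with multiplicity); for $m=0$ the product is $1$. Definition of $\mathfrak M$. Given an outer function $F\in H^1$ and points $a_1,\dots,a_m\in\mathbb D$ with $0\le m\le M$, put $F_0(z)=F(z)\prod_{j=1}^m(1-\overline{a_j}z)^{-2}\in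 H^1$, $C_k=\widehat{F_0}(k)$ for $k\in\mathbb Z$ (so $C_k=0$ for $k<0$), $A(k)=\mathrm{Re}\,C_k$ and $B(k)=\mathrm{Im}\,C_k$. For $j=1,\dots,M$ and $l=0,\dots,m$ let $$A^+_{j,l}=A(k_j+l-m)+A(k_j-l-m),\qquad B^+_{j,l}=B(k_j+l-m)+B(k_j-l-m),$$ $$A^-_{j,l}=A(k_j+l-m)-A(k_j-l-m),\qquad B^-_{j,l}=B(k_j+l-m)-B(k_j-l-m).$$ Let $\mathcal A^+=\{A^+_{j,l}\}$ and $\mathcal B^+=\{B^+_{j,l}\}$ be the $M\times(m+1)$ matrices with row index $j=1,\dots,M$ and column index $l=0,\dots,m$, and let $\mathcal A^-=\{A^-_{j,l}\}$ and $\mathcal B^-=\{B^-_{j,l}\}$ be the $M\times m$ matrices with row index $j=1,\dots,M$ and column index $l=1,\dots,m$. Then $$\mathfrak M=\mathfrak M_{\mathcal K}\left(F,\{a_j\}_{j=1}^m\right)=\begin{pmatrix}\mathcal A^+&\mathcal B^-\\ \mathcal B^+&-\mathcal A^-\end{pmatrix},$$ a real matrix with $2M$ rows and $2m+1$ columns (when $M=0$, necessarily $m=0$ and the matrix has no rows, hence rank $0$). *)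

theory Defs
  imports "HOL-Analysis.Analysis" "Jordan_Normal_Form.DL_Rank"
begin

text \<open>Elements of \<open>L\<^sup>1(\<T>)\<close> are represented by functions \<^typ>\<open>complex \<Rightarrow> complex\<close>
  of which only the values on the unit circle matter; two such functions represent the same
  element iff they agree almost everywhere for the measure \<open>circle\<close>, which is
  \<open>|d\<zeta>| / (2\<pi>)\<close> on the Borel sets of the circle.\<close>

definition circle :: "complex measure" where
  "circle = distr (uniform_measure lborel {0..2 * pi}) (restrict_space borel (sphere 0 1)) cis"

lemma measurable_cis_sphere:
  "cis \<in> measurable (uniform_measure lborel {0..2 * pi}) (restrict_space borel (sphere 0 1))"
proof -
  have "cis \<in> borel_measurable borel"
    by (intro borel_measurable_continuous_onI) (auto intro!: continuous_intros)
  then show ?thesis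
    by (intro measurable_restrict_space2) (auto simp: uniform_measure_def)
qed

lemma integral_circle:
  fixes f :: "complex \<Rightarrow> complex"
  assumes "f \<in> borel_measurable circle"
  shows "(LINT \<zeta>|circle. f \<zeta>) = (LINT t:{0..2 * pi}|lborel. f (cis t)) / (2 * pi)"
proof -
  have meas: "f \<in> borel_measurable (restrict_space borel (sphere 0 1))"
    using assms by (simp add: circle_def)
  have comp: "(\<lambda>t. f (cis t)) \<in> borel_measurable lborel"
    using measurable_compose[OF measurable_cis_sphere meas] by (simp add: uniform_measure_def)
  have "uniform_measure lborel {0..2 * pi} =
      density lborel (\<lambda>t. ennreal (indicator {0..2 * pi} t / (2 * pi)))"
    unfolding uniform_measure_def
    by (intro density_cong) (auto simp: indicator_def divide_ennreal simp flip: ennreal_1)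
  then have "(LINT \<zeta>|circle. f \<zeta>) =
      (LINT t|lborel. (indicator {0..2 * pi} t / (2 * pi)) *\<^sub>R f (cis t))"
    using comp unfolding circle_def
    by (subst integral_distr[OF measurable_cis_sphere meas]) (simp add: integral_density)
  also have "\<dots> = (LINT t|lborel. (1 / (2 * pi)) *\<^sub>R (indicator {0..2 * pi} t *\<^sub>R f (cis t)))"
    by (intro Bochner_Integration.integral_cong) auto
  also have "\<dots> = (LINT t:{0..2 * pi}|lborel. f (cis t)) / (2 * pi)"
    unfolding set_lebesgue_integral_def by (subst integral_scaleR_right) (simp add: scaleR_conv_of_real)
  finally show ?thesis .
qed

definition L1_norm :: "(complex \<Rightarrow> complex) \<Rightarrow> real" where
  "L1_norm f = (LINT \<zeta>|circle. cmod (f \<zeta>))"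

definition fourier_coeff :: "(complex \<Rightarrow> complex) \<Rightarrow> int \<Rightarrow> complex" where
  "fourier_coeff f k = (LINT \<zeta>|circle. (cnj \<zeta> powi k) * f \<zeta>)"

definition H1 :: "(complex \<Rightarrow> complex) set" where
  "H1 = {f. integrable circle f \<and> (\<forall>k<0. fourier_coeff f k = 0)}"

definition Hinf :: "(complex \<Rightarrow> complex) set" where
  "Hinf = {f \<in> H1. \<exists>C. AE \<zeta> in circle. cmod (f \<zeta>) \<le> C}"

definition H1_gap :: "int set \<Rightarrow> (complex \<Rightarrow> complex) set" where
  "H1_gap K = {f \<in> H1. \<forall>k\<in>K. fourier_coeff f k = 0}"

definition unit_ball :: "(complex \<Rightarrow> complex) set \<Rightarrow> (complex \<Rightarrow> complex) set" where
  "unit_ball X = {f \<in> X. L1_norm f \<le> 1}"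

text \<open>The library's \<^const>\<open>extreme_point_of\<close> does not apply to classes of functions modulo
  almost-everywhere equality: here a segment is nondegenerate iff its endpoints \<open>g\<close>, \<open>h\<close> differ
  as elements of \<open>L\<^sup>1\<close>.\<close>

definition extreme_point :: "(complex \<Rightarrow> complex) \<Rightarrow> (complex \<Rightarrow> complex) set \<Rightarrow> bool" where
  "extreme_point f S \<longleftrightarrow> f \<in> S \<and>
     \<not> (\<exists>g h. \<not> (AE \<zeta> in circle. g \<zeta> = h \<zeta>) \<and>
            (\<forall>t\<in>{0..1}. (\<lambda>\<zeta>. (1 - t) *\<^sub>R g \<zeta> + t *\<^sub>R h \<zeta>) \<in> S) \<and>
            (\<exists>t\<in>{0<..<1}. AE \<zeta> in circle. f \<zeta> = (1 - t) *\<^sub>R g \<zeta> + t *\<^sub>R h \<zeta>))"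

definition is_inner :: "(complex \<Rightarrow> complex) \<Rightarrow> bool" where
  "is_inner I \<longleftrightarrow> I \<in> Hinf \<and> (AE \<zeta> in circle. cmod (I \<zeta>) = 1)"

text \<open>The holomorphic extension to the disc of the boundary function \<open>f\<close>.\<close>

definition poisson :: "(complex \<Rightarrow> complex) \<Rightarrow> complex \<Rightarrow> complex" where
  "poisson f z = (LINT \<zeta>|circle. ((1 - (cmod z)\<^sup>2) / (cmod (\<zeta> - z))\<^sup>2) *\<^sub>R f \<zeta>)"

text \<open>Since \<^term>\<open>ln 0 = (0::real)\<close> and non-integrable functions have integral \<open>0\<close> here,
  the clauses before the equation say that both of its sides, read with \<open>log 0 = -\<infinity>\<close>,
  are finite. This excludes no outer function: \<open>log|F|\<close> is integrable for every non-null
  \<open>F\<close> in \<open>H\<^sup>1\<close>.\<close>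

definition is_outer :: "(complex \<Rightarrow> complex) \<Rightarrow> bool" where
  "is_outer F \<longleftrightarrow> F \<in> H1 \<and> poisson F 0 \<noteq> 0 \<and>
     (AE \<zeta> in circle. F \<zeta> \<noteq> 0) \<and> integrable circle (\<lambda>\<zeta>. ln (cmod (F \<zeta>))) \<and>
     ln (cmod (poisson F 0)) = (LINT \<zeta>|circle. ln (cmod (F \<zeta>)))"

text \<open>\<open>I\<close> is a finite Blaschke product of degree \<open>length as\<close> whose zeros, with multiplicity,
  are listed by \<open>as\<close>.\<close>

definition blaschke_with_zeros :: "(complex \<Rightarrow> complex) \<Rightarrow> complex list \<Rightarrow> bool" where
  "blaschke_with_zeros I as \<longleftrightarrow> set as \<subseteq> ball 0 1 \<and>
     (\<exists>c. cmod c = 1 \<and>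
        (AE \<zeta> in circle. I \<zeta> = c * (\<Prod>a\<leftarrow>as. (\<zeta> - a) / (1 - cnj a * \<zeta>))))"

definition F0 :: "(complex \<Rightarrow> complex) \<Rightarrow> complex list \<Rightarrow> complex \<Rightarrow> complex" where
  "F0 F as = (\<lambda>z. F z * (\<Prod>a\<leftarrow>as. 1 / (1 - cnj a * z)\<^sup>2))"

definition coeff_A :: "(complex \<Rightarrow> complex) \<Rightarrow> complex list \<Rightarrow> int \<Rightarrow> real" where
  "coeff_A F as n = Re (fourier_coeff (F0 F as) n)"

definition coeff_B :: "(complex \<Rightarrow> complex) \<Rightarrow> complex list \<Rightarrow> int \<Rightarrow> real" where
  "coeff_B F as n = Im (fourier_coeff (F0 F as) n)"

text \<open>\<open>entry_plus X k m j l\<close> and \<open>entry_minus X k m j l\<close> use the mathematical indices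
  \<open>j = 1, \<dots>, M\<close> and \<open>l = 0, \<dots>, m\<close>. Library matrices are indexed from \<open>0\<close>, hence the shift
  by one of the rows, and of the columns in the \<open>minus\<close> blocks (where \<open>l\<close> starts at \<open>1\<close>).\<close>

definition entry_plus :: "(int \<Rightarrow> real) \<Rightarrow> (nat \<Rightarrow> int) \<Rightarrow> nat \<Rightarrow> nat \<Rightarrow> nat \<Rightarrow> real" where
  "entry_plus X k m j l = X (k j + int l - int m) + X (k j - int l - int m)"

definition entry_minus :: "(int \<Rightarrow> real) \<Rightarrow> (nat \<Rightarrow> int) \<Rightarrow> nat \<Rightarrow> nat \<Rightarrow> nat \<Rightarrow> real" where
  "entry_minus X k m j l = X (k j + int l - int m) - X (k j - int l - int m)"

definition block_plus :: "nat \<Rightarrow> nat \<Rightarrow> (nat \<Rightarrow> int) \<Rightarrow> (int \<Rightarrow> real) \<Rightarrow> real Matrix.mat" where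
  "block_plus M m k X = Matrix.mat M (m + 1) (\<lambda>(r, c). entry_plus X k m (r + 1) c)"

definition block_minus :: "nat \<Rightarrow> nat \<Rightarrow> (nat \<Rightarrow> int) \<Rightarrow> (int \<Rightarrow> real) \<Rightarrow> real Matrix.mat" where
  "block_minus M m k X = Matrix.mat M m (\<lambda>(r, c). entry_minus X k m (r + 1) (c + 1))"

definition frakM ::
  "nat \<Rightarrow> (nat \<Rightarrow> int) \<Rightarrow> (complex \<Rightarrow> complex) \<Rightarrow> complex list \<Rightarrow> real Matrix.mat" where
  "frakM M k F as =
     (let m = length as; A = coeff_A F as; B = coeff_B F as in
      four_block_mat (block_plus M m k A) (block_minus M m k B)
                     (block_plus M m k B) (- block_minus M m k A))"

lemma frakM_carrier: "frakM M k F as \<in> carrier_mat (2 * M) (2 * length as + 1)"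
  by (auto simp: frakM_def Let_def block_plus_def block_minus_def)

end

theory Submission
  imports Defs "HOL-Computational_Algebra.Fundamental_Theorem_Algebra"
    "Jordan_Normal_Form.Matrix_Kernel"
begin

text \<open>Equality in the triangle inequality shows that \<open>f\<close> is an extreme point iff every bounded real
  \<open>h\<close> with \<open>f * h\<close> in the space is constant. If \<open>I\<close> is not a Blaschke product of degree at most
  \<open>M\<close>, then the backward shifts of \<open>I\<close> of orders \<open>1, \<dots>, M + 1\<close> are linearly independent, and the
  functions \<open>Re (cnj I * u)\<close> with \<open>u\<close> in their span provide a nonconstant such \<open>h\<close>, because the \<open>M\<close>
  spectral gaps impose only \<open>2 * M\<close> real conditions on \<open>2 * M + 2\<close> real parameters. If \<open>I\<close> is a
  Blaschke product with denominator \<open>D\<close> and degree \<open>m\<close>, then Smirnov's maximum principle puts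
  \<open>I * h\<close> into \<open>H\<^sup>\<infinity>\<close>. Hence \<open>h * |D|\<^sup>2\<close> is a real trigonometric polynomial of degree at most
  \<open>m\<close>, and the spectral gaps of \<open>f * h\<close> form the homogeneous linear system with the matrix of the
  theorem. The constants always provide one nonzero solution, so \<open>f\<close> is extreme iff the kernel is a line.

  The principle is derived directly from Jensen's equality for \<open>F\<close>: approximating \<open>-log|F|\<close> by real
  trigonometric polynomials, that is by real parts of polynomials \<open>P\<close>, one obtains \<open>exp P * F\<close>
  with a fixed mean and moduli tending to that mean, so that these functions converge to
  a constant in \<open>L\<^sup>1\<close>.\<close>

section \<open>The circle measure and Fourier coefficients\<close>

text \<open>Everything stays on the circle: \<open>H1\<close> is handled through Fourier
  coefficients, and the only trace of the disc is the mean \<open>fourier_coeff f 0\<close>, the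
  value at the origin. Fejer means take over the role of the Poisson integral: they converge in
  \<open>L1\<close>, respect essential bounds, and have the real parts of polynomials. The
  difficulty is that a multiplier \<open>h\<close> is only bounded and real, so \<open>I * h\<close>
  is a quotient of \<open>f * h\<close> by \<open>F\<close> about which nothing analytic is known a
  priori; outerness is what removes its negative frequencies. In the necessity of (a),
  \<open>u\<close> and \<open>I * cnj u\<close> are both analytic, hence so is
  \<open>2 * f * h = F * u + f * (I * cnj u)\<close>. The shift of order 0 is left out because it
  yields the constant \<open>h = 1\<close>; for the others \<open>I * cnj u\<close> has mean zero,
  so that a constant \<open>h\<close> forces \<open>u = 0\<close>. The number
  \<open>2 * m + 1\<close> is the real dimension of the real trigonometric polynomials of degree at
  most \<open>m\<close>. One of them is \<open>|D|^2\<close> itself, which gives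
  \<open>h = 1\<close>; so the rank is at most \<open>2 * m\<close>, and (b) asks for the largest
  possible value.\<close>

lemma space_circle [simp]: "space circle = sphere 0 1"
  by (simp add: circle_def)

lemma sets_circle [measurable_cong]: "sets circle = sets (restrict_space borel (sphere 0 1))"
  by (simp add: circle_def)

lemma emeasure_circle_space: "emeasure circle (sphere 0 1) = 1"
proof -
  have "emeasure circle (sphere 0 1) =
      emeasure (uniform_measure lborel {0..2 * pi}) (cis -` sphere 0 1 \<inter> UNIV)"
    unfolding circle_def
    by (subst emeasure_distr[OF measurable_cis_sphere]) (auto simp: sets_restrict_space uniform_measure_def)
  also have "cis -` sphere 0 1 \<inter> UNIV = UNIV"
    by auto
  finally show ?thesis
    by (simp add: emeasure_uniform_measure divide_ennreal)
qed

interpretation circle: finite_measure circle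
  by standard (simp add: emeasure_circle_space)

interpretation circle_pair: pair_sigma_finite circle circle ..

lemma measure_circle_space [simp]: "measure circle (sphere 0 1) = 1"
  by (simp add: measure_def emeasure_circle_space)

lemma borel_measurable_circleI:
  "continuous_on (sphere 0 1) f \<Longrightarrow> f \<in> borel_measurable circle"
  by (subst measurable_cong_sets[OF sets_circle refl]) (rule borel_measurable_continuous_on_restrict)

lemma ident_measurable_circle [measurable]: "(\<lambda>z. z) \<in> borel_measurable circle"
  by (intro borel_measurable_circleI continuous_intros)

lemma poly_measurable_circle [measurable]: "poly p \<in> borel_measurable circle"
  by (intro borel_measurable_circleI continuous_intros)

lemma powi_measurable_circle [measurable]: "(\<lambda>z. z powi k) \<in> borel_measurable circle"
  by (intro borel_measurable_circleI continuous_intros) auto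

lemma integrable_circle_bounded:
  fixes f :: "complex \<Rightarrow> 'b :: {banach, second_countable_topology}"
  assumes "f \<in> borel_measurable circle" "AE z in circle. norm (f z) \<le> C"
  shows "integrable circle f"
  using circle.integrable_const_bound assms by blast

lemma continuous_circle_bound:
  fixes f :: "complex \<Rightarrow> 'b :: real_normed_vector"
  assumes "continuous_on (sphere 0 1) f"
  obtains C where "\<And>z. z \<in> sphere 0 1 \<Longrightarrow> norm (f z) \<le> C"
proof -
  have "bounded (f ` sphere 0 1)"
    using assms by (intro compact_imp_bounded compact_continuous_image) auto
  then show ?thesis
    using that unfolding bounded_iff by blast
qed

lemma integrable_circle_continuous:
  fixes f :: "complex \<Rightarrow> 'b :: {banach, second_countable_topology}"
  assumes "continuous_on (sphere 0 1) f"
  shows "integrable circle f"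
proof -
  obtain C where "\<And>z. z \<in> sphere 0 1 \<Longrightarrow> norm (f z) \<le> C"
    by (rule continuous_circle_bound[OF assms]) blast
  then show ?thesis
    by (intro integrable_circle_bounded[of _ C] borel_measurable_circleI assms AE_I2) auto
qed

lemma integrable_mult_bounded:
  fixes f g :: "complex \<Rightarrow> 'b :: {real_normed_field, banach, second_countable_topology}"
  assumes "integrable circle f" "g \<in> borel_measurable circle" "AE z in circle. norm (g z) \<le> C"
  shows "integrable circle (\<lambda>z. g z * f z)"
proof (rule Bochner_Integration.integrable_bound)
  show "integrable circle (\<lambda>z. C * norm (f z))"
    using assms by auto
  show "(\<lambda>z. g z * f z) \<in> borel_measurable circle"
    using assms by auto
  show "AE z in circle. norm (g z * f z) \<le> norm (C * norm (f z))"
    using assms(3) by eventually_elim (auto simp: norm_mult intro: order_trans[OF mult_right_mono abs_ge_self])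
qed

lemma integrable_powi_mult:
  fixes f :: "complex \<Rightarrow> complex"
  assumes "integrable circle f"
  shows "integrable circle (\<lambda>z. z powi k * f z)"
  by (intro integrable_mult_bounded[where C = 1] assms AE_I2) (auto simp: norm_power_int)

lemma powi_mult_sphere: "z \<in> sphere 0 (1::real) \<Longrightarrow> z powi a * z powi b = (z :: complex) powi (a + b)"
  by (subst power_int_add) auto

lemma mult_cnj_eq_1: "cmod z = 1 \<Longrightarrow> z * cnj z = 1"
  by (simp add: complex_norm_square[symmetric])

lemma inverse_cnj_sphere: "z \<in> sphere 0 1 \<Longrightarrow> 1 / cnj z = z"
  using mult_cnj_eq_1[of z] by (auto simp: divide_eq_eq)

lemma cnj_powi_sphere: "z \<in> sphere 0 1 \<Longrightarrow> cnj z powi k = z powi (-k)"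
proof -
  assume "z \<in> sphere 0 1"
  then have "z * cnj z = 1"
    by (simp add: mult_cnj_eq_1)
  then have "cnj z = inverse z"
    by (metis inverse_unique)
  then show ?thesis
    by (simp add: power_int_minus power_int_inverse)
qed

lemma fourier_coeff_altdef: "fourier_coeff f k = (LINT z|circle. z powi (-k) * f z)"
  unfolding fourier_coeff_def
  by (intro Bochner_Integration.integral_cong) (auto simp: cnj_powi_sphere)

lemma integral_powi: "(LINT z|circle. z powi k) = of_bool (k = 0)"
proof (cases "k = 0")
  case False
  define F where "F = (\<lambda>t. exp (\<i> * of_int k * of_real t) / (\<i> * of_int k))"
  have "(LINT z|circle. z powi k) = (LINT t:{0..2 * pi}|lborel. cis t powi k) / (2 * pi)"
    by (rule integral_circle) measurable
  also have "(LINT t:{0..2 * pi}|lborel. cis t powi k) = F (2 * pi) - F 0"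
    unfolding set_lebesgue_integral_def
  proof (rule integral_FTC_Icc)
    fix t :: real
    have "((\<lambda>t. exp (\<i> * of_int k * t) / (\<i> * of_int k)) has_field_derivative
        exp (\<i> * of_int k * of_real t)) (at (of_real t))"
      using False by (auto intro!: derivative_eq_intros)
    then have "(F has_vector_derivative exp (\<i> * of_int k * of_real t)) (at t within {0..2 * pi})"
      unfolding F_def by (rule has_vector_derivative_real_field)
    also have "exp (\<i> * of_int k * of_real t) = cis t powi k"
      by (subst cis_power_int) (simp add: cis_conv_exp mult_ac)
    finally show "(F has_vector_derivative cis t powi k) (at t within {0..2 * pi})" .
  qed (auto intro!: continuous_intros)
  also have "F (2 * pi) = F 0"
  proof -
    have "exp (\<i> * of_int k * of_real (2 * pi)) = cis (2 * pi) powi k"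
      by (simp only: cis_power_int cis_conv_exp) (simp add: mult_ac)
    then show ?thesis
      by (simp add: F_def)
  qed
  finally show ?thesis
    using False by simp
qed simp

lemma fourier_coeff_powi: "fourier_coeff (\<lambda>z. z powi j) k = of_bool (j = k)"
proof -
  have "fourier_coeff (\<lambda>z. z powi j) k = (LINT z|circle. z powi (j - k))"
    unfolding fourier_coeff_altdef
    by (intro Bochner_Integration.integral_cong) (auto simp: powi_mult_sphere)
  then show ?thesis
    by (simp add: integral_powi)
qed

lemma fourier_coeff_cong_AE:
  assumes "AE z in circle. f z = g z" "f \<in> borel_measurable circle" "g \<in> borel_measurable circle"
  shows "fourier_coeff f k = fourier_coeff g k"
  unfolding fourier_coeff_altdef using assms by (intro integral_cong_AE) auto

lemma fourier_coeff_cong: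
  assumes "\<And>z. z \<in> sphere 0 1 \<Longrightarrow> f z = g z"
  shows "fourier_coeff f k = fourier_coeff g k"
  unfolding fourier_coeff_altdef using assms by (intro Bochner_Integration.integral_cong) auto

lemma fourier_coeff_add:
  "integrable circle f \<Longrightarrow> integrable circle g \<Longrightarrow>
   fourier_coeff (\<lambda>z. f z + g z) k = fourier_coeff f k + fourier_coeff g k"
  unfolding fourier_coeff_altdef by (simp add: distrib_left integrable_powi_mult)

lemma fourier_coeff_diff:
  "integrable circle f \<Longrightarrow> integrable circle g \<Longrightarrow>
   fourier_coeff (\<lambda>z. f z - g z) k = fourier_coeff f k - fourier_coeff g k"
  unfolding fourier_coeff_altdef by (simp add: right_diff_distrib integrable_powi_mult)

lemma fourier_coeff_cmult: "fourier_coeff (\<lambda>z. c * f z) k = c * fourier_coeff f k"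
  unfolding fourier_coeff_altdef by (simp add: mult.left_commute)

lemma fourier_coeff_sum:
  assumes "\<And>i. i \<in> A \<Longrightarrow> integrable circle (f i)"
  shows "fourier_coeff (\<lambda>z. \<Sum>i\<in>A. f i z) k = (\<Sum>i\<in>A. fourier_coeff (f i) k)"
  unfolding fourier_coeff_altdef sum_distrib_left
  using assms by (intro Bochner_Integration.integral_sum integrable_powi_mult)

lemma fourier_coeff_zero [simp]: "fourier_coeff (\<lambda>z. 0) k = 0"
  by (simp add: fourier_coeff_def)

lemma fourier_coeff_shift: "fourier_coeff (\<lambda>z. z powi j * f z) k = fourier_coeff f (k - j)"
  unfolding fourier_coeff_altdef mult.assoc[symmetric]
  by (intro Bochner_Integration.integral_cong) (auto simp: powi_mult_sphere)

lemma fourier_coeff_cnj: "fourier_coeff (\<lambda>z. cnj (f z)) k = cnj (fourier_coeff f (-k))"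
proof -
  have "fourier_coeff (\<lambda>z. cnj (f z)) k = (LINT z|circle. cnj (z powi k * f z))"
    unfolding fourier_coeff_def
    by (intro Bochner_Integration.integral_cong) (auto simp: cnj_powi_sphere)
  also have "\<dots> = cnj (fourier_coeff f (-k))"
    unfolding fourier_coeff_altdef by (simp only: minus_minus) (rule Bochner_Integration.integral_cnj)
  finally show ?thesis .
qed

lemma norm_fourier_coeff_le: "cmod (fourier_coeff f k) \<le> L1_norm f"
proof -
  have "cmod (fourier_coeff f k) \<le> (LINT z|circle. cmod (z powi (-k) * f z))"
    unfolding fourier_coeff_altdef by (rule integral_norm_bound)
  also have "\<dots> = L1_norm f"
    unfolding L1_norm_def
    by (intro Bochner_Integration.integral_cong) (auto simp: norm_mult norm_power_int)
  finally show ?thesis .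
qed

lemma integrable_powi [simp]: "integrable circle (\<lambda>z. z powi k :: complex)"
  by (intro integrable_circle_continuous continuous_intros) auto

lemma integrable_poly [simp]: "integrable circle (poly (p :: complex poly))"
  by (intro integrable_circle_continuous continuous_intros)

lemma integrable_power [simp]: "integrable circle (\<lambda>z. z ^ n :: complex)"
  using integrable_powi[of "int n"] by simp

lemma fourier_coeff_power: "fourier_coeff (\<lambda>z. z ^ n) k = of_bool (int n = k)"
  using fourier_coeff_powi[of "int n"] by simp

lemma fourier_coeff_poly: "fourier_coeff (poly p) k = (if k < 0 then 0 else coeff p (nat k))"
proof -
  have "fourier_coeff (poly p) k =
      fourier_coeff (\<lambda>z. \<Sum>i\<le>degree p. coeff p i * z ^ i) k"
    by (intro fourier_coeff_cong) (simp add: poly_altdef)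
  also have "\<dots> = (\<Sum>i\<le>degree p. coeff p i * of_bool (int i = k))"
    by (subst fourier_coeff_sum) (simp_all add: fourier_coeff_cmult fourier_coeff_power)
  also have "\<dots> = (\<Sum>i\<le>degree p. if i = nat k \<and> 0 \<le> k then coeff p i else 0)"
    by (intro sum.cong) auto
  also have "\<dots> = (if k < 0 then 0 else coeff p (nat k))"
    by (auto simp: sum.delta coeff_eq_0)
  finally show ?thesis .
qed

lemma L1_norm_triangle:
  assumes "integrable circle f" "integrable circle g"
  shows "L1_norm (\<lambda>z. f z + g z) \<le> L1_norm f + L1_norm g"
proof -
  have "L1_norm (\<lambda>z. f z + g z) \<le> (LINT z|circle. cmod (f z) + cmod (g z))"
    unfolding L1_norm_def using assms by (intro integral_mono) (auto intro: norm_triangle_ineq)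
  then show ?thesis
    unfolding L1_norm_def using assms by simp
qed

lemma L1_norm_nonneg [simp]: "0 \<le> L1_norm f"
  by (simp add: L1_norm_def)

lemma L1_norm_cmult: "L1_norm (\<lambda>z. c * f z) = cmod c * L1_norm f"
  by (simp add: L1_norm_def norm_mult)

lemma L1_norm_cong:
  assumes "\<And>z. z \<in> sphere 0 1 \<Longrightarrow> f z = g z"
  shows "L1_norm f = L1_norm g"
  unfolding L1_norm_def using assms by (intro Bochner_Integration.integral_cong) auto

lemma L1_norm_minus_commute: "L1_norm (\<lambda>z. f z - g z) = L1_norm (\<lambda>z. g z - f z)"
  by (simp add: L1_norm_def norm_minus_commute)

lemma L1_norm_eq_0_iff:
  "integrable circle f \<Longrightarrow> L1_norm f = 0 \<longleftrightarrow> (AE z in circle. f z = 0)"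
  unfolding L1_norm_def by (subst integral_nonneg_eq_0_iff_AE) auto

section \<open>Trigonometric approximation\<close>

text \<open>Supplies closure under products in Stone-Weierstrass:
  \<open>2 * Re a * Re b = Re (a * b) + Re (a * cnj b)\<close>, and only the mixed term is not
  obviously the real part of a polynomial. Peeling one coefficient off both factors leaves a shorter
  mixed product times \<open>z * cnj z = 1\<close>.\<close>

lemma Re_poly_mult_cnj_poly:
  "\<exists>r. \<forall>z\<in>sphere 0 1. Re (poly p z * cnj (poly q z)) = Re (poly r z)"
proof (induction p arbitrary: q)
  case 0
  show ?case
    by (intro exI[of _ 0]) simp
next
  case (pCons a p)
  obtain b q' where q: "q = pCons b q'"
    by (cases q)
  obtain r where r: "\<And>z. z \<in> sphere 0 1 \<Longrightarrow> Re (poly p z * cnj (poly q' z)) = Re (poly r z)"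
    using pCons.IH by blast
  show ?case
  proof (intro exI ballI)
    fix z :: complex
    assume z: "z \<in> sphere 0 1"
    have 1: "z * cnj z = 1"
      using z by (simp add: mult_cnj_eq_1)
    have "poly (pCons a p) z * cnj (poly q z) =
        a * cnj (poly q z) + z * cnj b * poly p z + z * cnj z * (poly p z * cnj (poly q' z))"
      by (simp add: q algebra_simps)
    also have "Re \<dots> = Re (a * cnj (poly q z)) + Re (z * cnj b * poly p z) + Re (poly r z)"
      using r[OF z] by (simp only: 1) simp
    also have "Re (a * cnj (poly q z)) = Re (cnj a * poly q z)"
      by simp
    also have "\<dots> + Re (z * cnj b * poly p z) + Re (poly r z) =
        Re (poly (Polynomial.smult (cnj a) q + pCons 0 (Polynomial.smult (cnj b) p) + r) z)"
      by (simp add: mult.assoc)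
    finally show "Re (poly (pCons a p) z * cnj (poly q z)) =
        Re (poly (Polynomial.smult (cnj a) q + pCons 0 (Polynomial.smult (cnj b) p) + r) z)" .
  qed
qed

lemma Stone_Weierstrass_circle:
  fixes g :: "complex \<Rightarrow> real"
  assumes "continuous_on (sphere 0 1) g" "0 < e"
  shows "\<exists>p. \<forall>z\<in>sphere 0 1. \<bar>g z - Re (poly p z)\<bar> < e"
proof -
  let ?P = "\<lambda>h :: complex \<Rightarrow> real. \<exists>p. \<forall>z\<in>sphere 0 1. h z = Re (poly p z)"
  have "\<exists>h. ?P h \<and> (\<forall>z\<in>sphere 0 1. \<bar>g z - h z\<bar> < e)"
  proof (rule Stone_Weierstrass_HOL[where P = ?P])
    show "?P (\<lambda>_. c)" for c
      by (intro exI[of _ "[:of_real c:]"]) simp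
    show "continuous_on (sphere 0 1) h" if "?P h" for h
    proof -
      obtain p where "\<And>z. z \<in> sphere 0 1 \<Longrightarrow> h z = Re (poly p z)"
        using \<open>?P h\<close> by blast
      then show ?thesis
        by (subst continuous_on_cong[OF refl, of _ _ "\<lambda>z. Re (poly p z)"])
           (auto intro!: continuous_intros)
    qed
    show "?P (\<lambda>x. h x + k x)" if hk: "?P h \<and> ?P k" for h k
    proof -
      obtain p q where "\<And>z. z \<in> sphere 0 1 \<Longrightarrow> h z = Re (poly p z)"
          "\<And>z. z \<in> sphere 0 1 \<Longrightarrow> k z = Re (poly q z)"
        using hk by blast
      then show ?thesis
        by (intro exI[of _ "p + q"]) simp
    qed
    show "?P (\<lambda>x. h x * k x)" if hk: "?P h \<and> ?P k" for h k
    proof -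
      obtain p q where pq: "\<And>z. z \<in> sphere 0 1 \<Longrightarrow> h z = Re (poly p z)"
          "\<And>z. z \<in> sphere 0 1 \<Longrightarrow> k z = Re (poly q z)"
        using hk by blast
      obtain r where r: "\<And>z. z \<in> sphere 0 1 \<Longrightarrow> Re (poly p z * cnj (poly q z)) = Re (poly r z)"
        using Re_poly_mult_cnj_poly by blast
      have "h z * k z = Re (poly (Polynomial.smult (1 / 2) (p * q + r)) z)" if z: "z \<in> sphere 0 1" for z
        using r[OF z] pq[OF z] by (simp add: field_simps)
      then show ?thesis
        by blast
    qed
    show "\<exists>h. ?P h \<and> h x \<noteq> h y" if xy: "x \<in> sphere 0 1 \<and> y \<in> sphere 0 1 \<and> x \<noteq> y" for x y :: complex
    proof (cases "Re x = Re y")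
      case True
      then have "Im x \<noteq> Im y"
        using xy complex_eqI by blast
      then show ?thesis
        by (intro exI[of _ Im] conjI exI[of _ "[:0, -\<i>:]"]) auto
    next
      case False
      then show ?thesis
        by (intro exI[of _ Re] conjI exI[of _ "[:0, 1:]"]) auto
    qed
  qed (use assms in auto)
  then show ?thesis
    by force
qed

text \<open>On the circle \<open>poly p + cnj (poly q)\<close> is the general trigonometric
  polynomial. Density in \<open>L1\<close> is phrased as a predicate so that the induction
  principles for Borel sets and for integrable functions apply to it.\<close>

definition trig_approx :: "(complex \<Rightarrow> complex) \<Rightarrow> bool" where
  "trig_approx f \<longleftrightarrow> integrable circle f \<and>
     (\<forall>e>0. \<exists>p q. L1_norm (\<lambda>z. f z - (poly p z + cnj (poly q z))) < e)"

lemma trig_approx_limit: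
  assumes s: "\<And>n. trig_approx (s n)" and f: "integrable circle f"
    and lim: "(\<lambda>n. L1_norm (\<lambda>z. f z - s n z)) \<longlonglongrightarrow> 0"
  shows "trig_approx f"
  unfolding trig_approx_def
proof (intro conjI allI impI f)
  fix e :: real
  assume "0 < e"
  then have "eventually (\<lambda>n. L1_norm (\<lambda>z. f z - s n z) < e / 2) sequentially"
    using order_tendstoD(2)[OF lim, of "e / 2"] by simp
  then obtain n where n: "L1_norm (\<lambda>z. f z - s n z) < e / 2"
    by (auto simp: eventually_sequentially)
  obtain p q where pq: "L1_norm (\<lambda>z. s n z - (poly p z + cnj (poly q z))) < e / 2"
    using s[of n] \<open>0 < e\<close> unfolding trig_approx_def by (meson half_gt_zero)
  have "L1_norm (\<lambda>z. (f z - s n z) + (s n z - (poly p z + cnj (poly q z)))) \<le>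
      L1_norm (\<lambda>z. f z - s n z) + L1_norm (\<lambda>z. s n z - (poly p z + cnj (poly q z)))"
    using f s[of n] by (intro L1_norm_triangle) (auto simp: trig_approx_def)
  also have "\<dots> < e"
    using n pq by simp
  also have "L1_norm (\<lambda>z. (f z - s n z) + (s n z - (poly p z + cnj (poly q z)))) =
      L1_norm (\<lambda>z. f z - (poly p z + cnj (poly q z)))"
    by (intro L1_norm_cong) simp
  finally show "\<exists>p q. L1_norm (\<lambda>z. f z - (poly p z + cnj (poly q z))) < e"
    by blast
qed

lemma trig_approx_add:
  assumes f: "trig_approx f" and g: "trig_approx g"
  shows "trig_approx (\<lambda>z. f z + g z)"
  unfolding trig_approx_def
proof (intro conjI allI impI)
  show "integrable circle (\<lambda>z. f z + g z)"
    using assms by (auto simp: trig_approx_def)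
  fix e :: real
  assume "0 < e"
  obtain p q where pq: "L1_norm (\<lambda>z. f z - (poly p z + cnj (poly q z))) < e / 2"
    using f \<open>0 < e\<close> unfolding trig_approx_def by (meson half_gt_zero)
  obtain p' q' where pq': "L1_norm (\<lambda>z. g z - (poly p' z + cnj (poly q' z))) < e / 2"
    using g \<open>0 < e\<close> unfolding trig_approx_def by (meson half_gt_zero)
  have "L1_norm (\<lambda>z. (f z - (poly p z + cnj (poly q z))) + (g z - (poly p' z + cnj (poly q' z)))) \<le>
      L1_norm (\<lambda>z. f z - (poly p z + cnj (poly q z))) + L1_norm (\<lambda>z. g z - (poly p' z + cnj (poly q' z)))"
    using f g by (intro L1_norm_triangle) (auto simp: trig_approx_def)
  also have "\<dots> < e"
    using pq pq' by simp
  finally show "\<exists>p q. L1_norm (\<lambda>z. f z + g z - (poly p z + cnj (poly q z))) < e"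
    by (intro exI[of _ "p + p'"] exI[of _ "q + q'"]) (simp add: algebra_simps)
qed

lemma trig_approx_poly: "trig_approx (\<lambda>z. poly p z + cnj (poly q z))"
  unfolding trig_approx_def
  by (intro conjI allI impI exI[of _ p] exI[of _ q]) (auto simp: L1_norm_def)

lemma trig_approx_cmult:
  assumes f: "trig_approx f"
  shows "trig_approx (\<lambda>z. c * f z)"
proof (cases "c = 0")
  case True
  then show ?thesis
    using trig_approx_poly[of 0 0] by simp
next
  case False
  show ?thesis
    unfolding trig_approx_def
  proof (intro conjI allI impI)
    show "integrable circle (\<lambda>z. c * f z)"
      using assms by (auto simp: trig_approx_def)
    fix e :: real
    assume "0 < e"
    then obtain p q where pq: "L1_norm (\<lambda>z. f z - (poly p z + cnj (poly q z))) < e / cmod c"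
      using f False unfolding trig_approx_def by (meson zero_less_norm_iff divide_pos_pos)
    have "L1_norm (\<lambda>z. c * f z - (poly (Polynomial.smult c p) z + cnj (poly (Polynomial.smult (cnj c) q) z))) =
        L1_norm (\<lambda>z. c * (f z - (poly p z + cnj (poly q z))))"
      by (intro L1_norm_cong) (simp add: algebra_simps)
    also have "\<dots> = cmod c * L1_norm (\<lambda>z. f z - (poly p z + cnj (poly q z)))"
      by (rule L1_norm_cmult)
    also have "\<dots> < cmod c * (e / cmod c)"
      by (rule mult_strict_left_mono[OF pq]) (simp add: False)
    also have "\<dots> = e"
      using False by simp
    finally show "\<exists>p q. L1_norm (\<lambda>z. c * f z - (poly p z + cnj (poly q z))) < e"
      by blast
  qed
qed

text \<open>The single limit argument behind the density theorem: it serves closed sets, countable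
  disjoint unions, and the limit case of the induction over integrable functions.\<close>

lemma trig_approx_dominated:
  assumes s: "\<And>n. trig_approx (s n)" and w: "integrable circle w"
    and lim: "\<And>z. z \<in> sphere 0 1 \<Longrightarrow> (\<lambda>n. s n z) \<longlonglongrightarrow> f z"
    and bound: "\<And>n z. z \<in> sphere 0 1 \<Longrightarrow> norm (s n z) \<le> w z"
  shows "trig_approx f"
proof -
  have meas: "s n \<in> borel_measurable circle" for n
    using s[of n] by (auto simp: trig_approx_def)
  have s_int: "integrable circle (s n)" for n
    using s[of n] by (simp add: trig_approx_def)
  have f_meas: "f \<in> borel_measurable circle"
    by (rule borel_measurable_LIMSEQ_metric[where f = s]) (use meas lim in auto)
  have f_int: "integrable circle f"
    by (rule integrable_dominated_convergence[where s = s and w = w])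
       (use s_int w lim bound f_meas in auto)
  have f_bound: "norm (f z) \<le> w z" if "z \<in> sphere 0 1" for z
    using tendsto_norm[OF lim[OF that]] bound[OF that] by (intro LIMSEQ_le_const2) auto
  have "(\<lambda>n. L1_norm (\<lambda>z. f z - s n z)) \<longlonglongrightarrow> (LINT z|circle. 0)"
    unfolding L1_norm_def
  proof (rule integral_dominated_convergence[where w = "\<lambda>z. 2 * w z"])
    show "AE z in circle. (\<lambda>n. cmod (f z - s n z)) \<longlonglongrightarrow> 0"
    proof (rule AE_I2)
      fix z assume "z \<in> space circle"
      then have "(\<lambda>n. cmod (f z - s n z)) \<longlonglongrightarrow> cmod (f z - f z)"
        by (intro tendsto_intros lim) simp
      then show "(\<lambda>n. cmod (f z - s n z)) \<longlonglongrightarrow> 0"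
        by simp
    qed
    show "AE z in circle. norm (cmod (f z - s n z)) \<le> 2 * w z" for n
    proof (rule AE_I2)
      fix z assume "z \<in> space circle"
      then have "norm (f z) \<le> w z" "norm (s n z) \<le> w z"
        using f_bound bound by auto
      then show "norm (cmod (f z - s n z)) \<le> 2 * w z"
        using norm_triangle_ineq4[of "f z" "s n z"] by simp
    qed
  qed (use w f_meas meas in auto)
  then show ?thesis
    by (intro trig_approx_limit[OF s f_int]) simp
qed

lemma trig_approx_Re_continuous:
  assumes "continuous_on (sphere 0 1) g"
  shows "trig_approx (\<lambda>z. of_real (g z))"
  unfolding trig_approx_def
proof (intro conjI allI impI)
  show "integrable circle (\<lambda>z. complex_of_real (g z))"
    using assms by (intro integrable_circle_continuous continuous_intros)
  fix e :: real
  assume "0 < e"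
  then obtain p where p: "\<forall>z\<in>sphere 0 1. \<bar>g z - Re (poly p z)\<bar> < e / 2"
    using Stone_Weierstrass_circle[OF assms, of "e / 2"] by (meson half_gt_zero)
  \<comment> \<open>Half of \<open>p\<close>, because adding the conjugate doubles the real
    part.\<close>
  let ?q = "Polynomial.smult (1 / 2) p"
  have eq: "complex_of_real (g z) - (poly ?q z + cnj (poly ?q z)) = of_real (g z - Re (poly p z))" for z
    by (simp add: complex_eq_iff)
  have "L1_norm (\<lambda>z. complex_of_real (g z) - (poly ?q z + cnj (poly ?q z))) \<le> (LINT z|circle. e / 2)"
    unfolding L1_norm_def eq norm_of_real
  proof (rule integral_mono)
    show "integrable circle (\<lambda>z. \<bar>g z - Re (poly p z)\<bar>)"
      using assms by (intro integrable_circle_continuous continuous_intros)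
    show "\<bar>g z - Re (poly p z)\<bar> \<le> e / 2" if "z \<in> space circle" for z
      using p that by (simp add: less_imp_le)
  qed simp
  also have "\<dots> < e"
    using \<open>0 < e\<close> by simp
  finally show "\<exists>p q. L1_norm (\<lambda>z. complex_of_real (g z) - (poly p z + cnj (poly q z))) < e"
    by blast
qed

text \<open>Dynkin's argument on the intersection-stable generator of closed sets: the continuous
  cut-offs \<open>max 0 (1 - n * infdist z A)\<close> tend to the indicator of a closed
  \<open>A\<close>, and complements and disjoint unions follow by linearity and dominated
  limits.\<close>

lemma trig_approx_indicator:
  assumes "A \<in> sets borel"
  shows "trig_approx (\<lambda>z. indicator A z)"
proof -
  have "Int_stable (Collect (closed :: complex set \<Rightarrow> bool))" "Collect closed \<subseteq> Pow (UNIV :: complex set)"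
    by (auto simp: Int_stable_def)
  moreover have "A \<in> sigma_sets UNIV (Collect closed)"
    using assms by (simp add: borel_eq_closed)
  ultimately show ?thesis
  proof (induction A rule: sigma_sets_induct_disjoint)
    case (basic A)
    show ?case
    \<comment> \<open>Since \<open>infdist z {} = 0\<close>, the cut-offs of the empty set would be
      constantly 1.\<close>
    proof (cases "A = {}")
      case True
      then show ?thesis
        using trig_approx_poly[of 0 0] by simp
    next
      case False
      define g where "g = (\<lambda>(n::nat) z. max 0 (1 - real n * infdist z A))"
      show ?thesis
      proof (rule trig_approx_dominated[where w = "\<lambda>_. 1"])
        show "trig_approx (\<lambda>z. of_real (g n z))" for n
          unfolding g_def by (intro trig_approx_Re_continuous continuous_intros)
        show "norm (complex_of_real (g n z)) \<le> 1" for n z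
          by (auto simp: g_def infdist_nonneg)
        show "(\<lambda>n. complex_of_real (g n z)) \<longlonglongrightarrow> indicator A z" for z
        proof (cases "z \<in> A")
          case True
          then show ?thesis
            by (simp add: g_def)
        next
          case notin: False
          then have pos: "infdist z A > 0"
            using basic False infdist_pos_not_in_closed by auto
          obtain N where N: "real N * infdist z A > 1"
            using pos reals_Archimedean3 by blast
          have "g n z = 0" if "n \<ge> N" for n
          proof -
            have "real N * infdist z A \<le> real n * infdist z A"
              using that pos by (intro mult_right_mono) auto
            then show ?thesis
              using N by (simp add: g_def)
          qed
          then have "eventually (\<lambda>n. complex_of_real (g n z) = 0) sequentially"
            by (auto simp: eventually_sequentially)
          then show ?thesis
            using notin by (simp add: tendsto_eventually)
        qed
      qed auto
    qed
  next
    case empty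
    then show ?case
      using trig_approx_poly[of 0 0] by simp
  next
    case (compl A)
    have "(\<lambda>z. (poly 1 z + cnj (poly 0 z)) + (-1) * indicator A z) =
        (\<lambda>z. indicator (UNIV - A) z :: complex)"
      by (auto simp: indicator_def)
    moreover have "trig_approx (\<lambda>z. (poly 1 z + cnj (poly 0 z)) + (-1) * indicator A z)"
      by (intro trig_approx_add trig_approx_poly trig_approx_cmult compl)
    ultimately show ?case
      by (rule subst[where P = trig_approx])
  next
    case (union A)
    have sum: "trig_approx (\<lambda>z. \<Sum>i<n. indicator (A i) z)" for n
    proof (induction n)
      case 0
      then show ?case
        using trig_approx_poly[of 0 0] by simp
    next
      case (Suc n)
      then show ?case
        using trig_approx_add[OF Suc union(3)[of n]] by simp
    qed
    have eq: "(\<Sum>i<n. indicator (A i) z) = (indicator (\<Union>i<n. A i) z :: complex)" for n z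
      using union(1) by (subst indicator_UN_disjoint)
        (auto simp: disjoint_family_on_def)
    show ?case
    proof (rule trig_approx_dominated[OF sum, where w = "\<lambda>_. 1"])
      show "(\<lambda>n. \<Sum>i<n. indicator (A i) z) \<longlonglongrightarrow> (indicator (\<Union>i. A i) z :: complex)" for z
        unfolding eq using LIMSEQ_indicator_UN[of A z] by simp
      show "norm (\<Sum>i<n. indicator (A i) z :: complex) \<le> 1" for n z
        unfolding eq by (simp add: indicator_def)
    qed auto
  qed
qed

lemma trig_approx_integrable:
  assumes "integrable circle f"
  shows "trig_approx f"
  using assms
proof (induction f rule: integrable_induct)
  case (base A c)
  then obtain B where B: "B \<in> sets borel" "A = sphere 0 1 \<inter> B"
    by (auto simp: sets_circle sets_restrict_space)
  have "trig_approx (\<lambda>z. c * indicator B z)"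
    by (intro trig_approx_cmult trig_approx_indicator B)
  then show ?case
    by (rule trig_approx_dominated[where w = "\<lambda>_. cmod c"])
       (auto simp: B indicator_def)
next
  case (add f g)
  then show ?case
    by (intro trig_approx_add)
next
  case (lim f s)
  show ?case
    by (rule trig_approx_dominated[of s "\<lambda>x. 2 * norm (f x)"]) (use lim in auto)
qed

section \<open>Fejer means\<close>

text \<open>The Cesaro mean of the Fourier series: the frequency \<open>k\<close> arises as
  \<open>i - j\<close> exactly \<open>N - |k|\<close> times. Indexing by pairs makes the kernel a
  squared modulus at once. For \<open>N = 0\<close> the value is 0 by division by zero, hence the
  recurring assumption \<open>0 < N\<close>.\<close>

definition fejer :: "nat \<Rightarrow> (complex \<Rightarrow> complex) \<Rightarrow> complex \<Rightarrow> complex" where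
  "fejer N f z = (\<Sum>i<N. \<Sum>j<N. fourier_coeff f (int i - int j) * z powi (int i - int j)) / of_nat N"

definition fejer_kernel :: "nat \<Rightarrow> complex \<Rightarrow> complex \<Rightarrow> real" where
  "fejer_kernel N z w = (cmod (\<Sum>i<N. (z * cnj w) ^ i))\<^sup>2 / real N"

lemma fejer_kernel_nonneg: "0 \<le> fejer_kernel N z w"
  by (simp add: fejer_kernel_def)

lemma fejer_kernel_commute: "fejer_kernel N z w = fejer_kernel N w z"
proof -
  have "(\<Sum>i<N. (z * cnj w) ^ i) = cnj (\<Sum>i<N. (w * cnj z) ^ i)"
    by (simp add: mult.commute)
  then have "cmod (\<Sum>i<N. (z * cnj w) ^ i) = cmod (\<Sum>i<N. (w * cnj z) ^ i)"
    by (simp only: complex_mod_cnj)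
  then show ?thesis
    by (simp only: fejer_kernel_def)
qed

lemma fejer_kernel_eq:
  assumes "z \<in> sphere 0 1" "w \<in> sphere 0 1"
  shows "of_real (fejer_kernel N z w) =
    (\<Sum>i<N. \<Sum>j<N. z powi (int i - int j) * w powi (- (int i - int j))) / of_nat N"
proof -
  have *: "(z * cnj w) ^ i * cnj ((z * cnj w) ^ j) = z powi (int i - int j) * w powi (- (int i - int j))" for i j
  proof -
    have "(z * cnj w) ^ i * cnj ((z * cnj w) ^ j) =
        (z powi int i * cnj z powi int j) * (cnj w powi int i * w powi int j)"
      by (simp add: power_mult_distrib mult_ac)
    also have "\<dots> = z powi (int i - int j) * w powi (- (int i - int j))"
      using assms by (simp only: cnj_powi_sphere powi_mult_sphere) simp
    finally show ?thesis .
  qed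
  have "complex_of_real ((cmod (\<Sum>i<N. (z * cnj w) ^ i))\<^sup>2) =
      (\<Sum>i<N. (z * cnj w) ^ i) * (\<Sum>j<N. cnj ((z * cnj w) ^ j))"
    by (simp only: complex_norm_square cnj_sum)
  also have "\<dots> = (\<Sum>i<N. \<Sum>j<N. z powi (int i - int j) * w powi (- (int i - int j)))"
    by (simp only: sum_product *)
  finally show ?thesis
    by (simp only: fejer_kernel_def of_real_divide of_real_of_nat_eq)
qed

lemma fejer_kernel_continuous [continuous_intros]:
  "continuous_on A f \<Longrightarrow> continuous_on A g \<Longrightarrow> continuous_on A (\<lambda>x. fejer_kernel N (f x) (g x))"
  unfolding fejer_kernel_def divide_inverse by (intro continuous_intros)

lemma integral_fejer_kernel:
  assumes "z \<in> sphere 0 1" "0 < N"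
  shows "(LINT w|circle. fejer_kernel N z w) = 1"
proof -
  have "complex_of_real (LINT w|circle. fejer_kernel N z w) =
      (LINT w|circle. complex_of_real (fejer_kernel N z w))"
    by simp
  also have "\<dots> = (LINT w|circle.
      (\<Sum>i<N. \<Sum>j<N. z powi (int i - int j) * w powi (- (int i - int j))) / of_nat N)"
    using assms by (intro Bochner_Integration.integral_cong refl fejer_kernel_eq) auto
  also have "\<dots> = (\<Sum>i<N. \<Sum>j<N. z powi (int i - int j) * (LINT w|circle. w powi (- (int i - int j)))) / of_nat N"
    by (subst integral_divide_zero, subst Bochner_Integration.integral_sum)
       (auto simp: Bochner_Integration.integral_sum)
  also have "\<dots> = (\<Sum>i<N. \<Sum>j<N. of_bool (i = j)) / of_nat N"
    by (intro arg_cong2[where f = "(/)"] sum.cong refl) (auto simp: integral_powi)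
  also have "\<dots> = 1"
    using assms by (simp add: of_bool_def sum.delta)
  finally show ?thesis
    using of_real_eq_1_iff by blast
qed

lemma fejer_eq_integral:
  assumes "z \<in> sphere 0 1" "integrable circle f"
  shows "fejer N f z = (LINT w|circle. of_real (fejer_kernel N z w) * f w)"
proof -
  have "(LINT w|circle. of_real (fejer_kernel N z w) * f w) = (LINT w|circle.
      (\<Sum>i<N. \<Sum>j<N. z powi (int i - int j) * (w powi (- (int i - int j)) * f w)) / of_nat N)"
    using assms
    by (intro Bochner_Integration.integral_cong refl)
       (simp add: fejer_kernel_eq sum_distrib_right mult.assoc)
  also have "\<dots> = (\<Sum>i<N. \<Sum>j<N. z powi (int i - int j) * fourier_coeff f (int i - int j)) / of_nat N"
    unfolding fourier_coeff_altdef using integrable_powi_mult[OF assms(2)]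
    by (subst integral_divide_zero, subst Bochner_Integration.integral_sum)
       (auto simp: Bochner_Integration.integral_sum)
  finally show ?thesis
    by (simp add: fejer_def mult.commute)
qed

lemma fejer_measurable [measurable]: "fejer N f \<in> borel_measurable circle"
  unfolding fejer_def[abs_def] by measurable

lemma fejer_integrable [simp]: "integrable circle (fejer N f)"
  unfolding fejer_def[abs_def] by simp

text \<open>The kernel is nonnegative, symmetric, and has integral 1 in either variable, so
  interchanging the two integrations gives a contraction.\<close>

lemma L1_norm_fejer_le:
  assumes f: "integrable circle f" and N: "0 < N"
  shows "L1_norm (fejer N f) \<le> L1_norm f"
proof -
  have f_meas [measurable]: "f \<in> borel_measurable circle"
    using f by simp
  have K1: "(\<integral>\<^sup>+ z. ennreal (fejer_kernel N z w) \<partial>circle) = 1" if "w \<in> sphere 0 1" for w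
  proof -
    have "integrable circle (fejer_kernel N w)"
      by (intro integrable_circle_continuous continuous_intros)
    then have "(\<integral>\<^sup>+ z. ennreal (fejer_kernel N w z) \<partial>circle) = ennreal (LINT z|circle. fejer_kernel N w z)"
      by (intro nn_integral_eq_integral) (auto simp: fejer_kernel_nonneg)
    then show ?thesis
      using integral_fejer_kernel[OF that N] by (simp add: fejer_kernel_commute[of N _ w])
  qed
  have K_meas [measurable]: "(\<lambda>x. fejer_kernel N (fst x) (snd x)) \<in> borel_measurable (circle \<Otimes>\<^sub>M circle)"
  proof -
    have 1: "(\<lambda>x. fst x) \<in> borel_measurable (circle \<Otimes>\<^sub>M circle)"
      using measurable_compose[OF measurable_fst ident_measurable_circle] by simp
    have 2: "(\<lambda>x. snd x) \<in> borel_measurable (circle \<Otimes>\<^sub>M circle)"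
      using measurable_compose[OF measurable_snd ident_measurable_circle] by simp
    have "(\<lambda>x :: complex \<times> complex. fejer_kernel N (fst x) (snd x)) \<in> borel_measurable borel"
      by (intro borel_measurable_continuous_onI continuous_intros)
    then have "(\<lambda>x :: complex \<times> complex. fejer_kernel N (fst x) (snd x)) \<in> borel_measurable (borel \<Otimes>\<^sub>M borel)"
      by (simp add: borel_prod)
    from measurable_compose[OF measurable_Pair[OF 1 2] this] show ?thesis
      by simp
  qed
  have "ennreal (L1_norm (fejer N f)) = (\<integral>\<^sup>+ z. ennreal (cmod (fejer N f z)) \<partial>circle)"
    unfolding L1_norm_def by (intro nn_integral_eq_integral[symmetric]) auto
  also have "\<dots> \<le> (\<integral>\<^sup>+ z. \<integral>\<^sup>+ w. ennreal (fejer_kernel N z w * cmod (f w)) \<partial>circle \<partial>circle)"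
  proof (rule nn_integral_mono)
    fix z assume "z \<in> space circle"
    then have z: "z \<in> sphere 0 1"
      by simp
    have Kf_meas: "(\<lambda>w. of_real (fejer_kernel N z w) * f w) \<in> borel_measurable circle"
      by (intro borel_measurable_times f_meas borel_measurable_circleI continuous_intros)
    have "ennreal (cmod (fejer N f z)) \<le> (\<integral>\<^sup>+ w. ennreal (cmod (of_real (fejer_kernel N z w) * f w)) \<partial>circle)"
    proof (cases "integrable circle (\<lambda>w. of_real (fejer_kernel N z w) * f w)")
      case True
      then show ?thesis
        unfolding fejer_eq_integral[OF z f] by (rule integral_norm_bound_ennreal)
    next
      case False
      then show ?thesis
        unfolding fejer_eq_integral[OF z f] by (simp add: not_integrable_integral_eq)
    qed
    then show "ennreal (cmod (fejer N f z)) \<le> (\<integral>\<^sup>+ w. ennreal (fejer_kernel N z w * cmod (f w)) \<partial>circle)"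
      by (simp add: norm_mult fejer_kernel_nonneg)
  qed
  also have "\<dots> = (\<integral>\<^sup>+ w. \<integral>\<^sup>+ z. ennreal (fejer_kernel N z w * cmod (f w)) \<partial>circle \<partial>circle)"
    by (intro circle_pair.Fubini'[symmetric]) (simp add: case_prod_unfold)
  also have "\<dots> = (\<integral>\<^sup>+ w. ennreal (cmod (f w)) \<partial>circle)"
  proof (rule nn_integral_cong)
    fix w assume "w \<in> space circle"
    then have w: "w \<in> sphere 0 1"
      by simp
    have "(\<lambda>z. fejer_kernel N z w) \<in> borel_measurable circle"
      by (intro borel_measurable_circleI continuous_intros)
    then have "(\<integral>\<^sup>+ z. ennreal (fejer_kernel N z w * cmod (f w)) \<partial>circle) =
        (\<integral>\<^sup>+ z. ennreal (fejer_kernel N z w) \<partial>circle) * ennreal (cmod (f w))"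
      by (subst nn_integral_multc[symmetric]) (auto simp: ennreal_mult fejer_kernel_nonneg)
    then show "(\<integral>\<^sup>+ z. ennreal (fejer_kernel N z w * cmod (f w)) \<partial>circle) = ennreal (cmod (f w))"
      using K1[OF w] by simp
  qed
  also have "\<dots> = ennreal (L1_norm f)"
    unfolding L1_norm_def using f by (intro nn_integral_eq_integral) auto
  finally show ?thesis
    by (simp add: ennreal_le_iff)
qed

text \<open>A Fejer mean is an average against a probability density. This bound is the reason for
  preferring Fejer means to arbitrary \<open>L1\<close> approximants: exponentials of the
  approximants stay dominated.\<close>

lemma norm_fejer_le:
  assumes f: "integrable circle f" and N: "0 < N" and z: "z \<in> sphere 0 1"
    and bound: "AE w in circle. cmod (f w) \<le> C"
  shows "cmod (fejer N f z) \<le> C"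
proof -
  have K: "integrable circle (fejer_kernel N z)"
    by (intro integrable_circle_continuous continuous_intros)
  have "cmod (fejer N f z) \<le> (LINT w|circle. cmod (of_real (fejer_kernel N z w) * f w))"
    unfolding fejer_eq_integral[OF z f] by (rule integral_norm_bound)
  also have "\<dots> \<le> (LINT w|circle. fejer_kernel N z w * C)"
  proof (rule integral_mono_AE)
    show AE: "AE w in circle. cmod (of_real (fejer_kernel N z w) * f w) \<le> fejer_kernel N z w * C"
      using bound by eventually_elim (auto simp: norm_mult fejer_kernel_nonneg intro!: mult_left_mono)
    have meas: "(\<lambda>w. cmod (of_real (fejer_kernel N z w) * f w)) \<in> borel_measurable circle"
      using f K by auto
    show "integrable circle (\<lambda>w. cmod (of_real (fejer_kernel N z w) * f w))"
      using AE by (intro Bochner_Integration.integrable_bound[OF integrable_mult_left[OF K, of C] meas]) auto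
  qed (use K in auto)
  also have "\<dots> = C"
    using integral_fejer_kernel[OF z N] by simp
  finally show ?thesis .
qed

lemma fejer_add:
  assumes "integrable circle f" "integrable circle g"
  shows "fejer N (\<lambda>z. f z + g z) z = fejer N f z + fejer N g z"
  using assms by (simp add: fejer_def fourier_coeff_add distrib_right sum.distrib add_divide_distrib)

lemma fejer_cmult: "fejer N (\<lambda>z. c * f z) z = c * fejer N f z"
  by (simp add: fejer_def fourier_coeff_cmult sum_distrib_left mult.assoc)

definition fejer_conv :: "(complex \<Rightarrow> complex) \<Rightarrow> bool" where
  "fejer_conv f \<longleftrightarrow> integrable circle f \<and> (\<lambda>N. L1_norm (\<lambda>z. fejer N f z - f z)) \<longlonglongrightarrow> 0"

lemma fejer_conv_add:
  assumes "fejer_conv f" "fejer_conv g"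
  shows "fejer_conv (\<lambda>z. f z + g z)"
proof -
  have int: "integrable circle f" "integrable circle g"
    using assms by (auto simp: fejer_conv_def)
  have "(\<lambda>N. L1_norm (\<lambda>z. fejer N (\<lambda>z. f z + g z) z - (f z + g z))) \<longlonglongrightarrow> 0"
  proof (rule tendsto_sandwich[where f = "\<lambda>_. 0"])
    show "(\<lambda>N. L1_norm (\<lambda>z. fejer N f z - f z) + L1_norm (\<lambda>z. fejer N g z - g z)) \<longlonglongrightarrow> 0"
      using assms unfolding fejer_conv_def by (auto intro!: tendsto_add_zero)
    have "L1_norm (\<lambda>z. fejer N (\<lambda>z. f z + g z) z - (f z + g z)) \<le>
        L1_norm (\<lambda>z. fejer N f z - f z) + L1_norm (\<lambda>z. fejer N g z - g z)" for N
      using L1_norm_triangle[of "\<lambda>z. fejer N f z - f z" "\<lambda>z. fejer N g z - g z"] int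
      by (simp add: fejer_add algebra_simps)
    then show "eventually (\<lambda>N. L1_norm (\<lambda>z. fejer N (\<lambda>z. f z + g z) z - (f z + g z)) \<le>
        L1_norm (\<lambda>z. fejer N f z - f z) + L1_norm (\<lambda>z. fejer N g z - g z)) sequentially"
      by simp
  qed auto
  then show ?thesis
    using int by (simp add: fejer_conv_def)
qed

lemma fejer_conv_cmult:
  assumes "fejer_conv f"
  shows "fejer_conv (\<lambda>z. c * f z)"
proof -
  have "L1_norm (\<lambda>z. fejer N (\<lambda>z. c * f z) z - c * f z) = cmod c * L1_norm (\<lambda>z. fejer N f z - f z)" for N
    unfolding fejer_cmult right_diff_distrib[symmetric] by (rule L1_norm_cmult)
  then show ?thesis
    using assms by (auto simp: fejer_conv_def intro!: tendsto_mult_right_zero)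
qed

lemma fejer_conv_sum:
  assumes "finite A" "\<And>i. i \<in> A \<Longrightarrow> fejer_conv (f i)"
  shows "fejer_conv (\<lambda>z. \<Sum>i\<in>A. f i z)"
  using assms
proof (induction A rule: finite_induct)
  case empty
  then show ?case
    by (simp add: fejer_conv_def fejer_def L1_norm_def)
next
  case (insert a A)
  then show ?case
    by (simp add: fejer_conv_add)
qed

text \<open>The multiplicity of the frequency \<open>k\<close> in \<open>fejer\<close>; truncated
  subtraction accounts for \<open>|k| > N\<close>.\<close>

lemma count_differences:
  "(\<Sum>i<N. \<Sum>j<N. of_bool (k = int i - int j)) = (of_nat (N - nat \<bar>k\<bar>) :: 'a :: semiring_1)"
proof -
  have "(\<Sum>j<N. of_bool (k = int i - int j) :: 'a) = of_bool (k \<le> int i \<and> int i < int N + k)" for i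
  proof (cases "k \<le> int i \<and> int i < int N + k")
    case True
    then have "(\<Sum>j<N. of_bool (k = int i - int j) :: 'a) = (\<Sum>j<N. if j = nat (int i - k) then 1 else 0)"
      by (intro sum.cong) auto
    then show ?thesis
      using True by (simp add: nat_less_iff)
  next
    case False
    have "(\<Sum>j<N. of_bool (k = int i - int j) :: 'a) = 0"
      by (rule sum.neutral) (use False in auto)
    then show ?thesis
      using False by simp
  qed
  then have "(\<Sum>i<N. \<Sum>j<N. of_bool (k = int i - int j)) =
      (\<Sum>i<N. of_bool (k \<le> int i \<and> int i < int N + k) :: 'a)"
    by simp
  also have "\<dots> = of_nat (card {i \<in> {..<N}. k \<le> int i \<and> int i < int N + k})"
    by (simp add: of_bool_def sum.If_cases Int_def)
  also have "{i \<in> {..<N}. k \<le> int i \<and> int i < int N + k} = {nat k..<N - nat (-k)}"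
    by auto
  also have "card \<dots> = N - nat \<bar>k\<bar>"
    by auto
  finally show ?thesis .
qed

lemma fejer_conv_powi: "fejer_conv (\<lambda>z. z powi k)"
proof -
  define n where "n = nat \<bar>k\<bar>"
  have eq: "fejer N (\<lambda>z. z powi k) z = of_nat (N - n) / of_nat N * z powi k" for N z
  proof -
    have "(\<Sum>i<N. \<Sum>j<N. fourier_coeff (\<lambda>z. z powi k) (int i - int j) * z powi (int i - int j)) =
        (\<Sum>i<N. \<Sum>j<N. of_bool (k = int i - int j) * z powi k)"
      by (intro sum.cong) (auto simp: fourier_coeff_powi)
    also have "\<dots> = of_nat (N - n) * z powi k"
      by (simp only: sum_distrib_right[symmetric] count_differences n_def)
    finally show ?thesis
      by (simp add: fejer_def)
  qed
  have "L1_norm (\<lambda>z. fejer N (\<lambda>z. z powi k) z - z powi k) = real n / real N"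
    if "N \<ge> n" "N > 0" for N
  proof -
    have "L1_norm (\<lambda>z. fejer N (\<lambda>z. z powi k) z - z powi k) =
        L1_norm (\<lambda>z. of_real (real n / real N) * z powi k)"
      unfolding eq L1_norm_def
    proof (intro Bochner_Integration.integral_cong refl)
      fix z :: complex
      have "of_nat (N - n) / of_nat N * z powi k - z powi k =
          - (of_real (real n / real N) * z powi k)"
        using that by (simp add: of_nat_diff field_simps)
      then show "cmod (of_nat (N - n) / of_nat N * z powi k - z powi k) =
          cmod (of_real (real n / real N) * z powi k)"
        by (simp only: norm_minus_cancel)
    qed
    also have "\<dots> = real n / real N * L1_norm (\<lambda>z. z powi k)"
      by (simp only: L1_norm_cmult norm_of_real) simp
    also have "L1_norm (\<lambda>z. z powi k) = L1_norm (\<lambda>z. 1)"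
      unfolding L1_norm_def by (intro Bochner_Integration.integral_cong) (auto simp: norm_power_int)
    finally show ?thesis
      by (simp add: L1_norm_def)
  qed
  then have "eventually (\<lambda>N. real n / real N = L1_norm (\<lambda>z. fejer N (\<lambda>z. z powi k) z - z powi k)) sequentially"
    by (auto intro!: eventually_sequentiallyI[of "max 1 (n)"])
  then have "(\<lambda>N. L1_norm (\<lambda>z. fejer N (\<lambda>z. z powi k) z - z powi k)) \<longlonglongrightarrow> 0"
    by (rule Lim_transform_eventually[OF lim_const_over_n])
  then show ?thesis
    by (simp add: fejer_conv_def)
qed

lemma fejer_conv_cong:
  assumes "\<And>z. z \<in> sphere 0 1 \<Longrightarrow> f z = g z" "fejer_conv f"
  shows "fejer_conv g"
proof -
  have "fejer N f = fejer N g" for N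
    using fourier_coeff_cong[of f g] assms(1) by (intro ext) (simp add: fejer_def)
  moreover have "integrable circle f \<longleftrightarrow> integrable circle g"
    using assms(1) by (intro Bochner_Integration.integrable_cong) auto
  moreover have "L1_norm (\<lambda>z. fejer N g z - f z) = L1_norm (\<lambda>z. fejer N g z - g z)" for N
    using assms(1) by (intro L1_norm_cong) simp
  ultimately show ?thesis
    using assms(2) by (simp add: fejer_conv_def)
qed

lemma fejer_conv_trig_poly: "fejer_conv (\<lambda>z. poly p z + cnj (poly q z))"
proof (rule fejer_conv_cong)
  show "fejer_conv (\<lambda>z. (\<Sum>i\<le>degree p. coeff p i * z powi int i) +
      (\<Sum>i\<le>degree q. cnj (coeff q i) * z powi (- int i)))"
    by (intro fejer_conv_add fejer_conv_sum fejer_conv_cmult fejer_conv_powi finite_atMost)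
  show "(\<Sum>i\<le>degree p. coeff p i * z powi int i) + (\<Sum>i\<le>degree q. cnj (coeff q i) * z powi (- int i)) =
      poly p z + cnj (poly q z)" if "z \<in> sphere 0 1" for z
    using cnj_powi_sphere[OF that] by (simp add: poly_altdef power_int_minus[symmetric] flip: power_int_of_nat)
qed

text \<open>Uniform contractivity reduces the claim to a dense set, and for a trigonometric
  polynomial the error of each frequency \<open>k\<close> is \<open>|k| / N\<close> once
  \<open>N\<close> is large.\<close>

theorem fejer_L1_convergence:
  assumes f: "integrable circle f"
  shows "(\<lambda>N. L1_norm (\<lambda>z. fejer N f z - f z)) \<longlonglongrightarrow> 0"
proof (rule LIMSEQ_I)
  fix e :: real
  assume e: "0 < e"
  obtain p q where pq: "L1_norm (\<lambda>z. f z - (poly p z + cnj (poly q z))) < e / 3"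
    using trig_approx_integrable[OF f] e unfolding trig_approx_def by (meson zero_less_divide_iff zero_less_numeral)
  define t where "t = (\<lambda>z. poly p z + cnj (poly q z))"
  have pq': "L1_norm (\<lambda>z. f z - t z) < e / 3"
    using pq by (simp add: t_def)
  have t: "fejer_conv t"
    unfolding t_def by (rule fejer_conv_trig_poly)
  then have t_int: "integrable circle t"
    by (simp add: fejer_conv_def)
  have "eventually (\<lambda>N. L1_norm (\<lambda>z. fejer N t z - t z) < e / 3) sequentially"
    using t e order_tendstoD(2)[of _ 0 sequentially "e / 3"] by (simp add: fejer_conv_def)
  then obtain N0 where N0: "\<And>N. N \<ge> N0 \<Longrightarrow> L1_norm (\<lambda>z. fejer N t z - t z) < e / 3"
    by (auto simp: eventually_sequentially)
  have "L1_norm (\<lambda>z. fejer N f z - f z) < e" if N: "N \<ge> max 1 N0" for N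
  proof -
    have d_int: "integrable circle (\<lambda>z. f z - t z)"
      using f t_int by simp
    have "L1_norm (\<lambda>z. fejer N f z - f z) =
        L1_norm (\<lambda>z. (fejer N (\<lambda>z. f z - t z) z + (fejer N t z - t z)) + (t z - f z))"
      using fejer_add[OF d_int t_int, of N] by (simp add: algebra_simps)
    also have "\<dots> \<le> L1_norm (\<lambda>z. fejer N (\<lambda>z. f z - t z) z + (fejer N t z - t z)) + L1_norm (\<lambda>z. t z - f z)"
      using f t_int by (intro L1_norm_triangle) auto
    also have "L1_norm (\<lambda>z. fejer N (\<lambda>z. f z - t z) z + (fejer N t z - t z)) \<le>
        L1_norm (fejer N (\<lambda>z. f z - t z)) + L1_norm (\<lambda>z. fejer N t z - t z)"
      using t_int by (intro L1_norm_triangle) auto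
    also have "L1_norm (fejer N (\<lambda>z. f z - t z)) \<le> L1_norm (\<lambda>z. f z - t z)"
      using d_int N by (intro L1_norm_fejer_le) auto
    finally show ?thesis
      using pq' N0[of N] N by (simp add: L1_norm_minus_commute[of t f])
  qed
  then show "\<exists>no. \<forall>N\<ge>no. norm (L1_norm (\<lambda>z. fejer N f z - f z) - 0) < e"
    by (intro exI[of _ "max 1 N0"]) simp
qed

theorem fourier_coeff_unique:
  assumes f: "integrable circle f" and g: "integrable circle g"
    and eq: "\<And>k. fourier_coeff f k = fourier_coeff g k"
  shows "AE z in circle. f z = g z"
proof -
  have int: "integrable circle (\<lambda>z. f z - g z)"
    using f g by simp
  have "fejer N (\<lambda>z. f z - g z) = (\<lambda>z. 0)" for N
    using f g eq by (intro ext) (simp add: fejer_def fourier_coeff_diff)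
  then have "L1_norm (\<lambda>z. g z - f z) = 0"
    using fejer_L1_convergence[OF int] by (simp add: LIMSEQ_const_iff)
  then have "L1_norm (\<lambda>z. f z - g z) = 0"
    by (simp add: L1_norm_minus_commute[of f g])
  then have "AE z in circle. f z - g z = 0"
    using int by (simp add: L1_norm_eq_0_iff)
  then show ?thesis
    by simp
qed

lemma fejer_AE_subseq:
  assumes f: "integrable circle f"
  shows "\<exists>r :: nat \<Rightarrow> nat. strict_mono r \<and> (AE z in circle. (\<lambda>n. fejer (r n) f z) \<longlonglongrightarrow> f z)"
proof -
  have "\<exists>r :: nat \<Rightarrow> nat. strict_mono r \<and> (AE z in circle. (\<lambda>n. fejer (r n) f z - f z) \<longlonglongrightarrow> 0)"
    using fejer_L1_convergence[OF f] f unfolding L1_norm_def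
    by (intro tendsto_L1_AE_subseq) auto
  then show ?thesis
    by (simp add: LIM_zero_iff)
qed

section \<open>Hardy spaces\<close>

lemma H1_integrable: "f \<in> H1 \<Longrightarrow> integrable circle f"
  by (simp add: H1_def)

lemma H1_fourier_coeff: "f \<in> H1 \<Longrightarrow> k < 0 \<Longrightarrow> fourier_coeff f k = 0"
  by (simp add: H1_def)

lemma H1_measurable: "f \<in> H1 \<Longrightarrow> f \<in> borel_measurable circle"
  by (rule borel_measurable_integrable[OF H1_integrable])

lemma H1_add: "f \<in> H1 \<Longrightarrow> g \<in> H1 \<Longrightarrow> (\<lambda>z. f z + g z) \<in> H1"
  by (simp add: H1_def fourier_coeff_add)

lemma H1_diff: "f \<in> H1 \<Longrightarrow> g \<in> H1 \<Longrightarrow> (\<lambda>z. f z - g z) \<in> H1"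
  by (simp add: H1_def fourier_coeff_diff)

lemma H1_cmult: "f \<in> H1 \<Longrightarrow> (\<lambda>z. c * f z) \<in> H1"
  by (simp add: H1_def fourier_coeff_cmult)

lemma integrable_cong_AE_circle:
  fixes f g :: "complex \<Rightarrow> complex"
  assumes "integrable circle f" "AE z in circle. f z = g z" "g \<in> borel_measurable circle"
  shows "integrable circle g"
  by (rule integrable_cong_AE_imp[OF assms(1) assms(3)]) (use assms(2) in auto)

lemma H1_cong_AE:
  assumes "f \<in> H1" "AE z in circle. f z = g z" "g \<in> borel_measurable circle"
  shows "g \<in> H1"
proof -
  have "fourier_coeff g k = fourier_coeff f k" for k
    using fourier_coeff_cong_AE[OF assms(2) H1_measurable[OF assms(1)] assms(3)] by simp
  then show ?thesis
    using integrable_cong_AE_circle[OF H1_integrable[OF assms(1)] assms(2,3)] assms(1)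
    by (simp add: H1_def)
qed

lemma H1_cong:
  assumes "f \<in> H1" "\<And>z. z \<in> sphere 0 1 \<Longrightarrow> f z = g z"
  shows "g \<in> H1"
proof -
  have "integrable circle f \<longleftrightarrow> integrable circle g"
    using assms(2) by (intro Bochner_Integration.integrable_cong) auto
  moreover have "fourier_coeff g k = fourier_coeff f k" for k
    using fourier_coeff_cong[of f g] assms(2) by simp
  ultimately show ?thesis
    using assms(1) by (simp add: H1_def)
qed

lemma H1_poly: "poly p \<in> H1"
  by (simp add: H1_def fourier_coeff_poly)

lemma H1_const: "(\<lambda>z. c) \<in> H1"
  by (rule H1_cong[OF H1_poly[of "[:c:]"]]) simp

lemma L1_norm_mult_le:
  assumes "integrable circle f" "b \<in> borel_measurable circle" "AE z in circle. cmod (b z) \<le> C"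
  shows "L1_norm (\<lambda>z. b z * f z) \<le> C * L1_norm f"
proof -
  have "L1_norm (\<lambda>z. b z * f z) \<le> (LINT z|circle. C * cmod (f z))"
    unfolding L1_norm_def
  proof (rule integral_mono_AE)
    show "AE z in circle. cmod (b z * f z) \<le> C * cmod (f z)"
      using assms(3) by eventually_elim (auto simp: norm_mult intro: mult_right_mono)
  qed (use assms integrable_norm[OF integrable_mult_bounded[OF assms]] in auto)
  then show ?thesis
    by (simp add: L1_norm_def)
qed

lemma fourier_coeff_L1_limit:
  assumes "\<And>n. integrable circle (s n)" "integrable circle f"
    "(\<lambda>n. L1_norm (\<lambda>z. s n z - f z)) \<longlonglongrightarrow> 0"
  shows "(\<lambda>n. fourier_coeff (s n) k) \<longlonglongrightarrow> fourier_coeff f k"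
proof (rule LIM_zero_cancel, rule Lim_null_comparison)
  show "eventually (\<lambda>n. norm (fourier_coeff (s n) k - fourier_coeff f k) \<le> L1_norm (\<lambda>z. s n z - f z)) sequentially"
    using norm_fourier_coeff_le[of "\<lambda>z. s _ z - f z" k] assms
    by (simp add: fourier_coeff_diff)
qed (fact assms)

lemma H1_L1_limit:
  assumes s: "\<And>n. s n \<in> H1" and f: "integrable circle f"
    and lim: "(\<lambda>n. L1_norm (\<lambda>z. s n z - f z)) \<longlonglongrightarrow> 0"
  shows "f \<in> H1"
proof -
  have "fourier_coeff f k = 0" if "k < 0" for k
    using fourier_coeff_L1_limit[OF H1_integrable[OF s] f lim, of k] H1_fourier_coeff[OF s that]
    by (simp add: LIMSEQ_const_iff)
  then show ?thesis
    using f by (simp add: H1_def)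
qed

text \<open>The convolution formula for the coefficients of a product. The convolution series need
  not converge absolutely, so \<open>f\<close> is replaced by its Fejer means, whose
  \<open>L1\<close> convergence survives multiplication by a bounded function.\<close>

lemma fourier_coeff_mult_limit:
  assumes f: "integrable circle f" and b: "b \<in> borel_measurable circle" "AE z in circle. cmod (b z) \<le> C"
  shows "(\<lambda>N. (\<Sum>i<N. \<Sum>j<N. fourier_coeff f (int i - int j) * fourier_coeff b (k - (int i - int j))) / of_nat N)
    \<longlonglongrightarrow> fourier_coeff (\<lambda>z. b z * f z) k"
proof -
  have b_int: "integrable circle b"
    using b by (rule integrable_circle_bounded)
  have "(\<lambda>N. L1_norm (\<lambda>z. b z * fejer N f z - b z * f z)) \<longlonglongrightarrow> 0"
  proof (rule Lim_null_comparison)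
    show "(\<lambda>N. C * L1_norm (\<lambda>z. fejer N f z - f z)) \<longlonglongrightarrow> 0"
      using fejer_L1_convergence[OF f] by (rule tendsto_mult_right_zero)
    show "eventually (\<lambda>N. norm (L1_norm (\<lambda>z. b z * fejer N f z - b z * f z)) \<le>
        C * L1_norm (\<lambda>z. fejer N f z - f z)) sequentially"
      using L1_norm_mult_le[OF _ b, of "\<lambda>z. fejer _ f z - f z"] f
      by (simp add: right_diff_distrib)
  qed
  then have "(\<lambda>N. fourier_coeff (\<lambda>z. b z * fejer N f z) k) \<longlonglongrightarrow> fourier_coeff (\<lambda>z. b z * f z) k"
    using f b by (intro fourier_coeff_L1_limit integrable_mult_bounded) auto
  moreover have "fourier_coeff (\<lambda>z. b z * fejer N f z) k =
      (\<Sum>i<N. \<Sum>j<N. fourier_coeff f (int i - int j) * fourier_coeff b (k - (int i - int j))) / of_nat N" for N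
  proof -
    have "fourier_coeff (\<lambda>z. b z * fejer N f z) k = fourier_coeff (\<lambda>z. inverse (of_nat N) *
        (\<Sum>i<N. \<Sum>j<N. fourier_coeff f (int i - int j) * (z powi (int i - int j) * b z))) k"
      by (intro fourier_coeff_cong) (simp add: fejer_def sum_distrib_left divide_inverse mult_ac)
    then show ?thesis
      using integrable_powi_mult[OF b_int]
      by (simp add: fourier_coeff_cmult fourier_coeff_sum fourier_coeff_shift divide_inverse_commute)
  qed
  ultimately show ?thesis
    by simp
qed

text \<open>The two frequencies in each term of the convolution formula add up to \<open>k\<close>.
  If \<open>k < 0\<close>, one of them is negative and the term vanishes; if \<open>k = 0\<close>,
  only the terms with both frequencies zero survive, which makes the mean multiplicative.\<close>

lemma H1_mult_bounded:
  assumes f: "f \<in> H1" and b: "b \<in> H1" "AE z in circle. cmod (b z) \<le> C"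
  shows "(\<lambda>z. b z * f z) \<in> H1"
    and "fourier_coeff (\<lambda>z. b z * f z) 0 = fourier_coeff b 0 * fourier_coeff f 0"
proof -
  note lim = fourier_coeff_mult_limit[OF H1_integrable[OF f] H1_measurable[OF b(1)] b(2)]
  have "fourier_coeff (\<lambda>z. b z * f z) k = 0" if k: "k < 0" for k
  proof -
    have "fourier_coeff f (int i - int j) * fourier_coeff b (k - (int i - int j)) = 0" for i j
      using H1_fourier_coeff[OF f, of "int i - int j"] H1_fourier_coeff[OF b(1), of "k - (int i - int j)"] k
      by (cases "int i - int j < 0") auto
    then show ?thesis
      using lim[of k] by (simp add: LIMSEQ_const_iff)
  qed
  moreover have "integrable circle (\<lambda>z. b z * f z)"
    using H1_integrable[OF f] H1_measurable[OF b(1)] b(2) by (rule integrable_mult_bounded)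
  ultimately show "(\<lambda>z. b z * f z) \<in> H1"
    by (simp add: H1_def)
  define S where "S = (\<lambda>N. (\<Sum>i<N. \<Sum>j<N. fourier_coeff f (int i - int j) * fourier_coeff b (0 - (int i - int j))) / of_nat N)"
  have "fourier_coeff f (int i - int j) * fourier_coeff b (0 - (int i - int j)) =
      (if j = i then fourier_coeff f 0 * fourier_coeff b 0 else 0)" for i j
    using H1_fourier_coeff[OF f, of "int i - int j"] H1_fourier_coeff[OF b(1), of "0 - (int i - int j)"]
    by (cases "i < j"; cases "j < i") auto
  then have *: "S N = fourier_coeff b 0 * fourier_coeff f 0" if "N > 0" for N
    unfolding S_def using that by (simp only:) (simp add: sum.delta)
  have "eventually (\<lambda>N. S N = fourier_coeff b 0 * fourier_coeff f 0) sequentially"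
    using eventually_gt_at_top[of 0] by eventually_elim (rule *)
  then have "S \<longlonglongrightarrow> fourier_coeff b 0 * fourier_coeff f 0"
    by (rule tendsto_eventually)
  then show "fourier_coeff (\<lambda>z. b z * f z) 0 = fourier_coeff b 0 * fourier_coeff f 0"
    unfolding S_def by (rule LIMSEQ_unique[OF lim[of 0]])
qed

section \<open>Bounded analytic functions: polynomials, exponentials and geometric series\<close>

lemma HinfI:
  assumes "f \<in> H1" "\<And>z. z \<in> sphere 0 1 \<Longrightarrow> cmod (f z) \<le> C"
  shows "f \<in> Hinf"
  using assms by (auto simp: Hinf_def intro!: exI[of _ C] AE_I2)

lemma Hinf_imp_H1: "f \<in> Hinf \<Longrightarrow> f \<in> H1"
  by (simp add: Hinf_def)

lemma H1_mult_Hinf: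
  assumes "f \<in> H1" "b \<in> Hinf"
  shows "(\<lambda>z. b z * f z) \<in> H1"
    and "fourier_coeff (\<lambda>z. b z * f z) 0 = fourier_coeff b 0 * fourier_coeff f 0"
  using assms H1_mult_bounded[of f b] by (auto simp: Hinf_def)

lemma Hinf_poly: "poly p \<in> Hinf"
proof -
  obtain C where "\<And>z. z \<in> sphere 0 1 \<Longrightarrow> cmod (poly p z) \<le> C"
    by (rule continuous_circle_bound[of "poly p"]) (auto intro: continuous_intros)
  then show ?thesis
    by (intro HinfI[of _ C] H1_poly) auto
qed

lemma H1_mult_poly: "f \<in> H1 \<Longrightarrow> (\<lambda>z. poly p z * f z) \<in> H1"
  by (rule H1_mult_Hinf(1)[OF _ Hinf_poly])

text \<open>The way to recognise bounded analytic functions that are not polynomials: partial sums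
  of a power series, uniformly bounded on the circle, converge in \<open>L1\<close> and carry their
  coefficients to the limit.\<close>

lemma Hinf_poly_limit:
  assumes lim: "\<And>z. z \<in> sphere 0 1 \<Longrightarrow> (\<lambda>n. poly (p n) z) \<longlonglongrightarrow> E z"
    and bound: "\<And>n z. z \<in> sphere 0 1 \<Longrightarrow> cmod (poly (p n) z) \<le> C"
  shows "E \<in> Hinf" and "(\<lambda>n. coeff (p n) 0) \<longlonglongrightarrow> fourier_coeff E 0"
proof -
  have E_bound: "cmod (E z) \<le> C" if "z \<in> sphere 0 1" for z
    using tendsto_norm[OF lim[OF that]] bound[OF that] by (intro LIMSEQ_le_const2) auto
  have E_meas: "E \<in> borel_measurable circle"
    by (rule borel_measurable_LIMSEQ_metric[where f = "\<lambda>n. poly (p n)"]) (use lim in auto)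
  have E_int: "integrable circle E"
    using E_meas E_bound by (intro integrable_circle_bounded[of _ C] AE_I2) auto
  have "(\<lambda>n. L1_norm (\<lambda>z. poly (p n) z - E z)) \<longlonglongrightarrow> (LINT z|circle. 0)"
    unfolding L1_norm_def
  proof (rule integral_dominated_convergence[where w = "\<lambda>z. 2 * C"])
    show "AE z in circle. (\<lambda>n. cmod (poly (p n) z - E z)) \<longlonglongrightarrow> 0"
      using lim by (intro AE_I2 tendsto_norm_zero LIM_zero) auto
    show "AE z in circle. norm (cmod (poly (p n) z - E z)) \<le> 2 * C" for n
    proof (rule AE_I2)
      fix z assume "z \<in> space circle"
      then have "cmod (poly (p n) z) \<le> C" "cmod (E z) \<le> C"
        using bound E_bound by auto
      then show "norm (cmod (poly (p n) z - E z)) \<le> 2 * C"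
        using norm_triangle_ineq4[of "poly (p n) z" "E z"] by simp
    qed
  qed (use E_meas in auto)
  then have L1: "(\<lambda>n. L1_norm (\<lambda>z. poly (p n) z - E z)) \<longlonglongrightarrow> 0"
    by simp
  have "E \<in> H1"
    by (rule H1_L1_limit[OF H1_poly E_int L1])
  then show "E \<in> Hinf"
    using E_bound by (rule HinfI)
  show "(\<lambda>n. coeff (p n) 0) \<longlonglongrightarrow> fourier_coeff E 0"
    using fourier_coeff_L1_limit[OF _ E_int L1, of 0] by (simp add: fourier_coeff_poly)
qed

text \<open>The mean is identified through the partial sums of the exponential series: their
  constant coefficients tend to the mean by \<open>L1\<close> convergence, and to
  \<open>exp (coeff P 0)\<close> because the series also converges at the origin.\<close>

lemma exp_poly_Hinf:
  "(\<lambda>z. exp (poly P z)) \<in> Hinf" "fourier_coeff (\<lambda>z. exp (poly P z)) 0 = exp (coeff P 0)"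
proof -
  define p where "p = (\<lambda>n. \<Sum>i<n. Polynomial.smult (1 / fact i) (P ^ i))"
  have p: "poly (p n) z = (\<Sum>i<n. (poly P z) ^ i /\<^sub>R fact i)" for n z
    by (simp add: p_def poly_sum poly_power scaleR_conv_of_real field_simps)
  have lim: "(\<lambda>n. poly (p n) z) \<longlonglongrightarrow> exp (poly P z)" for z
    unfolding p using exp_converges[of "poly P z"] by (simp add: sums_def)
  obtain C where C: "\<And>z. z \<in> sphere 0 1 \<Longrightarrow> cmod (poly P z) \<le> C"
    by (rule continuous_circle_bound[of "poly P"]) (auto intro: continuous_intros)
  have bound: "cmod (poly (p n) z) \<le> exp C" if "z \<in> sphere 0 1" for n z
  proof -
    have "cmod (poly (p n) z) \<le> (\<Sum>i<n. cmod (poly P z) ^ i /\<^sub>R fact i)"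
      unfolding p by (rule sum_norm_le) (simp add: norm_power)
    also have "\<dots> \<le> exp (cmod (poly P z))"
      unfolding exp_def by (intro sum_le_suminf summable_exp_generic) auto
    also have "\<dots> \<le> exp C"
      using C that by simp
    finally show ?thesis .
  qed
  show "(\<lambda>z. exp (poly P z)) \<in> Hinf"
    by (rule Hinf_poly_limit[OF lim bound])
  have "(\<lambda>n. coeff (p n) 0) \<longlonglongrightarrow> fourier_coeff (\<lambda>z. exp (poly P z)) 0"
    by (rule Hinf_poly_limit[OF lim bound])
  moreover have "(\<lambda>n. coeff (p n) 0) \<longlonglongrightarrow> exp (coeff P 0)"
    using lim[of 0] by (simp add: poly_0_coeff_0)
  ultimately show "fourier_coeff (\<lambda>z. exp (poly P z)) 0 = exp (coeff P 0)"
    by (rule LIMSEQ_unique)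
qed

lemma geometric_Hinf:
  assumes a: "cmod a < 1"
  shows "(\<lambda>z. 1 / (1 - cnj a * z)) \<in> Hinf"
proof (rule Hinf_poly_limit)
  let ?p = "\<lambda>n. \<Sum>i<n. [:0, cnj a:] ^ i"
  have p: "poly (?p n) z = (\<Sum>i<n. (cnj a * z) ^ i)" for n z
    by (simp add: poly_sum poly_power mult.commute)
  show "(\<lambda>n. poly (?p n) z) \<longlonglongrightarrow> 1 / (1 - cnj a * z)" if "z \<in> sphere 0 1" for z
  proof -
    have "norm (cnj a * z) < 1"
      using a that by (simp add: norm_mult)
    then show ?thesis
      unfolding p using geometric_sums[of "cnj a * z"] by (simp add: sums_def)
  qed
  show "cmod (poly (?p n) z) \<le> 1 / (1 - cmod a)" if "z \<in> sphere 0 1" for n z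
  proof -
    have "cmod (poly (?p n) z) \<le> (\<Sum>i<n. cmod a ^ i)"
      unfolding p using that by (intro sum_norm_le) (simp add: norm_power norm_mult)
    also have "\<dots> \<le> (\<Sum>i. cmod a ^ i)"
      using a by (intro sum_le_suminf summable_geometric) auto
    also have "\<dots> = 1 / (1 - cmod a)"
      using a by (simp add: suminf_geometric)
    finally show ?thesis .
  qed
qed

section \<open>Bounded approximation by real parts of polynomials\<close>

lemma Re_trig_term:
  "\<exists>p. \<forall>z\<in>sphere 0 1. Re (c * z powi d) = Re (poly p z)"
proof (cases "0 \<le> d")
  case True
  then show ?thesis
    by (intro exI[of _ "monom c (nat d)"]) (auto simp: poly_monom power_int_def)
next
  case False
  have "Re (c * z powi d) = Re (poly (monom (cnj c) (nat (-d))) z)" if z: "z \<in> sphere 0 1" for z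
  proof -
    have "poly (monom (cnj c) (nat (-d))) z = cnj (c * cnj z powi (-d))"
      using False by (simp add: poly_monom power_int_def)
    also have "\<dots> = cnj (c * z powi d)"
      using cnj_powi_sphere[OF z, of "-d"] by simp
    finally show ?thesis
      by (simp only: cnj.simps)
  qed
  then show ?thesis
    by blast
qed

lemma Re_fejer: "\<exists>p. \<forall>z\<in>sphere 0 1. Re (fejer N f z) = Re (poly p z)"
proof -
  define p where "p = (\<lambda>i j :: nat. SOME p. \<forall>z\<in>sphere 0 1.
      Re (fourier_coeff f (int i - int j) / of_nat N * z powi (int i - int j)) = Re (poly p z))"
  have p: "Re (fourier_coeff f (int i - int j) / of_nat N * z powi (int i - int j)) = Re (poly (p i j) z)"
    if "z \<in> sphere 0 1" for i j z
    using someI_ex[OF Re_trig_term] that unfolding p_def by blast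
  have "Re (fejer N f z) = Re (poly (\<Sum>i<N. \<Sum>j<N. p i j) z)" if "z \<in> sphere 0 1" for z
  proof -
    have "fejer N f z = (\<Sum>i<N. \<Sum>j<N. fourier_coeff f (int i - int j) / of_nat N * z powi (int i - int j))"
      by (simp add: fejer_def sum_divide_distrib)
    then show ?thesis
      by (simp only: poly_sum Re_sum p[OF that])
  qed
  then show ?thesis
    by blast
qed

text \<open>Fejer means of a real function keep its bound, and a subsequence converges almost
  everywhere. Their real parts are those of polynomials because conjugation reflects negative
  frequencies to positive ones.\<close>

lemma bounded_real_trig_approx:
  fixes v :: "complex \<Rightarrow> real"
  assumes v: "v \<in> borel_measurable circle" "AE z in circle. \<bar>v z\<bar> \<le> C"
  shows "\<exists>P :: nat \<Rightarrow> complex poly. (\<forall>n. \<forall>z\<in>sphere 0 1. \<bar>Re (poly (P n) z)\<bar> \<le> C) \<and>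
    (AE z in circle. (\<lambda>n. Re (poly (P n) z)) \<longlonglongrightarrow> v z)"
proof -
  let ?v = "\<lambda>z. complex_of_real (v z)"
  have v_bound: "AE z in circle. cmod (?v z) \<le> C"
    using v by simp
  have v_int: "integrable circle ?v"
    by (rule integrable_circle_bounded[OF _ v_bound]) (use v in simp)
  obtain r where r: "strict_mono r" "AE z in circle. (\<lambda>n. fejer (r n) ?v z) \<longlonglongrightarrow> ?v z"
    using fejer_AE_subseq[OF v_int] by blast
  define P where "P = (\<lambda>n. SOME p. \<forall>z\<in>sphere 0 1. Re (fejer n ?v z) = Re (poly p z))"
  have P: "Re (fejer n ?v z) = Re (poly (P n) z)" if "z \<in> sphere 0 1" for n z
    using someI_ex[OF Re_fejer] that unfolding P_def by blast
  show ?thesis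
  proof (intro exI[of _ "\<lambda>n. P (r (Suc n))"] conjI allI ballI)
    fix n and z :: complex
    assume z: "z \<in> sphere 0 1"
    have "r 0 < r (Suc n)"
      using r(1) by (simp add: strict_mono_less)
    then have "cmod (fejer (r (Suc n)) ?v z) \<le> C"
      by (intro norm_fejer_le v_int v_bound z) simp
    then show "\<bar>Re (poly (P (r (Suc n))) z)\<bar> \<le> C"
      unfolding P[OF z, symmetric] using abs_Re_le_cmod order_trans by blast
  next
    show "AE z in circle. (\<lambda>n. Re (poly (P (r (Suc n))) z)) \<longlonglongrightarrow> v z"
      using r(2) AE_space
    proof eventually_elim
      case (elim z)
      then have "(\<lambda>n. Re (fejer (r (Suc n)) ?v z)) \<longlonglongrightarrow> Re (?v z)"
        by (intro tendsto_Re) (rule LIMSEQ_Suc)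
      then show ?case
        using elim by (simp add: P)
    qed
  qed
qed

section \<open>Outer functions\<close>

text \<open>Since the mean is 1, the nonnegative function \<open>|r| - Re r\<close> has integral
  \<open>LINT |r| - 1\<close>, which the distance of the moduli from 1 bounds. So the arguments are
  controlled as well as the moduli.\<close>

lemma tendsto_L1_one:
  fixes r :: "nat \<Rightarrow> complex \<Rightarrow> complex"
  assumes int: "\<And>n. integrable circle (r n)"
    and mean: "\<And>n. (LINT z|circle. r n z) = 1"
    and lim: "(\<lambda>n. LINT z|circle. \<bar>cmod (r n z) - 1\<bar>) \<longlonglongrightarrow> 0"
  shows "(\<lambda>n. L1_norm (\<lambda>z. r n z - 1)) \<longlonglongrightarrow> 0"
proof (rule LIMSEQ_I)
  fix e :: real
  assume e: "0 < e"
  define d where "d = (\<lambda>n. LINT z|circle. \<bar>cmod (r n z) - 1\<bar>)"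
  \<comment> \<open>The free parameter of the arithmetic-geometric inequality below; the final bound
    tends to \<open>\<delta>\<close>, which therefore has to be less than \<open>e\<close>.\<close>
  define \<delta> where "\<delta> = e / 2"
  have \<delta>: "0 < \<delta>"
    using e by (simp add: \<delta>_def)
  have amgm: "4 * a * b \<le> (a + b)\<^sup>2" for a b :: real
    using zero_le_power2[of "a - b"] by (simp add: power2_eq_square algebra_simps)
  \<comment> \<open>With \<open>a = |r|\<close> and \<open>b = |r| - Re r\<close> one has \<open>|r - |r||\<^sup>2 = 2ab\<close>.\<close>
  have pointwise: "cmod (y - 1) \<le> \<bar>cmod y - 1\<bar> + \<delta> * cmod y + (cmod y - Re y) / (2 * \<delta>)" for y
  proof -
    have "cmod (y - of_real (cmod y)) \<le> \<delta> * cmod y + (cmod y - Re y) / (2 * \<delta>)"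
    proof (rule power2_le_imp_le)
      have "(cmod (y - of_real (cmod y)))\<^sup>2 = 2 * cmod y * (cmod y - Re y)"
      proof -
        have "(cmod (y - of_real (cmod y)))\<^sup>2 = (Re y - cmod y)\<^sup>2 + (Im y)\<^sup>2"
          by (subst cmod_power2) simp
        then show ?thesis
          using cmod_power2[of y] by (simp add: power2_eq_square algebra_simps)
      qed
      also have "\<dots> = 4 * (\<delta> * cmod y) * ((cmod y - Re y) / (2 * \<delta>))"
        using \<delta> by (simp add: field_simps)
      also have "\<dots> \<le> (\<delta> * cmod y + (cmod y - Re y) / (2 * \<delta>))\<^sup>2"
        by (rule amgm)
      finally show "(cmod (y - of_real (cmod y)))\<^sup>2 \<le> (\<delta> * cmod y + (cmod y - Re y) / (2 * \<delta>))\<^sup>2" .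
      show "0 \<le> \<delta> * cmod y + (cmod y - Re y) / (2 * \<delta>)"
        using \<delta> complex_Re_le_cmod[of y] by (intro add_nonneg_nonneg divide_nonneg_pos) auto
    qed
    moreover have "cmod (of_real (cmod y) - 1) = \<bar>cmod y - 1\<bar>"
      by (metis norm_of_real of_real_1 of_real_diff)
    moreover have "cmod (y - 1) \<le> cmod (y - of_real (cmod y)) + cmod (of_real (cmod y) - 1)"
      using norm_triangle_ineq[of "y - of_real (cmod y)" "of_real (cmod y) - 1"] by simp
    ultimately show ?thesis
      by linarith
  qed
  have bound: "L1_norm (\<lambda>z. r n z - 1) \<le> d n + \<delta> * (1 + d n) + d n / (2 * \<delta>)" for n
  proof -
    have Re1: "(LINT z|circle. Re (r n z)) = 1"
      using mean[of n] int[of n] by (subst integral_Re) auto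
    have norm1: "(LINT z|circle. cmod (r n z)) \<le> 1 + d n"
    proof -
      have "(LINT z|circle. cmod (r n z)) \<le> (LINT z|circle. 1 + \<bar>cmod (r n z) - 1\<bar>)"
        using int[of n] by (intro integral_mono) auto
      then show ?thesis
        using int[of n] by (simp add: d_def)
    qed
    have "L1_norm (\<lambda>z. r n z - 1) \<le>
        (LINT z|circle. \<bar>cmod (r n z) - 1\<bar> + \<delta> * cmod (r n z) + (cmod (r n z) - Re (r n z)) / (2 * \<delta>))"
      unfolding L1_norm_def using int[of n] pointwise by (intro integral_mono) auto
    also have "\<dots> = d n + \<delta> * (LINT z|circle. cmod (r n z)) +
        ((LINT z|circle. cmod (r n z)) - 1) / (2 * \<delta>)"
      using int[of n] Re1 by (simp add: d_def)
    also have "\<dots> \<le> d n + \<delta> * (1 + d n) + d n / (2 * \<delta>)"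
      using norm1 \<delta> by (intro add_mono mult_left_mono divide_right_mono) auto
    finally show ?thesis .
  qed
  have "(\<lambda>n. d n + \<delta> * (1 + d n) + d n / (2 * \<delta>)) \<longlonglongrightarrow> 0 + \<delta> * (1 + 0) + 0 / (2 * \<delta>)"
    using lim \<delta> by (intro tendsto_intros) (auto simp: d_def)
  then have "eventually (\<lambda>n. d n + \<delta> * (1 + d n) + d n / (2 * \<delta>) < e) sequentially"
    by (rule order_tendstoD(2)) (use e in \<open>simp add: \<delta>_def\<close>)
  then have "eventually (\<lambda>n. L1_norm (\<lambda>z. r n z - 1) < e) sequentially"
    by eventually_elim (use bound in \<open>rule le_less_trans\<close>)
  then show "\<exists>no. \<forall>n\<ge>no. norm (L1_norm (\<lambda>z. r n z - 1) - 0) < e"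
    by (simp add: eventually_sequentially)
qed

text \<open>Continuity of the functional \<open>J\<close> of the next proof, where it is applied
  once to truncated logarithms and once to polynomials. Centring the exponent only contributes the
  convergent, hence bounded, factor \<open>exp (- mean)\<close>.\<close>

lemma weight_limit:
  fixes v :: "nat \<Rightarrow> complex \<Rightarrow> real"
  assumes v: "\<And>n. v n \<in> borel_measurable circle" and w: "w \<in> borel_measurable circle"
    and u: "integrable circle u"
    and mean: "(\<lambda>n. LINT z|circle. v n z) \<longlonglongrightarrow> m"
    and lim: "AE z in circle. (\<lambda>n. exp (v n z) * w z) \<longlonglongrightarrow> g z" "g \<in> borel_measurable circle"
    and bound: "\<And>n. AE z in circle. \<bar>exp (v n z) * w z\<bar> \<le> u z"
  shows "(\<lambda>n. LINT z|circle. \<bar>exp (v n z - (LINT z|circle. v n z)) * w z - c\<bar>)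
    \<longlonglongrightarrow> (LINT z|circle. \<bar>exp (- m) * g z - c\<bar>)"
proof -
  define a where "a = (\<lambda>n. exp (- (LINT z|circle. v n z)))"
  have a: "a \<longlonglongrightarrow> exp (- m)"
    unfolding a_def by (intro tendsto_intros mean)
  obtain B where B: "\<And>n. \<bar>a n\<bar> \<le> B"
    using convergent_imp_Bseq[of a] a by (auto simp: Bseq_def convergent_def)
  have eq: "exp (v n z - (LINT z|circle. v n z)) * w z = a n * (exp (v n z) * w z)" for n z
    by (simp add: a_def exp_diff exp_minus field_simps)
  show ?thesis
    unfolding eq
  proof (rule integral_dominated_convergence[where w = "\<lambda>z. B * u z + \<bar>c\<bar>"])
    show "AE z in circle. (\<lambda>n. \<bar>a n * (exp (v n z) * w z) - c\<bar>) \<longlonglongrightarrow> \<bar>exp (- m) * g z - c\<bar>"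
      using lim(1) by eventually_elim (intro tendsto_intros a)
    show "AE z in circle. norm \<bar>a n * (exp (v n z) * w z) - c\<bar> \<le> B * u z + \<bar>c\<bar>" for n
      using bound[of n]
    proof eventually_elim
      case (elim z)
      have "\<bar>a n * (exp (v n z) * w z)\<bar> \<le> B * u z"
        unfolding abs_mult[of "a n"] using elim B[of n] by (intro mult_mono) auto
      then show ?case
        using abs_triangle_ineq4[of "a n * (exp (v n z) * w z)" c] by simp
    qed
  qed (use u v w lim in auto)
qed

text \<open>The exponent \<open>- ln w\<close>, centred by its mean, would turn \<open>w\<close>
  into the constant \<open>exp (LINT ln w)\<close>, but it is neither bounded nor trigonometric.
  Clamping \<open>w\<close> between \<open>1 / (n + 1)\<close> and \<open>n + 1\<close> makes it
  bounded; bounded trigonometric approximation does the rest.\<close>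

lemma outer_exp_approx:
  fixes w :: "complex \<Rightarrow> real"
  assumes w: "integrable circle w" "\<And>z. 0 \<le> w z" "AE z in circle. 0 < w z"
    and ln: "integrable circle (\<lambda>z. ln (w z))"
    and e: "0 < e"
  shows "\<exists>P. coeff P 0 = 0 \<and>
    (LINT z|circle. \<bar>exp (Re (poly P z)) * w z - exp (LINT z|circle. ln (w z))\<bar>) < e"
proof -
  define L where "L = (LINT z|circle. ln (w z))"
  define J where "J = (\<lambda>v. LINT z|circle. \<bar>exp (v z - (LINT z|circle. v z)) * w z - exp L\<bar>)"
  define v where "v = (\<lambda>n z. - ln (min (max (w z) (1 / real (Suc n))) (real (Suc n))))"
  have w_meas [measurable]: "w \<in> borel_measurable circle"
    using w by simp
  have v_meas [measurable]: "v n \<in> borel_measurable circle" for n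
    unfolding v_def by measurable
  have clamp: "1 / real (Suc n) \<le> min (max x (1 / real (Suc n))) (real (Suc n))"
      "min (max x (1 / real (Suc n))) (real (Suc n)) \<le> real (Suc n)" for x n
    by (auto simp: min_def max_def field_simps)
  have v_bound: "\<bar>v n z\<bar> \<le> ln (real (Suc n))" for n z
  proof -
    have pos: "0 < 1 / real (Suc n)"
      by simp
    have "ln (1 / real (Suc n)) \<le> ln (min (max (w z) (1 / real (Suc n))) (real (Suc n)))"
      using clamp(1)[where x = "w z" and n = n] pos by (subst ln_le_cancel_iff) linarith+
    moreover have "ln (min (max (w z) (1 / real (Suc n))) (real (Suc n))) \<le> ln (real (Suc n))"
      using clamp[where x = "w z" and n = n] pos by (subst ln_le_cancel_iff) linarith+
    ultimately show ?thesis
      by (simp add: v_def ln_div)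
  qed
  have v_eventually: "AE z in circle. eventually (\<lambda>n. v n z = - ln (w z)) sequentially"
    using w(3)
  proof eventually_elim
    case (elim z)
    obtain N where N: "max (w z) (1 / w z) < real N"
      using reals_Archimedean2 by blast
    have "v n z = - ln (w z)" if n: "n \<ge> N" for n
    proof -
      have "real N \<le> real (Suc n)"
        using n by simp
      then have "w z < real (Suc n)" "1 / w z < real (Suc n)"
        using N by linarith+
      then have "1 / real (Suc n) < w z"
        using elim by (simp add: field_simps)
      then show ?thesis
        using \<open>w z < real (Suc n)\<close> by (simp add: v_def max_def min_def)
    qed
    then show ?case
      by (auto simp: eventually_sequentially)
  qed
  have v_abs: "\<bar>v n z\<bar> \<le> \<bar>ln (w z)\<bar>" if pos: "0 < w z" for n z
  proof -
    have le: "1 / real (Suc n) \<le> 1" "1 \<le> real (Suc n)" "0 < 1 / real (Suc n)"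
      by (auto simp: field_simps)
    show ?thesis
    proof (cases "w z \<le> 1")
      case True
      then have "min (max (w z) (1 / real (Suc n))) (real (Suc n)) = max (w z) (1 / real (Suc n))"
        using le by linarith
      moreover have "max (w z) (1 / real (Suc n)) \<le> 1" "w z \<le> max (w z) (1 / real (Suc n))"
        using True le by auto
      ultimately show ?thesis
        using pos True ln_mono[of "w z" "max (w z) (1 / real (Suc n))"]
          ln_le_zero_iff[of "max (w z) (1 / real (Suc n))"] ln_le_zero_iff[of "w z"]
        unfolding v_def by linarith
    next
      case False
      then have eq: "min (max (w z) (1 / real (Suc n))) (real (Suc n)) = min (w z) (real (Suc n))"
        using le by linarith
      have "1 \<le> min (w z) (real (Suc n))" "min (w z) (real (Suc n)) \<le> w z"
        using False le by auto
      then show ?thesis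
        using pos False ln_mono[of "min (w z) (real (Suc n))" "w z"]
          ln_ge_zero[of "min (w z) (real (Suc n))"] ln_ge_zero[of "w z"]
        unfolding v_def eq by linarith
    qed
  qed
  \<comment> \<open>The quotient of \<open>w\<close> by its clamped value exceeds 1 only where the
    upper clamp acts, and there the denominator is at least 1. Thus \<open>max 1 w\<close> is an
    integrable majorant.\<close>
  have v_exp: "exp (v n z) * w z \<le> max 1 (w z)" if pos: "0 < w z" for n z
  proof -
    define c where "c = min (max (w z) (1 / real (Suc n))) (real (Suc n))"
    have c: "0 < c"
      using clamp(1)[where x = "w z" and n = n] unfolding c_def by (rule less_le_trans[rotated]) simp
    have "v n z = - ln c"
      by (simp only: v_def c_def)
    then have "exp (v n z) * w z = w z / c"
      using c by (simp add: exp_minus divide_inverse mult.commute)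
    moreover have "w z / c \<le> max 1 (w z)"
    proof (cases "w z \<le> c")
      case True
      then have "w z / c \<le> 1"
        using c by simp
      then show ?thesis
        by simp
    next
      case False
      then have "c = real (Suc n)"
        unfolding c_def by (auto simp: min_def max_def split: if_splits)
      then have "w z / c \<le> w z"
        using pos by (simp add: field_simps)
      then show ?thesis
        by simp
    qed
    ultimately show ?thesis
      by simp
  qed
  have mean: "(\<lambda>n. LINT z|circle. v n z) \<longlonglongrightarrow> - L"
    unfolding L_def integral_minus[symmetric]
  proof (rule integral_dominated_convergence[where w = "\<lambda>z. \<bar>ln (w z)\<bar>"])
    show "AE z in circle. (\<lambda>n. v n z) \<longlonglongrightarrow> - ln (w z)"
      using v_eventually by eventually_elim (rule tendsto_eventually)
    show "AE z in circle. norm (v n z) \<le> \<bar>ln (w z)\<bar>" for n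
      using w(3) by eventually_elim (simp add: v_abs)
  qed (use ln in auto)
  have "(\<lambda>n. J (v n)) \<longlonglongrightarrow> (LINT z|circle. \<bar>exp (- (- L)) * 1 - exp L\<bar>)"
    unfolding J_def
  proof (rule weight_limit[where u = "\<lambda>z. max 1 (w z)"])
    show "AE z in circle. (\<lambda>n. exp (v n z) * w z) \<longlonglongrightarrow> 1"
      using v_eventually w(3)
    proof eventually_elim
      case (elim z)
      then have "eventually (\<lambda>n. exp (v n z) * w z = 1) sequentially"
        by (auto elim!: eventually_mono simp: exp_minus)
      then show ?case
        by (rule tendsto_eventually)
    qed
    show "AE z in circle. \<bar>exp (v n z) * w z\<bar> \<le> max 1 (w z)" for n
      using w(3) by eventually_elim (simp add: v_exp abs_mult)
  qed (use mean w in auto)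
  then have "(\<lambda>n. J (v n)) \<longlonglongrightarrow> 0"
    by simp
  then have "eventually (\<lambda>n. J (v n) < e) sequentially"
    using e by (rule order_tendstoD(2))
  then obtain N where N: "J (v N) < e"
    by (auto simp: eventually_sequentially)
  define C where "C = ln (real (Suc N))"
  have "AE z in circle. \<bar>v N z\<bar> \<le> C"
    unfolding C_def using v_bound by (intro AE_I2)
  then obtain P where P0: "\<forall>n. \<forall>z\<in>sphere 0 1. \<bar>Re (poly (P n) z)\<bar> \<le> C"
      and P2: "AE z in circle. (\<lambda>n. Re (poly (P n) z)) \<longlonglongrightarrow> v N z"
    using bounded_real_trig_approx[OF v_meas] by blast
  have P1: "\<bar>Re (poly (P n) z)\<bar> \<le> C" if "z \<in> sphere 0 1" for n z
    using P0 that by blast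
  note P = P1 P2
  have meanP: "(\<lambda>n. LINT z|circle. Re (poly (P n) z)) \<longlonglongrightarrow> (LINT z|circle. v N z)"
    by (rule integral_dominated_convergence[where w = "\<lambda>z. C"]) (use P in \<open>auto intro!: AE_I2\<close>)
  have "(\<lambda>n. J (\<lambda>z. Re (poly (P n) z))) \<longlonglongrightarrow>
      (LINT z|circle. \<bar>exp (- (LINT z|circle. v N z)) * (exp (v N z) * w z) - exp L\<bar>)"
    unfolding J_def
  proof (rule weight_limit[where u = "\<lambda>z. exp C * w z"])
    show "AE z in circle. (\<lambda>n. exp (Re (poly (P n) z)) * w z) \<longlonglongrightarrow> exp (v N z) * w z"
      using P(2) by eventually_elim (intro tendsto_intros)
    show "AE z in circle. \<bar>exp (Re (poly (P n) z)) * w z\<bar> \<le> exp C * w z" for n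
    proof (rule AE_I2)
      fix z assume "z \<in> space circle"
      then have "Re (poly (P n) z) \<le> C"
        using P(1)[of z n] by simp
      then show "\<bar>exp (Re (poly (P n) z)) * w z\<bar> \<le> exp C * w z"
        using w(2)[of z] by (simp add: abs_mult mult_right_mono)
    qed
  qed (use meanP w in auto)
  also have "(LINT z|circle. \<bar>exp (- (LINT z|circle. v N z)) * (exp (v N z) * w z) - exp L\<bar>) = J (v N)"
    unfolding J_def by (simp add: exp_diff exp_minus field_simps)
  finally have "eventually (\<lambda>n. J (\<lambda>z. Re (poly (P n) z)) < e) sequentially"
    using N by (rule order_tendstoD(2))
  then obtain n where n: "J (\<lambda>z. Re (poly (P n) z)) < e"
    by (auto simp: eventually_sequentially)
  \<comment> \<open>The mean of \<open>Re P\<close> is the real part of the constant coefficient, so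
    removing that coefficient is exactly the centring in \<open>J\<close>; it also gives
    \<open>exp Q\<close> the mean 1.\<close>
  let ?Q = "P n - [:coeff (P n) 0:]"
  have "(LINT z|circle. poly (P n) z) = coeff (P n) 0"
    using fourier_coeff_poly[of "P n" 0] by (simp add: fourier_coeff_altdef)
  then have "(LINT z|circle. Re (poly (P n) z)) = Re (coeff (P n) 0)"
    by simp
  then have "(LINT z|circle. \<bar>exp (Re (poly ?Q z)) * w z - exp L\<bar>) < e"
    using n unfolding J_def by simp
  then show ?thesis
    unfolding L_def by (intro exI[of _ ?Q]) simp
qed

lemma Hinf_cmult:
  assumes "f \<in> Hinf"
  shows "(\<lambda>z. c * f z) \<in> Hinf"
proof -
  obtain C where C: "AE z in circle. cmod (f z) \<le> C"
    using assms by (auto simp: Hinf_def)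
  have "AE z in circle. cmod (c * f z) \<le> cmod c * C"
    using C by eventually_elim (simp add: norm_mult mult_left_mono)
  then show ?thesis
    using assms H1_cmult[of f c] by (auto simp: Hinf_def)
qed

lemma outer_fourier_coeff_0:
  assumes "is_outer F"
  shows "fourier_coeff F 0 \<noteq> 0" "cmod (fourier_coeff F 0) = exp (LINT z|circle. ln (cmod (F z)))"
proof -
  have "poisson F 0 = (LINT z|circle. F z)"
    unfolding poisson_def by (intro Bochner_Integration.integral_cong) auto
  then have eq: "poisson F 0 = fourier_coeff F 0"
    by (simp add: fourier_coeff_altdef)
  then show nz: "fourier_coeff F 0 \<noteq> 0"
    using assms by (simp add: is_outer_def)
  have "ln (cmod (fourier_coeff F 0)) = (LINT z|circle. ln (cmod (F z)))"
    using assms eq by (simp add: is_outer_def)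
  then show "cmod (fourier_coeff F 0) = exp (LINT z|circle. ln (cmod (F z)))"
    using nz exp_ln[of "cmod (fourier_coeff F 0)"] by simp
qed

text \<open>Jensen's equality makes two constants agree: \<open>E * F\<close> has mean
  \<open>A\<close> because \<open>E\<close> has mean 1, and its modulus tends to
  \<open>exp (LINT ln |F|) = |A|\<close>. After division by \<open>A\<close>, both the mean and the
  limiting modulus are 1, as \<open>tendsto_L1_one\<close> requires.\<close>

lemma outer_inverse_approx:
  assumes F: "is_outer F"
  shows "\<exists>E. (\<forall>n. E n \<in> Hinf) \<and> (\<lambda>n. L1_norm (\<lambda>z. E n z * F z - 1)) \<longlonglongrightarrow> 0"
proof -
  have F_H1: "F \<in> H1"
    using F by (simp add: is_outer_def)
  define A where "A = fourier_coeff F 0"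
  have A: "A \<noteq> 0" "cmod A = exp (LINT z|circle. ln (cmod (F z)))"
    unfolding A_def using outer_fourier_coeff_0[OF F] by auto
  have "\<exists>P. coeff P 0 = 0 \<and> (LINT z|circle. \<bar>exp (Re (poly P z)) * cmod (F z) - cmod A\<bar>) < 1 / real (Suc n)" for n
    unfolding A(2) using F H1_integrable[OF F_H1]
    by (intro outer_exp_approx) (auto simp: is_outer_def)
  then obtain P where P: "\<And>n. coeff (P n) 0 = 0"
      "\<And>n. (LINT z|circle. \<bar>exp (Re (poly (P n) z)) * cmod (F z) - cmod A\<bar>) < 1 / real (Suc n)"
    by metis
  define d where "d = (\<lambda>n. LINT z|circle. \<bar>exp (Re (poly (P n) z)) * cmod (F z) - cmod A\<bar>)"
  define E where "E = (\<lambda>n z. exp (poly (P n) z))"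
  have E: "E n \<in> Hinf" "fourier_coeff (E n) 0 = 1" for n
    using exp_poly_Hinf[of "P n"] P(1)[of n] by (auto simp: E_def)
  define r where "r = (\<lambda>n z. E n z * F z / A)"
  have EF: "(\<lambda>z. E n z * F z) \<in> H1" "fourier_coeff (\<lambda>z. E n z * F z) 0 = A" for n
    using H1_mult_Hinf[OF F_H1 E(1)[of n]] E(2)[of n] by (auto simp: A_def)
  have r_int: "integrable circle (r n)" for n
    unfolding r_def using H1_integrable[OF EF(1)[of n]] by auto
  have "(\<lambda>n. L1_norm (\<lambda>z. r n z - 1)) \<longlonglongrightarrow> 0"
  proof (rule tendsto_L1_one[OF r_int])
    show "(LINT z|circle. r n z) = 1" for n
      using EF(2)[of n] A(1) by (simp add: r_def fourier_coeff_altdef)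
    have eq: "(LINT z|circle. \<bar>cmod (r n z) - 1\<bar>) = d n / cmod A" for n
    proof -
      have "\<bar>cmod (r n z) - 1\<bar> = \<bar>exp (Re (poly (P n) z)) * cmod (F z) - cmod A\<bar> / cmod A" for z
      proof -
        have "cmod (r n z) - 1 = (exp (Re (poly (P n) z)) * cmod (F z) - cmod A) / cmod A"
          using A(1) by (simp add: r_def E_def norm_mult norm_divide norm_exp_eq_Re field_simps)
        then show ?thesis
          by simp
      qed
      then show ?thesis
        by (simp add: d_def)
    qed
    have "d \<longlonglongrightarrow> 0"
    proof (rule Lim_null_comparison)
      show "(\<lambda>n. 1 / real (Suc n)) \<longlonglongrightarrow> 0"
        using LIMSEQ_Suc[OF lim_const_over_n[of "1 :: real"]] by simp
      show "eventually (\<lambda>n. norm (d n) \<le> 1 / real (Suc n)) sequentially"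
        using P(2) by (auto simp: d_def intro!: always_eventually less_imp_le)
    qed
    then show "(\<lambda>n. LINT z|circle. \<bar>cmod (r n z) - 1\<bar>) \<longlonglongrightarrow> 0"
      unfolding eq using tendsto_divide_zero by blast
  qed
  moreover have "(\<lambda>z. E n z / A) \<in> Hinf" for n
    using Hinf_cmult[OF E(1)[of n], of "inverse A"] by (simp add: divide_inverse_commute)
  ultimately show ?thesis
    by (intro exI[of _ "\<lambda>n z. E n z / A"]) (simp add: r_def)
qed

text \<open>Smirnov's maximum principle: bounded analytic approximants \<open>E\<close> of \<open>1/F\<close> turn \<open>F * G\<close>
  into analytic approximants \<open>E * F * G\<close> of \<open>G\<close>.\<close>

theorem outer_quotient_H1:
  assumes F: "is_outer F" and G: "G \<in> borel_measurable circle" "AE z in circle. cmod (G z) \<le> C"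
    and FG: "(\<lambda>z. F z * G z) \<in> H1"
  shows "G \<in> H1"
proof -
  obtain E where E: "\<And>n. E n \<in> Hinf" and lim: "(\<lambda>n. L1_norm (\<lambda>z. E n z * F z - 1)) \<longlonglongrightarrow> 0"
    using outer_inverse_approx[OF F] by blast
  have F_H1: "F \<in> H1"
    using F by (simp add: is_outer_def)
  have G_int: "integrable circle G"
    using G by (rule integrable_circle_bounded)
  show ?thesis
  proof (rule H1_L1_limit[where s = "\<lambda>n z. E n z * (F z * G z)"])
    show "(\<lambda>z. E n z * (F z * G z)) \<in> H1" for n
      by (rule H1_mult_Hinf[OF FG E])
    show "(\<lambda>n. L1_norm (\<lambda>z. E n z * (F z * G z) - G z)) \<longlonglongrightarrow> 0"
    proof (rule Lim_null_comparison)
      show "(\<lambda>n. C * L1_norm (\<lambda>z. E n z * F z - 1)) \<longlonglongrightarrow> 0"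
        using lim by (rule tendsto_mult_right_zero)
      have "L1_norm (\<lambda>z. E n z * (F z * G z) - G z) \<le> C * L1_norm (\<lambda>z. E n z * F z - 1)" for n
      proof -
        have "integrable circle (\<lambda>z. E n z * F z - 1)"
          using H1_integrable[OF H1_mult_Hinf(1)[OF F_H1 E]] by simp
        from L1_norm_mult_le[OF this G] show ?thesis
          by (simp add: algebra_simps)
      qed
      then show "eventually (\<lambda>n. norm (L1_norm (\<lambda>z. E n z * (F z * G z) - G z)) \<le>
          C * L1_norm (\<lambda>z. E n z * F z - 1)) sequentially"
        by simp
    qed
  qed (rule G_int)
qed

section \<open>Extreme points and real multipliers\<close>

lemma H1_gap_integrable: "f \<in> H1_gap K \<Longrightarrow> integrable circle f"
  by (simp add: H1_gap_def H1_integrable)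

lemma H1_gap_measurable: "f \<in> H1_gap K \<Longrightarrow> f \<in> borel_measurable circle"
  by (rule borel_measurable_integrable[OF H1_gap_integrable])

lemma H1_gap_add: "f \<in> H1_gap K \<Longrightarrow> g \<in> H1_gap K \<Longrightarrow> (\<lambda>z. f z + g z) \<in> H1_gap K"
  by (simp add: H1_gap_def H1_add H1_integrable fourier_coeff_add)

lemma H1_gap_cmult: "f \<in> H1_gap K \<Longrightarrow> (\<lambda>z. c * f z) \<in> H1_gap K"
  by (simp add: H1_gap_def H1_cmult fourier_coeff_cmult)

lemma H1_gap_cong_AE:
  assumes "f \<in> H1_gap K" "AE z in circle. f z = g z" "g \<in> borel_measurable circle"
  shows "g \<in> H1_gap K"
proof -
  have f: "f \<in> H1" and zero: "\<And>k. k \<in> K \<Longrightarrow> fourier_coeff f k = 0"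
    using assms(1) by (auto simp: H1_gap_def)
  have "fourier_coeff f k = fourier_coeff g k" for k
    by (rule fourier_coeff_cong_AE[OF assms(2) H1_measurable[OF f] assms(3)])
  then show ?thesis
    using H1_cong_AE[OF f assms(2,3)] zero by (simp add: H1_gap_def)
qed

text \<open>For \<open>y = a / (a + b)\<close> one has
  \<open>|y| + |1 - y| = 1 = Re y + Re (1 - y)\<close>, so neither modulus can exceed the
  corresponding real part.\<close>

lemma proportional_summands:
  fixes a b :: complex
  assumes "cmod (a + b) = cmod a + cmod b" "a + b \<noteq> 0"
  shows "a = (a + b) * of_real (Re (a / (a + b)))" "\<bar>Re (a / (a + b))\<bar> \<le> 1"
proof -
  define y where "y = a / (a + b)"
  have sum: "cmod y + cmod (1 - y) = 1"
  proof -
    have "1 - y = b / (a + b)"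
      using assms(2) by (simp add: y_def field_simps)
    moreover have "cmod a + cmod b \<noteq> 0"
      using assms by (metis norm_eq_zero)
    ultimately show ?thesis
      using assms by (simp add: y_def norm_divide add_divide_distrib[symmetric])
  qed
  have "cmod y = Re y"
    using complex_Re_le_cmod[of y] complex_Re_le_cmod[of "1 - y"] sum by simp
  then have "(Im y)\<^sup>2 = 0"
    using cmod_power2[of y] by simp
  then have "y = of_real (Re y)"
    by (simp add: complex_eq_iff)
  then show "a = (a + b) * of_real (Re (a / (a + b)))"
    using assms(2) by (metis y_def nonzero_mult_div_cancel_left times_divide_eq_right)
  show "\<bar>Re (a / (a + b))\<bar> \<le> 1"
    using abs_Re_le_cmod[of y] norm_ge_zero[of "1 - y"] sum unfolding y_def[symmetric] by linarith
qed

lemma extreme_pointI: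
  assumes f: "f \<in> H1_gap K" "L1_norm f = 1" "AE z in circle. f z \<noteq> 0"
    and const: "\<And>h :: complex \<Rightarrow> real. h \<in> borel_measurable circle \<Longrightarrow> AE z in circle. \<bar>h z\<bar> \<le> 1 \<Longrightarrow>
      (\<lambda>z. f z * of_real (h z)) \<in> H1_gap K \<Longrightarrow> \<exists>c. AE z in circle. h z = c"
  shows "extreme_point f (unit_ball (H1_gap K))"
  unfolding extreme_point_def
proof (intro conjI notI)
  show "f \<in> unit_ball (H1_gap K)"
    using f by (simp add: unit_ball_def)
  assume "\<exists>g h. \<not> (AE z in circle. g z = h z) \<and>
    (\<forall>t\<in>{0..1}. (\<lambda>z. (1 - t) *\<^sub>R g z + t *\<^sub>R h z) \<in> unit_ball (H1_gap K)) \<and>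
    (\<exists>t\<in>{0<..<1}. AE z in circle. f z = (1 - t) *\<^sub>R g z + t *\<^sub>R h z)"
  then obtain g h t where ne: "\<not> (AE z in circle. g z = h z)"
    and seg: "\<And>t. t \<in> {0..1} \<Longrightarrow> (\<lambda>z. (1 - t) *\<^sub>R g z + t *\<^sub>R h z) \<in> unit_ball (H1_gap K)"
    and t: "0 < t" "t < 1"
    and eq: "AE z in circle. f z = (1 - t) *\<^sub>R g z + t *\<^sub>R h z"
    by auto
  have g: "g \<in> H1_gap K" "L1_norm g \<le> 1"
    using seg[of 0] by (auto simp: unit_ball_def)
  have h: "h \<in> H1_gap K" "L1_norm h \<le> 1"
    using seg[of 1] by (auto simp: unit_ball_def)
  note int = H1_gap_integrable[OF f(1)] H1_gap_integrable[OF g(1)] H1_gap_integrable[OF h(1)]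
  note meas [measurable] = H1_gap_measurable[OF f(1)] H1_gap_measurable[OF g(1)] H1_gap_measurable[OF h(1)]
  \<comment> \<open>The pointwise defect in the triangle inequality. It is nonnegative, and the norm
    conditions make its integral nonpositive, so it vanishes almost everywhere.\<close>
  define D where "D = (\<lambda>z. (1 - t) * cmod (g z) + t * cmod (h z) - cmod (f z))"
  have D_int: "integrable circle D"
    unfolding D_def using int by auto
  have D_nonneg: "AE z in circle. 0 \<le> D z"
    using eq
  proof eventually_elim
    case (elim z)
    have "cmod (f z) \<le> cmod ((1 - t) *\<^sub>R g z) + cmod (t *\<^sub>R h z)"
      unfolding elim by (rule norm_triangle_ineq)
    then show ?case
      using t by (simp add: D_def)
  qed
  have "(LINT z|circle. D z) = (1 - t) * L1_norm g + t * L1_norm h - L1_norm f"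
    unfolding D_def L1_norm_def using int by simp
  also have "\<dots> \<le> (1 - t) * 1 + t * 1 - 1"
    using t g h f by (intro diff_mono add_mono mult_left_mono) auto
  finally have "(LINT z|circle. D z) = 0"
    using integral_nonneg_AE[OF D_nonneg] by simp
  then have D0: "AE z in circle. D z = 0"
    using integral_nonneg_eq_0_iff_AE[OF D_int D_nonneg] by simp
  define k where "k = (\<lambda>z. Re ((1 - t) *\<^sub>R g z / f z))"
  have k: "AE z in circle. \<bar>k z\<bar> \<le> 1 \<and> f z * of_real (k z) = (1 - t) *\<^sub>R g z"
    using eq D0 f(3)
  proof eventually_elim
    case (elim z)
    then have "cmod ((1 - t) *\<^sub>R g z + t *\<^sub>R h z) = cmod ((1 - t) *\<^sub>R g z) + cmod (t *\<^sub>R h z)"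
      using t by (simp add: D_def)
    from proportional_summands[OF this] show ?case
      using elim by (simp add: k_def)
  qed
  have "\<exists>c. AE z in circle. k z = c"
  proof (rule const)
    show k_meas: "k \<in> borel_measurable circle"
      unfolding k_def by measurable
    show "AE z in circle. \<bar>k z\<bar> \<le> 1"
      using k by eventually_elim simp
    show "(\<lambda>z. f z * of_real (k z)) \<in> H1_gap K"
    proof (rule H1_gap_cong_AE[OF H1_gap_cmult[OF g(1), of "of_real (1 - t)"]])
      show "AE z in circle. complex_of_real (1 - t) * g z = f z * of_real (k z)"
        using k by eventually_elim (simp add: scaleR_conv_of_real)
    qed (use k_meas in measurable)
  qed
  then obtain c where c: "AE z in circle. k z = c"
    by blast
  have g_eq: "AE z in circle. g z = of_real (c / (1 - t)) * f z"
    using k c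
  proof eventually_elim
    case (elim z)
    then have "of_real (1 - t) * g z = of_real c * f z"
      by (simp add: scaleR_conv_of_real mult.commute)
    then show ?case
      using t by (simp add: field_simps)
  qed
  have h_eq: "AE z in circle. h z = of_real ((1 - c) / t) * f z"
    using k c eq
  proof eventually_elim
    case (elim z)
    have "of_real t * h z = f z - (1 - t) *\<^sub>R g z"
      unfolding elim(3) by (simp add: scaleR_conv_of_real)
    also have "(1 - t) *\<^sub>R g z = f z * of_real c"
      using elim(1,2) by simp
    finally have "of_real t * h z = of_real (1 - c) * f z"
      by (simp add: algebra_simps)
    then show ?case
      using t by (simp add: field_simps)
  qed
  \<comment> \<open>Now \<open>g\<close> and \<open>h\<close> are multiples of \<open>f\<close>;
    their norm bounds give \<open>c \<le> 1 - t\<close> and \<open>1 - c \<le> t\<close>, which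
    pinches \<open>c\<close> and makes both factors 1.\<close>
  have "L1_norm g = L1_norm (\<lambda>z. of_real (c / (1 - t)) * f z)"
    unfolding L1_norm_def using g_eq by (intro integral_cong_AE) auto
  then have "\<bar>c / (1 - t)\<bar> \<le> 1"
    using g(2) by (simp only: L1_norm_cmult f norm_of_real mult_1_right)
  moreover have "L1_norm h = L1_norm (\<lambda>z. of_real ((1 - c) / t) * f z)"
    unfolding L1_norm_def using h_eq by (intro integral_cong_AE) auto
  then have "\<bar>(1 - c) / t\<bar> \<le> 1"
    using h(2) by (simp only: L1_norm_cmult f norm_of_real mult_1_right)
  ultimately have "c \<le> 1 - t" "1 - c \<le> t"
    using t by (auto simp: abs_le_iff field_simps)
  then have c_eq: "c = 1 - t"
    by simp
  have "AE z in circle. g z = h z"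
    using g_eq h_eq by eventually_elim (use t in \<open>simp add: c_eq\<close>)
  then show False
    using ne by contradiction
qed

text \<open>Centring \<open>h\<close> with respect to the weight \<open>|f|\<close> and scaling it
  below 1 gives \<open>k\<close> for which \<open>|f * (1 + s * k)| = |f| * (1 + s * k)\<close> has
  integral 1 whenever \<open>|s| \<le> 1\<close>. Thus \<open>f\<close> is the midpoint of a segment
  in the unit sphere, nondegenerate unless \<open>h\<close> is constant.\<close>

lemma extreme_pointD:
  fixes h :: "complex \<Rightarrow> real"
  assumes extreme: "extreme_point f (unit_ball (H1_gap K))"
    and f: "f \<in> H1_gap K" "L1_norm f = 1" "AE z in circle. f z \<noteq> 0"
    and h: "h \<in> borel_measurable circle" "AE z in circle. \<bar>h z\<bar> \<le> C"
    and fh: "(\<lambda>z. f z * of_real (h z)) \<in> H1_gap K"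
  shows "\<exists>c. AE z in circle. h z = c"
proof (rule ccontr)
  assume nconst: "\<not> (\<exists>c. AE z in circle. h z = c)"
  note int = H1_gap_integrable[OF f(1)]
  note meas [measurable] = H1_gap_measurable[OF f(1)] h(1)
  define m where "m = (LINT z|circle. cmod (f z) * h z)"
  \<comment> \<open>Bounds \<open>|h - m|\<close> almost everywhere; the summand 1 keeps the divisor
    positive.\<close>
  define D where "D = \<bar>C\<bar> + \<bar>m\<bar> + 1"
  define k where "k = (\<lambda>z. (h z - m) / D)"
  have D: "0 < D"
    by (simp add: D_def)
  have k_meas [measurable]: "k \<in> borel_measurable circle"
    unfolding k_def by measurable
  have k_bound: "AE z in circle. \<bar>k z\<bar> \<le> 1"
    using h(2)
  proof eventually_elim
    case (elim z)
    then have "\<bar>h z - m\<bar> \<le> D"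
      by (simp add: D_def)
    then show ?case
      using D by (simp add: k_def)
  qed
  have fh_int: "integrable circle (\<lambda>z. cmod (f z) * h z)"
    using integrable_mult_bounded[of "\<lambda>z. cmod (f z)" h C] int h by (simp add: mult.commute)
  have fk_eq: "cmod (f z) * k z = (cmod (f z) * h z - m * cmod (f z)) / D" for z
    by (simp add: k_def right_diff_distrib mult.commute)
  have fk_int: "integrable circle (\<lambda>z. cmod (f z) * k z)"
    unfolding fk_eq using fh_int int by auto
  have fk_0: "(LINT z|circle. cmod (f z) * k z) = 0"
    unfolding fk_eq using fh_int int f(2) by (simp add: m_def[symmetric] L1_norm_def)
  have mem: "(\<lambda>z. f z * of_real (1 + s * k z)) \<in> unit_ball (H1_gap K)" if s: "\<bar>s\<bar> \<le> 1" for s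
  proof -
    have "(\<lambda>z. of_real (1 - s * m / D) * f z + of_real (s / D) * (f z * of_real (h z))) \<in> H1_gap K"
      by (intro H1_gap_add H1_gap_cmult f fh)
    also have "(\<lambda>z. of_real (1 - s * m / D) * f z + of_real (s / D) * (f z * of_real (h z))) =
        (\<lambda>z. f z * of_real (1 + s * k z))"
      by (intro ext) (use D in \<open>simp add: k_def field_simps\<close>)
    finally have "(\<lambda>z. f z * of_real (1 + s * k z)) \<in> H1_gap K" .
    moreover have "L1_norm (\<lambda>z. f z * of_real (1 + s * k z)) =
        (LINT z|circle. cmod (f z) + s * (cmod (f z) * k z))"
      unfolding L1_norm_def
    proof (intro integral_cong_AE)
      show "AE z in circle. cmod (f z * of_real (1 + s * k z)) = cmod (f z) + s * (cmod (f z) * k z)"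
        using k_bound
      proof eventually_elim
        case (elim z)
        have "\<bar>s * k z\<bar> \<le> 1 * 1"
          unfolding abs_mult using elim s by (intro mult_mono) auto
        then have "\<bar>1 + s * k z\<bar> = 1 + s * k z"
          by linarith
        then have "cmod (f z * of_real (1 + s * k z)) = cmod (f z) * (1 + s * k z)"
          by (simp only: norm_mult norm_of_real)
        then show ?case
          by (simp only: ring_distribs mult_1_right mult.left_commute)
      qed
    qed measurable
    moreover have "\<dots> = 1"
      using int fk_int fk_0 f(2) by (simp add: L1_norm_def)
    ultimately show ?thesis
      by (simp add: unit_ball_def)
  qed
  have 1: "\<not> (AE z in circle. f z * of_real (1 + k z) = f z * of_real (1 - k z))"
  proof
    assume "AE z in circle. f z * of_real (1 + k z) = f z * of_real (1 - k z)"
    with f(3) have "AE z in circle. h z = m"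
    proof eventually_elim
      case (elim z)
      then have "complex_of_real (1 + k z) = of_real (1 - k z)"
        by simp
      then have "1 + k z = 1 - k z"
        by (simp only: of_real_eq_iff)
      then show ?case
        using D by (simp add: k_def)
    qed
    then show False
      using nconst by blast
  qed
  have 2: "(\<lambda>z. (1 - t) *\<^sub>R (f z * of_real (1 + k z)) + t *\<^sub>R (f z * of_real (1 - k z))) \<in> unit_ball (H1_gap K)"
    if t: "t \<in> {0..1}" for t
  proof -
    have "(\<lambda>z. (1 - t) *\<^sub>R (f z * of_real (1 + k z)) + t *\<^sub>R (f z * of_real (1 - k z))) =
        (\<lambda>z. f z * of_real (1 + (1 - 2 * t) * k z))"
      by (intro ext) (simp add: scaleR_conv_of_real algebra_simps)
    then show ?thesis
      using mem[of "1 - 2 * t"] t by (simp only:) (simp add: abs_le_iff)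
  qed
  have 3: "\<exists>t\<in>{0<..<1}. AE z in circle. f z =
      (1 - t) *\<^sub>R (f z * of_real (1 + k z)) + t *\<^sub>R (f z * of_real (1 - k z))"
    by (intro bexI[of _ "1 / 2"] AE_I2) (auto simp: scaleR_conv_of_real algebra_simps)
  show False
    using extreme unfolding extreme_point_def
    by (elim conjE notE) (intro exI[of _ "\<lambda>z. f z * of_real (1 + k z)"]
      exI[of _ "\<lambda>z. f z * of_real (1 - k z)"] conjI ballI 1 2 3)
qed

section \<open>Rational inner functions\<close>

definition blaschke :: "complex list \<Rightarrow> complex \<Rightarrow> complex" where
  "blaschke as z = (\<Prod>a\<leftarrow>as. (z - a) / (1 - cnj a * z))"

lemma one_minus_cnj_mult_nonzero:
  assumes "cmod a < 1" "cmod z \<le> 1"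
  shows "1 - cnj a * z \<noteq> 0"
proof
  assume "1 - cnj a * z = 0"
  then have "cmod a * cmod z = 1"
    by (metis complex_mod_cnj eq_iff_diff_eq_0 norm_mult norm_one)
  moreover have "cmod a * cmod z \<le> cmod a * 1"
    using assms by (intro mult_left_mono) auto
  ultimately show False
    using assms by simp
qed

lemma sphere_minus_eq:
  assumes "z \<in> sphere 0 1"
  shows "z - a = z * cnj (1 - cnj a * z)"
proof -
  have "z * cnj z = 1"
    using assms by (simp add: mult_cnj_eq_1)
  then show ?thesis
    by (simp add: algebra_simps)
qed

lemma cmod_blaschke_factor:
  assumes "cmod a < 1" "z \<in> sphere 0 1"
  shows "cmod (z - a) = cmod (1 - cnj a * z)"
  using assms(2) unfolding sphere_minus_eq[OF assms(2), of a] by (simp add: norm_mult del: complex_cnj_diff complex_cnj_mult)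

lemma poly_eq_of_AE:
  assumes "AE z in circle. poly p z = poly q z"
  shows "p = q"
proof (rule poly_eqI)
  fix n
  have "fourier_coeff (poly p) (int n) = fourier_coeff (poly q) (int n)"
    by (intro fourier_coeff_cong_AE assms) measurable
  then show "coeff p n = coeff q n"
    by (simp add: fourier_coeff_poly)
qed

text \<open>On the circle \<open>1 / cnj z = z\<close>, so there \<open>|P|\<^sup>2\<close> is the polynomial \<open>P * R\<close> divided by \<open>z\<^sup>N\<close>.\<close>

lemma reflected_poly_exists:
  assumes "degree P \<le> N"
  shows "\<exists>R. (\<forall>y. y \<noteq> 0 \<longrightarrow> poly R y = y ^ N * cnj (poly P (1 / cnj y)))"
proof (intro exI allI impI)
  fix y :: complex
  assume y: "y \<noteq> 0"
  have "poly (\<Sum>i\<le>N. monom (cnj (coeff P i)) (N - i)) y = (\<Sum>i\<le>N. cnj (coeff P i) * y ^ (N - i))"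
    by (simp add: poly_sum poly_monom)
  also have "\<dots> = (\<Sum>i\<le>N. y ^ N * cnj (coeff P i * (1 / cnj y) ^ i))"
    using y by (intro sum.cong refl) (simp add: power_diff power_one_over)
  also have "\<dots> = y ^ N * cnj (\<Sum>i\<le>N. coeff P i * (1 / cnj y) ^ i)"
    by (simp add: sum_distrib_left)
  also have "(\<Sum>i\<le>N. coeff P i * (1 / cnj y) ^ i) = poly P (1 / cnj y)"
    unfolding poly_altdef using assms by (intro sum.mono_neutral_right) (auto simp: coeff_eq_0)
  finally show "poly (\<Sum>i\<le>N. monom (cnj (coeff P i)) (N - i)) y = y ^ N * cnj (poly P (1 / cnj y))" .
qed

text \<open>Continues \<open>|P|^2 = |q|^2\<close> from the circle to the punctured plane: after
  multiplication by \<open>z ^ N\<close> both sides are polynomials that agree almost everywhere on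
  the circle. Consequently a zero \<open>b \<noteq> 0\<close> of \<open>q\<close> forces a zero of
  \<open>P\<close> at \<open>b\<close> or at the reflected point \<open>1 / cnj b\<close>.\<close>

lemma equal_modulus_reflection:
  assumes eq: "AE z in circle. cmod (poly P z) = cmod (poly q z)" and y: "y \<noteq> 0"
  shows "poly P y * cnj (poly P (1 / cnj y)) = poly q y * cnj (poly q (1 / cnj y))"
proof -
  define N where "N = max (degree P) (degree q)"
  obtain R where R: "\<And>y. y \<noteq> 0 \<Longrightarrow> poly R y = y ^ N * cnj (poly P (1 / cnj y))"
    using reflected_poly_exists[of P N] by (auto simp: N_def)
  obtain S where S: "\<And>y. y \<noteq> 0 \<Longrightarrow> poly S y = y ^ N * cnj (poly q (1 / cnj y))"
    using reflected_poly_exists[of q N] by (auto simp: N_def)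
  have "AE z in circle. poly (P * R) z = poly (q * S) z"
    using eq AE_space
  proof eventually_elim
    case (elim z)
    then have z: "z \<in> sphere 0 1"
      by simp
    have nz: "z \<noteq> 0"
      using z by auto
    note inv = inverse_cnj_sphere[OF z]
    have "poly P z * cnj (poly P z) = poly q z * cnj (poly q z)"
      using elim(1) by (simp only: complex_norm_square[symmetric])
    then have "z ^ N * (poly P z * cnj (poly P z)) = z ^ N * (poly q z * cnj (poly q z))"
      by simp
    then show ?case
      using R[OF nz] S[OF nz] inv by (simp add: mult_ac)
  qed
  then have "P * R = q * S"
    by (rule poly_eq_of_AE)
  then have "poly (P * R) y = poly (q * S) y"
    by simp
  then show ?thesis
    using y R[OF y] S[OF y] by simp
qed

lemma poly_root_factor:
  assumes "poly P (b :: complex) = 0"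
  obtains P1 where "P = [:-b, 1:] * P1" "P \<noteq> 0 \<Longrightarrow> degree P = Suc (degree P1)"
proof -
  obtain P1 where P1: "P = [:-b, 1:] * P1"
    using assms by (auto simp: poly_eq_0_iff_dvd elim: dvdE)
  have "degree P = Suc (degree P1)" if "P \<noteq> 0"
  proof -
    have "P1 \<noteq> 0"
      using that P1 by auto
    then show ?thesis
      unfolding P1 by (subst degree_mult_eq) auto
  qed
  then show ?thesis
    using that P1 by blast
qed

text \<open>With a constant \<open>q\<close> the reflection identity leaves \<open>P\<close> no zero
  except the origin, so all linear factors of \<open>P\<close> are \<open>z\<close>.\<close>

lemma monomial_of_constant_modulus:
  assumes eq: "\<And>z. z \<in> sphere 0 1 \<Longrightarrow> cmod (poly P z) = cmod (poly q z)"
    and q: "degree q = 0" "q \<noteq> 0"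
  shows "\<exists>c. cmod c = 1 \<and> (\<forall>z. poly P z = c * poly q z * z ^ degree P)"
proof -
  obtain q0 where q0: "q = [:q0:]" "q0 \<noteq> 0"
    using q degree_eq_zeroE by (metis pCons_0_0)
  have roots: "y = 0" if "poly P y = 0" for y
  proof (rule ccontr)
    assume y: "y \<noteq> 0"
    show False
      using equal_modulus_reflection[of P q, OF AE_I2 y] eq that q0 by simp
  qed
  have "\<exists>c. \<forall>z. poly P z = c * z ^ degree P"
    using roots
  proof (induction "degree P" arbitrary: P)
    case 0
    then obtain p0 where "P = [:p0:]"
      using degree_eq_zeroE by metis
    then show ?case
      by auto
  next
    case (Suc n)
    obtain b where b: "poly P b = 0"
      using Suc.hyps(2) fundamental_theorem_of_algebra[of P] constant_degree[of P] by auto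
    then have "b = 0"
      using Suc.prems by simp
    then obtain P1 where P1: "P = [:0, 1:] * P1" "P \<noteq> 0 \<Longrightarrow> degree P = Suc (degree P1)"
      using b poly_root_factor[of P 0] by (metis neg_equal_0_iff_equal)
    have deg: "degree P = Suc (degree P1)"
      using P1(2) Suc.hyps(2) by fastforce
    have "y = 0" if "poly P1 y = 0" for y
      using Suc.prems[of y] that by (simp add: P1)
    then obtain c where "\<And>z. poly P1 z = c * z ^ degree P1"
      using Suc.hyps(1)[of P1] Suc.hyps(2) deg by auto
    then have "poly P z = c * z ^ degree P" for z
      unfolding deg by (simp add: P1(1) mult_ac)
    then show ?case
      by blast
  qed
  then obtain c where c: "\<And>z. poly P z = c * z ^ degree P"
    by blast
  have "cmod c = cmod q0"
    using eq[of 1] c[of 1] q0 by simp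
  then show ?thesis
    using c q0 by (intro exI[of _ "c / q0"]) (auto simp: norm_divide)
qed

text \<open>Induction on the zeros of \<open>q\<close>, all outside the closed disc. By reflection
  \<open>P\<close> vanishes at the zero \<open>b\<close>, and a common factor cancels, or at
  \<open>a = 1 / cnj b\<close>, and a Blaschke factor splits off. A constant \<open>q\<close> leaves
  a monomial, that is a Blaschke product with all zeros at the origin.\<close>

lemma rational_blaschke:
  assumes "degree P \<le> N" "degree q \<le> N" "q \<noteq> 0"
    and "\<And>y. poly q y = 0 \<Longrightarrow> 1 < cmod y"
    and "\<And>z. z \<in> sphere 0 1 \<Longrightarrow> cmod (poly P z) = cmod (poly q z)"
  shows "\<exists>as c. set as \<subseteq> ball 0 1 \<and> length as \<le> N \<and> cmod c = 1 \<and>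
    (\<forall>z\<in>sphere 0 1. poly P z / poly q z = c * blaschke as z)"
  using assms
proof (induction "degree q" arbitrary: P q N)
  case 0
  obtain c where c: "cmod c = 1" "\<And>z. poly P z = c * poly q z * z ^ degree P"
    using monomial_of_constant_modulus[of P q] 0 by auto
  have "poly P z / poly q z = c * blaschke (replicate (degree P) 0) z" if "z \<in> sphere 0 1" for z
  proof -
    have "poly q z \<noteq> 0"
      using 0(5)[of z] that by auto
    then show ?thesis
      by (simp add: c(2) blaschke_def)
  qed
  then show ?case
    using c(1) 0(2) by (intro exI[of _ "replicate (degree P) 0"] exI[of _ c]) auto
next
  case (Suc n)
  obtain b where b: "poly q b = 0"
    using Suc.hyps(2) fundamental_theorem_of_algebra[of q] constant_degree[of q] by auto
  have b1: "1 < cmod b"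
    using Suc.prems(4) b .
  then have b0: "b \<noteq> 0"
    by auto
  obtain q1 where q1: "q = [:-b, 1:] * q1" "degree q = Suc (degree q1)"
    using poly_root_factor[OF b] Suc.prems(3) by metis
  have q1_nz: "q1 \<noteq> 0"
    using Suc.prems(3) q1 by auto
  have q1_roots: "1 < cmod y" if "poly q1 y = 0" for y
    using Suc.prems(4)[of y] that by (simp add: q1)
  have P_nz: "P \<noteq> 0"
  proof
    assume "P = 0"
    then have "poly q 1 = 0"
      using Suc.prems(5)[of 1] by simp
    then show False
      using Suc.prems(4)[of 1] by simp
  qed
  define a where "a = 1 / cnj b"
  have a: "cmod a < 1" "a \<noteq> 0" "b = 1 / cnj a"
    using b1 b0 by (auto simp: a_def norm_divide)
  have "poly P b * cnj (poly P a) = 0"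
    using equal_modulus_reflection[of P q, OF AE_I2 b0] Suc.prems(5) b by (simp add: a_def)
  then consider "poly P b = 0" | "poly P a = 0"
    by auto
  then show ?case
  proof cases
    case 1
    then obtain P1 where P1: "P = [:-b, 1:] * P1" "degree P = Suc (degree P1)"
      using poly_root_factor P_nz by metis
    have ne: "z \<noteq> b" if "z \<in> sphere 0 1" for z
      using that b1 by auto
    have mod: "cmod (poly P1 z) = cmod (poly q1 z)" if "z \<in> sphere 0 1" for z
    proof -
      have "poly P z = (z - b) * poly P1 z" "poly q z = (z - b) * poly q1 z"
        by (simp_all add: P1 q1 algebra_simps)
      then show ?thesis
        using Suc.prems(5)[OF that] ne[OF that] by (simp add: norm_mult)
    qed
    have le: "degree P1 \<le> N - 1" "degree q1 \<le> N - 1"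
      using Suc.prems(1,2) P1(2) q1(2) by auto
    have deg: "n = degree q1"
      using Suc.hyps(2) q1(2) by simp
    obtain as c where as: "set as \<subseteq> ball 0 1" "length as \<le> N - 1" "cmod c = 1"
        "\<forall>z\<in>sphere 0 1. poly P1 z / poly q1 z = c * blaschke as z"
      using Suc.hyps(1)[OF deg le q1_nz q1_roots mod] by blast
    have "poly P z / poly q z = poly P1 z / poly q1 z" if "z \<in> sphere 0 1" for z
    proof -
      have "poly P z = (z - b) * poly P1 z" "poly q z = (z - b) * poly q1 z"
        by (simp_all add: P1 q1 algebra_simps)
      then show ?thesis
        using ne[OF that] by simp
    qed
    then show ?thesis
      using as by (intro exI[of _ as] exI[of _ c]) auto
  next
    case 2
    then obtain P1 where P1: "P = [:-a, 1:] * P1" "degree P = Suc (degree P1)"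
      using poly_root_factor P_nz by metis
    have P_eq: "poly P z = (z - a) * poly P1 z" for z
      by (simp add: P1(1) algebra_simps)
    \<comment> \<open>Absorbs the constant in \<open>z - b = - b * (1 - cnj a * z)\<close>.\<close>
    define q2 where "q2 = Polynomial.smult (- b) q1"
    have q_eq: "poly q z = (1 - cnj a * z) * poly q2 z" for z
      using b0 by (simp add: q1 q2_def a_def field_simps)
    have q2_nz: "q2 \<noteq> 0" and deg2: "degree q2 = degree q1" 
      using q1_nz b0 by (auto simp: q2_def)
    have q2_roots: "1 < cmod y" if "poly q2 y = 0" for y
      using q1_roots[of y] that b0 by (simp add: q2_def)
    have mod: "cmod (poly P1 z) = cmod (poly q2 z)" if z: "z \<in> sphere 0 1" for z
    proof -
      have "cmod (z - a) * cmod (poly P1 z) = cmod (1 - cnj a * z) * cmod (poly q2 z)"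
        using Suc.prems(5)[OF z] by (simp only: P_eq q_eq norm_mult)
      then show ?thesis
        using one_minus_cnj_mult_nonzero[OF a(1), of z] z cmod_blaschke_factor[OF a(1) z] by simp
    qed
    have le: "degree P1 \<le> N - 1" "degree q2 \<le> N - 1"
      using Suc.prems(1,2) P1(2) q1(2) deg2 by auto
    have deg: "n = degree q2"
      using Suc.hyps(2) q1(2) deg2 by simp
    obtain as c where as: "set as \<subseteq> ball 0 1" "length as \<le> N - 1" "cmod c = 1"
        "\<forall>z\<in>sphere 0 1. poly P1 z / poly q2 z = c * blaschke as z"
      using Suc.hyps(1)[OF deg le q2_nz q2_roots mod] by blast
    have "poly P z / poly q z = c * blaschke (a # as) z" if z: "z \<in> sphere 0 1" for z
    proof -
      have "poly P z / poly q z = (z - a) / (1 - cnj a * z) * (poly P1 z / poly q2 z)"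
        by (simp add: P_eq q_eq)
      also have "poly P1 z / poly q2 z = c * blaschke as z"
        using as(4) z by blast
      finally show ?thesis
        by (simp add: blaschke_def)
    qed
    moreover have "length (a # as) \<le> N"
      using as(2) Suc.prems(1) P1(2) by simp
    ultimately show ?thesis
      using as a(1) by (intro exI[of _ "a # as"] exI[of _ c]) auto
  qed
qed

text \<open>Allows cancelling a factor \<open>z - b\<close>, wherever \<open>b\<close> lies: the
  coefficients satisfy a two-term recursion that propagates the zeros at negative frequencies to all
  frequencies.\<close>

lemma H1_shift_eigenvector:
  assumes g: "g \<in> H1" and eq: "AE z in circle. z * g z = b * g z"
  shows "AE z in circle. g z = 0"
proof -
  note meas [measurable] = H1_measurable[OF g]
  have shift: "fourier_coeff g (k - 1) = b * fourier_coeff g k" for k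
  proof -
    have "fourier_coeff (\<lambda>z. z powi 1 * g z) k = fourier_coeff (\<lambda>z. b * g z) k"
      by (intro fourier_coeff_cong_AE) (use eq in auto)
    then show ?thesis
      by (simp only: fourier_coeff_shift fourier_coeff_cmult)
  qed
  have zero: "fourier_coeff g k = 0" for k
  proof (cases "b = 0")
    case True
    then show ?thesis
      using shift[of "k + 1"] by simp
  next
    case False
    have "fourier_coeff g (int n) = 0" for n
    proof (induction n)
      case 0
      then show ?case
        using shift[of 0] H1_fourier_coeff[OF g, of "-1"] False by simp
    next
      case (Suc n)
      then show ?case
        using shift[of "int (Suc n)"] False by simp
    qed
    then show ?thesis
      using H1_fourier_coeff[OF g, of k] by (cases "k < 0") (auto simp: not_less dest: zero_le_imp_eq_int)
  qed
  then show ?thesis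
    using fourier_coeff_unique[OF H1_integrable[OF g] H1_integrable[OF H1_const[of 0]]] by simp
qed

text \<open>Otherwise \<open>g = c / (z - b)\<close> would have a pole in the disc. On the circle
  \<open>cnj (z * g) = cnj c * E\<close> with the geometric series \<open>E\<close> of mean 1,
  whereas \<open>z * g\<close> has mean zero.\<close>

lemma H1_pole_free:
  assumes g: "g \<in> H1" and b: "cmod b < 1" and eq: "AE z in circle. (z - b) * g z = c"
  shows "c = 0"
proof -
  note meas [measurable] = H1_measurable[OF g]
  define E where "E = (\<lambda>z. 1 / (1 - cnj b * z))"
  have E: "E \<in> H1"
    unfolding E_def by (intro Hinf_imp_H1 geometric_Hinf b)
  note E_meas [measurable] = H1_measurable[OF E]
  have "fourier_coeff (\<lambda>z. E z - cnj b * (z powi 1 * E z)) 0 = fourier_coeff (poly 1) 0"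
  proof (intro fourier_coeff_cong)
    fix z :: complex
    assume "z \<in> sphere 0 1"
    then have "1 - cnj b * z \<noteq> 0"
      using one_minus_cnj_mult_nonzero[OF b, of z] by simp
    then show "E z - cnj b * (z powi 1 * E z) = poly 1 z"
      by (simp add: E_def field_simps)
  qed
  then have E0: "fourier_coeff E 0 = 1"
    using H1_fourier_coeff[OF E, of "-1"] H1_integrable[OF E] integrable_powi_mult[OF H1_integrable[OF E], of 1]
    by (simp only: fourier_coeff_diff integrable_mult_right fourier_coeff_cmult fourier_coeff_shift fourier_coeff_poly) simp
  have "AE z in circle. cnj (z powi 1 * g z) = cnj c * E z"
    using eq AE_space
  proof eventually_elim
    case (elim z)
    then have z: "z \<in> sphere 0 1"
      by simp
    then have nz: "1 - cnj b * z \<noteq> 0"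
      using one_minus_cnj_mult_nonzero[OF b, of z] by simp
    have "cnj c = cnj ((z - b) * g z)"
      by (simp only: elim(1))
    also have "\<dots> = cnj (z * g z) * (1 - cnj b * z)"
      unfolding sphere_minus_eq[OF z, of b] by (simp add: mult_ac)
    finally have "cnj c = cnj (z * g z) * (1 - cnj b * z)" .
    then show ?case
      using nz by (simp add: E_def)
  qed
  then have "fourier_coeff (\<lambda>z. cnj (z powi 1 * g z)) 0 = fourier_coeff (\<lambda>z. cnj c * E z) 0"
    using borel_measurable_integrable[OF integrable_cnj[OF integrable_powi_mult[OF H1_integrable[OF g], of 1]]]
    by (intro fourier_coeff_cong_AE) auto
  then have "cnj c = 0"
    using H1_fourier_coeff[OF g, of "-1"]
    by (simp only: fourier_coeff_cnj fourier_coeff_shift fourier_coeff_cmult E0) simp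
  then show ?thesis
    by simp
qed

text \<open>The fraction \<open>P / q\<close> need not be reduced, so zeros of \<open>q\<close> in
  the closed disc are cancelled one at a time until \<open>rational_blaschke\<close> applies. At a
  zero on the circle \<open>P\<close> vanishes by equality of moduli, at an interior zero because
  \<open>I\<close> has no pole.\<close>

lemma inner_rational_blaschke:
  assumes "I \<in> H1" "AE z in circle. cmod (I z) = 1"
    and "degree q \<le> N" "degree P \<le> N" "q \<noteq> 0"
    and "AE z in circle. I z * poly q z = poly P z"
  shows "\<exists>as. blaschke_with_zeros I as \<and> length as \<le> N"
  using assms(3-6)
proof (induction "degree q" arbitrary: P q rule: less_induct)
  case less
  have AE_mod: "AE z in circle. cmod (poly P z) = cmod (poly q z)"
    using less.prems(4) assms(2)
  proof eventually_elim
    case (elim z)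
    have "cmod (I z) * cmod (poly q z) = cmod (poly P z)"
      by (simp only: elim(1) norm_mult[symmetric])
    then show ?case
      by (simp add: elim(2))
  qed
  \<comment> \<open>Evaluating the reflection identity at a point of the circle upgrades the
    equality from almost everywhere to everywhere.\<close>
  have mod: "cmod (poly P z) = cmod (poly q z)" if z: "z \<in> sphere 0 1" for z
  proof -
    have nz: "z \<noteq> 0"
      using z by auto
    have "poly P z * cnj (poly P z) = poly q z * cnj (poly q z)"
      using equal_modulus_reflection[OF AE_mod nz] inverse_cnj_sphere[OF z] by simp
    then have "(cmod (poly P z))\<^sup>2 = (cmod (poly q z))\<^sup>2"
      by (simp only: complex_norm_square[symmetric] of_real_eq_iff)
    then show ?thesis
      by simp
  qed
  show ?case
  proof (cases "\<exists>b. poly q b = 0 \<and> cmod b \<le> 1")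
    case False
    then have roots: "1 < cmod y" if "poly q y = 0" for y
      using that by force
    obtain as c where as: "set as \<subseteq> ball 0 1" "length as \<le> N" "cmod c = 1"
        "\<forall>z\<in>sphere 0 1. poly P z / poly q z = c * blaschke as z"
      using rational_blaschke[OF less.prems(2,1,3) roots mod] by blast
    have "AE z in circle. I z = c * (\<Prod>a\<leftarrow>as. (z - a) / (1 - cnj a * z))"
      using less.prems(4) AE_space
    proof eventually_elim
      case (elim z)
      then have "poly q z \<noteq> 0"
        using False by force
      then have "I z = poly P z / poly q z"
        using elim(1) by (simp add: field_simps)
      then show ?case
        using as(4) elim(2) by (simp add: blaschke_def)
    qed
    then show ?thesis
      using as unfolding blaschke_with_zeros_def by blast
  next
    case True
    then obtain b where b: "poly q b = 0" "cmod b \<le> 1"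
      by blast
    obtain q1 where q1: "q = [:-b, 1:] * q1" "degree q = Suc (degree q1)"
      using poly_root_factor[OF b(1)] less.prems(3) by metis
    have q_eq: "poly q z = (z - b) * poly q1 z" for z
      by (simp add: q1 algebra_simps)
    have quotient_H1: "(\<lambda>z. I z * poly q1 z - poly P1 z) \<in> H1" for P1
      using H1_diff[OF H1_mult_poly[OF assms(1)] H1_poly, of q1 P1] by (simp add: mult.commute)
    have Pb: "poly P b = 0"
    proof (cases "cmod b = 1")
      case True
      then show ?thesis
        using mod[of b] b by simp
    next
      case False
      \<comment> \<open>Division with remainder: \<open>(z - b) * (I * q1 - P1)\<close> is the
        constant \<open>poly P b\<close>, which must be zero because the second factor is
        analytic.\<close>
      obtain P1 where P1: "P - [:poly P b:] = [:-b, 1:] * P1"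
        using poly_root_factor[of "P - [:poly P b:]" b] by auto
      have P_eq: "poly P z = (z - b) * poly P1 z + poly P b" for z
      proof -
        have "poly (P - [:poly P b:]) z = (z - b) * poly P1 z"
          unfolding P1 by (simp add: algebra_simps)
        then show ?thesis
          by (simp add: algebra_simps)
      qed
      show ?thesis
      proof (rule H1_pole_free[OF quotient_H1])
        show "AE z in circle. (z - b) * (I z * poly q1 z - poly P1 z) = poly P b"
          using less.prems(4)
        proof eventually_elim
          case (elim z)
          then show ?case
            using P_eq[of z] q_eq[of z] by (simp add: algebra_simps)
        qed
      qed (use b False in simp)
    qed
    then obtain P1 where P1: "P = [:-b, 1:] * P1" "P \<noteq> 0 \<Longrightarrow> degree P = Suc (degree P1)"
      using poly_root_factor by blast
    have P_eq: "poly P z = (z - b) * poly P1 z" for z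
      by (simp add: P1(1) algebra_simps)
    have "AE z in circle. I z * poly q1 z - poly P1 z = 0"
    proof (rule H1_shift_eigenvector[OF quotient_H1])
      show "AE z in circle. z * (I z * poly q1 z - poly P1 z) = b * (I z * poly q1 z - poly P1 z)"
        using less.prems(4)
      proof eventually_elim
        case (elim z)
        then show ?case
          using P_eq[of z] q_eq[of z] by (simp add: algebra_simps)
      qed
    qed
    then have AE1: "AE z in circle. I z * poly q1 z = poly P1 z"
      by eventually_elim simp
    have degP1: "degree P1 \<le> N"
    proof (cases "P = 0")
      case True
      then have "[:-b, 1:] * P1 = 0"
        by (metis P1(1))
      then have "P1 = 0"
        by (simp only: mult_eq_0_iff) simp
      then show ?thesis
        by simp
    next
      case False
      then show ?thesis
        using P1(2) less.prems(2) by simp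
    qed
    have q1': "q1 \<noteq> 0" "degree q1 < degree q" "degree q1 \<le> N"
      using q1 less.prems(1,3) by auto
    show ?thesis
      by (rule less.hyps[OF q1'(2,3) degP1 q1'(1) AE1])
  qed
qed

section \<open>Rank and kernel of a matrix\<close>


lemma mat_linear_map:
  assumes A: "(A :: 'a :: field mat) \<in> carrier_mat nr nc"
  shows "linear_map class_ring (module_vec TYPE('a) nc) (module_vec TYPE('a) nr) (\<lambda>v. A *\<^sub>v v)"
proof -
  interpret V: vec_space "TYPE('a)" nc .
  interpret W: vec_space "TYPE('a)" nr .
  show ?thesis
    by unfold_locales
       (use A in \<open>auto simp: module_hom_def mult_add_distrib_mat_vec[OF A] mult_mat_vec[OF A]\<close>)
qed

lemma rank_plus_kernel_dim:
  assumes A: "(A :: 'a :: field mat) \<in> carrier_mat nr nc"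
  shows "vec_space.rank nr A + kernel.dim nc A = nc"
proof -
  interpret K: kernel nr nc A
    by unfold_locales (rule A)
  interpret W: vec_space "TYPE('a)" nr .
  interpret L: linear_map class_ring "module_vec TYPE('a) nc" "module_vec TYPE('a) nr" "\<lambda>v. A *\<^sub>v v"
    by (rule mat_linear_map[OF A])
  have im: "L.im = W.span (set (cols A))"
  proof -
    have "W.span (set (cols A)) = {y \<in> carrier_vec nr. \<exists>x\<in>carrier_vec nc. A *\<^sub>v x = y}"
      using W.col_space_eq[OF A] A unfolding W.col_space_def by simp
    also have "\<dots> = (\<lambda>v. A *\<^sub>v v) ` carrier_vec nc"
      using A by (auto intro: mult_mat_vec_carrier)
    finally show ?thesis
      unfolding L.im_def by simp
  qed
  have ker: "L.ker = mat_kernel A"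
    using A unfolding L.ker_def mat_kernel_def by auto
  have "vectorspace.dim class_ring (W.vs L.im) + vectorspace.dim class_ring (K.NC.vs L.ker) = K.NC.dim"
    by (rule L.rank_nullity) (rule K.NC.fin_dim)
  then show ?thesis
    unfolding im ker W.rank_def K.NC.dim_is_n .
qed

text \<open>Finite dimension is required before an independent set of the right size may be called a
  basis. Sets independent in the kernel are independent in the whole space, which bounds their
  size.\<close>

lemma kernel_fin_dim:
  assumes A: "(A :: 'a :: field mat) \<in> carrier_mat nr nc"
  shows "vectorspace.fin_dim class_ring (module_vec TYPE('a) nc\<lparr>carrier := mat_kernel A\<rparr>)"
proof -
  interpret K: kernel nr nc A
    by unfold_locales (rule A)
  interpret W: vec_space "TYPE('a)" nr .
  interpret L: linear_map class_ring "module_vec TYPE('a) nc" "module_vec TYPE('a) nr" "\<lambda>v. A *\<^sub>v v"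
    by (rule mat_linear_map[OF A])
  have ker: "L.ker = mat_kernel A"
    using A unfolding L.ker_def mat_kernel_def by auto
  have sub: "submodule class_ring (mat_kernel A) (module_vec TYPE('a) nc)"
    using L.kerT_is_subspace unfolding ker subspace_def by simp
  have ker_carrier: "mat_kernel A \<subseteq> carrier_vec nc"
    using A by (auto simp: mat_kernel_def)
  have small: "finite B \<and> card B \<le> nc" if B: "B \<subseteq> mat_kernel A \<and> K.Ker.lin_indpt B" for B
  proof -
    have "K.NC.lin_indpt B"
      using K.NC.span_li_not_depend(2)[OF _ sub, of B] B by simp
    then show ?thesis
      using K.NC.li_le_dim[OF K.NC.fin_dim, of B] B ker_carrier by (auto simp: K.NC.dim_is_n)
  qed
  have "K.Ker.lin_indpt {}"
    by (rule K.Ker.finite_lin_indpt2) auto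
  then have "\<exists>B. finite B \<and> maximal B (\<lambda>B. B \<subseteq> mat_kernel A \<and> K.Ker.lin_indpt B)"
    using small by (intro maximal_exists[where N = nc and B = "{}"]) auto
  then obtain B where B: "finite B" "maximal B (\<lambda>B. B \<subseteq> mat_kernel A \<and> K.Ker.lin_indpt B)"
    by blast
  then have "K.Ker.basis B"
    by (intro K.Ker.max_li_is_basis) auto
  then show ?thesis
    using B(1) unfolding K.Ker.fin_dim_def K.Ker.basis_def by blast
qed

lemma rank_eq_iff_kernel_line:
  assumes A: "(A :: 'a :: field mat) \<in> carrier_mat nr (Suc n)"
    and v0: "v0 \<in> carrier_vec (Suc n)" "v0 \<noteq> 0\<^sub>v (Suc n)" "A *\<^sub>v v0 = 0\<^sub>v nr"
  shows "vec_space.rank nr A = n \<longleftrightarrow> (\<forall>v\<in>carrier_vec (Suc n). A *\<^sub>v v = 0\<^sub>v nr \<longrightarrow> (\<exists>c. v = c \<cdot>\<^sub>v v0))"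
proof -
  interpret K: kernel nr "Suc n" A
    by unfold_locales (rule A)
  have v0_ker: "v0 \<in> mat_kernel A"
    using v0 by (intro mat_kernelI[OF A]) auto
  have lc: "K.Ker.lincomb a {v0} = a v0 \<cdot>\<^sub>v v0" for a
  proof -
    have "a v0 \<cdot>\<^sub>v v0 \<in> carrier_vec (Suc n)"
      using v0 by simp
    moreover have "a v0 \<cdot>\<^sub>v v0 \<in> mat_kernel A"
      by (rule mat_kernel_smult[OF A v0_ker])
    ultimately show ?thesis
      unfolding K.Ker.lincomb_def by (simp add: K.Ker.M.finsum_insert)
  qed
  have smult_zero: "c = 0" if "c \<cdot>\<^sub>v v0 = 0\<^sub>v (Suc n)" for c
  proof (rule ccontr)
    assume "c \<noteq> 0"
    then have "v0 = inverse c \<cdot>\<^sub>v (c \<cdot>\<^sub>v v0)"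
      by (simp add: smult_smult_assoc)
    then show False
      using that v0(2) by simp
  qed
  have indpt: "K.Ker.lin_indpt {v0}"
    by (rule K.Ker.finite_lin_indpt2) (use v0_ker smult_zero in \<open>auto simp: lc\<close>)
  have span: "K.Ker.span {v0} = (\<lambda>c. c \<cdot>\<^sub>v v0) ` UNIV"
  proof -
    have "K.Ker.span {v0} = {K.Ker.lincomb a {v0} | a. a \<in> {v0} \<rightarrow> UNIV}"
      by (subst K.Ker.finite_span) (use v0_ker in auto)
    also have "\<dots> = (\<lambda>c. c \<cdot>\<^sub>v v0) ` UNIV"
      unfolding lc by (auto intro!: exI[of _ "\<lambda>_. _"])
    finally show ?thesis .
  qed
  have dim_eq: "kernel.dim (Suc n) A = 1 \<longleftrightarrow> K.Ker.span {v0} = mat_kernel A"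
  proof
    assume "kernel.dim (Suc n) A = 1"
    then have "K.Ker.basis {v0}"
      using v0_ker indpt kernel_fin_dim[OF A] by (intro K.Ker.dim_li_is_basis) auto
    then show "K.Ker.span {v0} = mat_kernel A"
      by (simp add: K.Ker.basis_def)
  next
    assume "K.Ker.span {v0} = mat_kernel A"
    then have "K.Ker.basis {v0}"
      using v0_ker indpt by (simp add: K.Ker.basis_def)
    then show "kernel.dim (Suc n) A = 1"
      using K.Ker.dim_basis[of "{v0}"] by simp
  qed
  have "vec_space.rank nr A = n \<longleftrightarrow> kernel.dim (Suc n) A = 1"
    using rank_plus_kernel_dim[OF A] by linarith
  also have "\<dots> \<longleftrightarrow> mat_kernel A \<subseteq> (\<lambda>c. c \<cdot>\<^sub>v v0) ` UNIV"
    unfolding dim_eq span using mat_kernel_smult[OF A v0_ker] by auto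
  also have "\<dots> \<longleftrightarrow> (\<forall>v\<in>carrier_vec (Suc n). A *\<^sub>v v = 0\<^sub>v nr \<longrightarrow> (\<exists>c. v = c \<cdot>\<^sub>v v0))"
    using A by (auto simp: mat_kernel_def image_def subset_eq)
  finally show ?thesis .
qed

text \<open>Padding the coefficients with zero rows gives a square matrix; row \<open>r\<close>
  vanishes, hence so does the determinant.\<close>

lemma homogeneous_system:
  fixes a :: "nat \<Rightarrow> nat \<Rightarrow> 'a :: field"
  assumes "r < c"
  shows "\<exists>x. (\<exists>i<c. x i \<noteq> 0) \<and> (\<forall>j<r. (\<Sum>i<c. a j i * x i) = 0)"
proof -
  define A where "A = Matrix.mat c c (\<lambda>(j, i). if j < r then a j i else 0)"
  have A: "A \<in> carrier_mat c c"
    by (simp add: A_def)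
  have "A = mat\<^sub>r c c (\<lambda>j. if j = r then 0\<^sub>v c else Matrix.row A j)"
    using assms by (intro eq_matI) (auto simp: A_def)
  then have "Determinant.det A = 0"
  proof (rule ssubst[where P = "\<lambda>B. Determinant.det B = 0"])
    show "Determinant.det (mat\<^sub>r c c (\<lambda>j. if j = r then 0\<^sub>v c else Matrix.row A j)) = 0"
      by (rule det_row_0[OF assms]) (use A in auto)
  qed
  then obtain v where v: "v \<in> carrier_vec c" "v \<noteq> 0\<^sub>v c" "A *\<^sub>v v = 0\<^sub>v c"
    using det_0_iff_vec_prod_zero_field[OF A] by blast
  have "(\<Sum>i<c. a j i * vec_index v i) = 0" if "j < r" for j
  proof -
    have "vec_index (A *\<^sub>v v) j = (\<Sum>i<c. a j i * vec_index v i)"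
      using that assms v(1) by (simp add: A_def scalar_prod_def atLeast0LessThan)
    then show ?thesis
      using v(3) that assms by simp
  qed
  moreover have "\<exists>i<c. vec_index v i \<noteq> 0"
  proof (rule ccontr)
    assume "\<not> (\<exists>i<c. vec_index v i \<noteq> 0)"
    then have "v = 0\<^sub>v c"
      using v(1) by (intro eq_vecI) auto
    then show False
      using v(2) by contradiction
  qed
  ultimately show ?thesis
    by (intro exI[of _ "\<lambda>i. vec_index v i"]) auto
qed

section \<open>Extreme points have finite Blaschke inner factors\<close>

lemma Hinf_add:
  assumes "f \<in> Hinf" "g \<in> Hinf"
  shows "(\<lambda>z. f z + g z) \<in> Hinf"
proof -
  obtain C D where C: "AE z in circle. cmod (f z) \<le> C" and D: "AE z in circle. cmod (g z) \<le> D"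
    using assms by (auto simp: Hinf_def)
  have "AE z in circle. cmod (f z + g z) \<le> C + D"
    using C D by eventually_elim (rule norm_triangle_mono)
  then show ?thesis
    using assms H1_add[of f g] by (auto simp: Hinf_def)
qed

lemma Hinf_diff:
  assumes "f \<in> Hinf" "g \<in> Hinf"
  shows "(\<lambda>z. f z - g z) \<in> Hinf"
  using Hinf_add[OF assms(1) Hinf_cmult[OF assms(2), of "-1"]] by simp

lemma Hinf_mult:
  assumes "f \<in> Hinf" "g \<in> Hinf"
  shows "(\<lambda>z. f z * g z) \<in> Hinf"
proof -
  obtain C D where C: "AE z in circle. cmod (f z) \<le> C" and D: "AE z in circle. cmod (g z) \<le> D"
    using assms by (auto simp: Hinf_def)
  have "AE z in circle. cmod (f z * g z) \<le> C * D"
    using C D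
  proof eventually_elim
    case (elim z)
    then show ?case
      unfolding norm_mult by (intro mult_mono) (auto intro: order_trans[OF norm_ge_zero])
  qed
  then show ?thesis
    using H1_mult_Hinf(1)[OF Hinf_imp_H1[OF assms(2)] assms(1)] by (auto simp: Hinf_def)
qed

lemma Hinf_sum:
  assumes "finite A" "\<And>i. i \<in> A \<Longrightarrow> f i \<in> Hinf"
  shows "(\<lambda>z. \<Sum>i\<in>A. f i z) \<in> Hinf"
  using assms
proof (induction A rule: finite_induct)
  case empty
  show ?case
    using HinfI[OF H1_const[of 0], of 0] by simp
next
  case (insert a A)
  then show ?case
    by (simp add: Hinf_add)
qed

lemma Hinf_measurable: "f \<in> Hinf \<Longrightarrow> f \<in> borel_measurable circle"
  by (rule H1_measurable[OF Hinf_imp_H1])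

text \<open>\<open>shift_coeff I n\<close> is the \<open>n\<close>-th iterate of the backward shift applied to \<open>I\<close>. For inner \<open>I\<close> it
  lies in the model space of \<open>I\<close>, so that \<open>I * cnj (shift_coeff I n)\<close>, which equals
  \<open>shift_conj I n\<close> on the circle, is analytic as well.\<close>

definition taylor_poly :: "(complex \<Rightarrow> complex) \<Rightarrow> nat \<Rightarrow> complex poly" where
  "taylor_poly I n = (\<Sum>j<n. monom (fourier_coeff I (int j)) j)"

definition shift_coeff :: "(complex \<Rightarrow> complex) \<Rightarrow> nat \<Rightarrow> complex \<Rightarrow> complex" where
  "shift_coeff I n z = z powi (- int n) * (I z - poly (taylor_poly I n) z)"

definition shift_conj :: "(complex \<Rightarrow> complex) \<Rightarrow> nat \<Rightarrow> complex \<Rightarrow> complex" where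
  "shift_conj I n z = z ^ n - I z * poly (\<Sum>j<n. monom (cnj (fourier_coeff I (int j))) (n - j)) z"

lemma coeff_taylor_poly: "coeff (taylor_poly I n) i = (if i < n then fourier_coeff I (int i) else 0)"
  by (simp add: taylor_poly_def coeff_sum)

lemma shift_coeff_Hinf:
  assumes "I \<in> Hinf"
  shows "shift_coeff I n \<in> Hinf"
proof -
  define g where "g = (\<lambda>z. I z - poly (taylor_poly I n) z)"
  have g: "g \<in> Hinf"
    unfolding g_def by (intro Hinf_diff assms Hinf_poly)
  have eq: "shift_coeff I n = (\<lambda>z. z powi (- int n) * g z)"
    by (intro ext) (simp add: shift_coeff_def g_def)
  have g_coeff: "fourier_coeff g k = 0" if "k < int n" for k
  proof -
    have "fourier_coeff g k = fourier_coeff I k - fourier_coeff (poly (taylor_poly I n)) k"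
      unfolding g_def by (intro fourier_coeff_diff H1_integrable Hinf_imp_H1 assms Hinf_poly)
    also have "\<dots> = 0"
      using that H1_fourier_coeff[OF Hinf_imp_H1[OF assms], of k]
      by (simp add: fourier_coeff_poly coeff_taylor_poly)
    finally show ?thesis .
  qed
  have "integrable circle (\<lambda>z. z powi (- int n) * g z)"
    by (intro integrable_powi_mult H1_integrable Hinf_imp_H1 g)
  then have "(\<lambda>z. z powi (- int n) * g z) \<in> H1"
    by (simp add: H1_def fourier_coeff_shift g_coeff)
  moreover obtain C where C: "AE z in circle. cmod (g z) \<le> C"
    using g by (auto simp: Hinf_def)
  have "AE z in circle. cmod (z powi (- int n) * g z) \<le> C"
    using C AE_space by eventually_elim (simp add: norm_mult norm_power_int)
  ultimately show ?thesis
    unfolding eq Hinf_def by blast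
qed

lemma shift_conj_Hinf:
  assumes "I \<in> Hinf"
  shows "shift_conj I n \<in> Hinf"
proof -
  have "(\<lambda>z. poly (monom 1 n) z - I z * poly (\<Sum>j<n. monom (cnj (fourier_coeff I (int j))) (n - j)) z) \<in> Hinf"
    by (intro Hinf_diff Hinf_mult Hinf_poly assms)
  then show ?thesis
    by (simp add: shift_conj_def[abs_def] poly_monom)
qed

text \<open>All powers of \<open>z\<close> involved have exponent \<open>n\<close> or
  \<open>n - j\<close> with \<open>j < n\<close>, hence at least 1. The zero mean is what later
  rules out a constant real part.\<close>

lemma shift_conj_coeff_0:
  assumes "I \<in> Hinf" "0 < n"
  shows "fourier_coeff (shift_conj I n) 0 = 0"
proof -
  let ?r = "\<Sum>j<n. monom (cnj (fourier_coeff I (int j))) (n - j)"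
  have int: "integrable circle (\<lambda>z. I z * poly ?r z)"
    by (intro H1_integrable Hinf_imp_H1 Hinf_mult Hinf_poly assms)
  have "coeff ?r 0 = 0"
    by (simp add: coeff_sum)
  then have "fourier_coeff (\<lambda>z. I z * poly ?r z) 0 = 0"
    using H1_mult_Hinf(2)[OF H1_poly assms(1), of ?r] by (simp add: fourier_coeff_poly)
  then show ?thesis
    using int assms(2) fourier_coeff_diff[OF integrable_power[of n] int, of 0]
    by (simp add: shift_conj_def[abs_def] fourier_coeff_power)
qed

lemma inner_mult_cnj_shift_coeff:
  assumes "z \<in> sphere 0 1" "cmod (I z) = 1"
  shows "I z * cnj (shift_coeff I n z) = shift_conj I n z"
proof -
  have cnj_powi: "cnj (z powi (- int n)) = z ^ n"
    using cnj_powi_sphere[OF assms(1), of "- int n"] by simp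
  have power_eq: "z ^ n * cnj (z ^ j) = z ^ (n - j)" if "j < n" for j
  proof -
    have "z ^ n * cnj (z ^ j) = z powi int n * cnj z powi int j"
      by simp
    also have "\<dots> = z powi (int n - int j)"
      unfolding cnj_powi_sphere[OF assms(1)] powi_mult_sphere[OF assms(1)] by simp
    also have "int n - int j = int (n - j)"
      using that by simp
    finally show ?thesis
      by simp
  qed
  have "z ^ n * cnj (poly (taylor_poly I n) z) = (\<Sum>j<n. cnj (fourier_coeff I (int j)) * (z ^ n * cnj (z ^ j)))"
    by (simp add: taylor_poly_def poly_sum poly_monom sum_distrib_left mult_ac)
  also have "\<dots> = poly (\<Sum>j<n. monom (cnj (fourier_coeff I (int j))) (n - j)) z"
    unfolding poly_sum poly_monom by (intro sum.cong refl) (simp only: power_eq lessThan_iff)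
  finally have conj: "z ^ n * cnj (poly (taylor_poly I n) z) = poly (\<Sum>j<n. monom (cnj (fourier_coeff I (int j))) (n - j)) z" .
  have "I z * cnj (I z) = 1"
    by (rule mult_cnj_eq_1[OF assms(2)])
  moreover have "I z * cnj (shift_coeff I n z) =
      z ^ n * (I z * cnj (I z)) - I z * (z ^ n * cnj (poly (taylor_poly I n) z))"
    unfolding shift_coeff_def complex_cnj_mult cnj_powi complex_cnj_diff by (simp add: algebra_simps)
  ultimately show ?thesis
    unfolding conj shift_conj_def by simp
qed

text \<open>Multiplying the relation by \<open>z ^ N\<close> clears the negative powers and leaves
  \<open>I * q = P\<close>. The shifts have orders 1 to \<open>N\<close>, so the degrees are at most
  \<open>N - 1\<close>, and the coefficients of \<open>q\<close> are the \<open>\<alpha> n\<close>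
  in reverse order.\<close>

lemma dependent_shifts_blaschke:
  assumes I: "is_inner I" and \<alpha>: "\<exists>n<N. \<alpha> n \<noteq> 0"
    and dep: "AE z in circle. (\<Sum>n<N. \<alpha> n * shift_coeff I (Suc n) z) = 0"
  shows "\<exists>as. blaschke_with_zeros I as \<and> length as \<le> N - 1"
proof -
  define q where "q = (\<Sum>n<N. monom (\<alpha> n) (N - Suc n))"
  define P where "P = (\<Sum>n<N. monom (\<alpha> n) (N - Suc n) * taylor_poly I (Suc n))"
  have "degree q \<le> N - 1"
    unfolding q_def by (intro degree_sum_le) (auto intro!: order_trans[OF degree_monom_le])
  moreover have "degree P \<le> N - 1"
    unfolding P_def
  proof (intro degree_sum_le)
    fix n assume "n \<in> {..<N}"
    have "degree (taylor_poly I (Suc n)) \<le> n"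
      by (intro degree_le) (simp add: coeff_taylor_poly)
    then have "degree (monom (\<alpha> n) (N - Suc n) * taylor_poly I (Suc n)) \<le> (N - Suc n) + n"
      using degree_mult_le[of "monom (\<alpha> n) (N - Suc n)" "taylor_poly I (Suc n)"] degree_monom_le[of "\<alpha> n" "N - Suc n"]
      by linarith
    then show "degree (monom (\<alpha> n) (N - Suc n) * taylor_poly I (Suc n)) \<le> N - 1"
      using \<open>n \<in> {..<N}\<close> by simp
  qed simp
  moreover have "q \<noteq> 0"
  proof -
    obtain n where n: "n < N" "\<alpha> n \<noteq> 0"
      using \<alpha> by blast
    have "coeff q (N - Suc n) = (\<Sum>i<N. if i = n then \<alpha> i else 0)"
      unfolding q_def coeff_sum coeff_monom using n by (intro sum.cong) auto
    then show ?thesis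
      using n by auto
  qed
  moreover have "AE z in circle. I z * poly q z = poly P z"
    using dep AE_space
  proof eventually_elim
    case (elim z)
    then have z: "z \<in> sphere 0 1"
      by simp
    have "z ^ N * shift_coeff I (Suc n) z = z ^ (N - Suc n) * (I z - poly (taylor_poly I (Suc n)) z)" if "n < N" for n
    proof -
      have "z ^ N * z powi (- int (Suc n)) = z powi (int N - int (Suc n))"
        using powi_mult_sphere[OF z, of "int N" "- int (Suc n)"]
        by (simp only: power_int_of_nat add_uminus_conv_diff)
      also have "int N - int (Suc n) = int (N - Suc n)"
        using that by simp
      finally have "z ^ N * z powi (- int (Suc n)) = z ^ (N - Suc n)"
        by simp
      then show ?thesis
        unfolding shift_coeff_def mult.assoc[symmetric] by simp
    qed
    then have "(\<Sum>n<N. \<alpha> n * (z ^ (N - Suc n) * (I z - poly (taylor_poly I (Suc n)) z))) =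
        z ^ N * (\<Sum>n<N. \<alpha> n * shift_coeff I (Suc n) z)"
      unfolding sum_distrib_left by (intro sum.cong refl) (simp add: mult.left_commute[of _ "\<alpha> _"])
    also have "\<dots> = 0"
      using elim by simp
    finally have "I z * poly q z - poly P z = 0"
      by (simp add: q_def P_def poly_sum poly_monom sum_distrib_left sum_subtractf algebra_simps)
    then show ?case
      by simp
  qed
  moreover have "I \<in> H1" "AE z in circle. cmod (I z) = 1"
    using I by (auto simp: is_inner_def Hinf_def)
  ultimately show ?thesis
    using inner_rational_blaschke by blast
qed

text \<open>The spectra of \<open>w\<close> and \<open>cnj w\<close> meet only at frequency 0, so a
  constant sum forces every other coefficient of \<open>w\<close> to vanish.\<close>

lemma AE_zero_of_const_Re:
  assumes w: "w \<in> H1" "fourier_coeff w 0 = 0" and const: "AE z in circle. Re (w z) = c"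
  shows "AE z in circle. w z = 0"
proof -
  note int = H1_integrable[OF w(1)] and meas [measurable] = H1_measurable[OF w(1)]
  have sum: "fourier_coeff w k + cnj (fourier_coeff w (- k)) = 2 * of_real c * of_bool (k = 0)" for k
  proof -
    have "fourier_coeff (\<lambda>z. w z + cnj (w z)) k = fourier_coeff (poly [:2 * of_real c:]) k"
    proof (intro fourier_coeff_cong_AE)
      show "AE z in circle. w z + cnj (w z) = poly [:2 * of_real c:] z"
        using const by eventually_elim (simp add: complex_eq_iff)
      show "(\<lambda>z. w z + cnj (w z)) \<in> borel_measurable circle"
        using int by (intro borel_measurable_integrable) simp
    qed measurable
    then show ?thesis
      using int by (auto simp: fourier_coeff_add fourier_coeff_cnj fourier_coeff_poly coeff_pCons split: nat.splits)
  qed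
  have "fourier_coeff w k = 0" for k
    using H1_fourier_coeff[OF w(1), of k] H1_fourier_coeff[OF w(1), of "- k"] sum[of k] w(2)
    by (cases "k = 0"; cases "k < 0") auto
  then show ?thesis
    using fourier_coeff_unique[OF int H1_integrable[OF H1_const[of 0]]] by simp
qed

section \<open>Real-linear conditions and the construction of a nonconstant multiplier\<close>

lemma sum_lessThan_add:
  fixes g :: "nat \<Rightarrow> 'a :: comm_monoid_add"
  shows "(\<Sum>i<m + n. g i) = (\<Sum>i<m. g i) + (\<Sum>i<n. g (m + i))"
  by (induction n) (simp_all add: add.assoc)

text \<open>The equations are only real-linear in \<open>\<alpha>\<close>, so they are counted over
  the reals: \<open>2 * M\<close> equations for \<open>2 * M + 2\<close> unknowns.\<close>

lemma homogeneous_conjugate_system: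
  fixes A B :: "nat \<Rightarrow> nat \<Rightarrow> complex"
  shows "\<exists>\<alpha>. (\<exists>n\<le>M. \<alpha> n \<noteq> 0) \<and> (\<forall>j<M. (\<Sum>n\<le>M. A j n * \<alpha> n + B j n * cnj (\<alpha> n)) = 0)"
proof -
  define N where "N = Suc M"
  \<comment> \<open>The first \<open>N\<close> real unknowns are the real parts of
    \<open>\<alpha>\<close>, the last \<open>N\<close> its imaginary parts; \<open>e\<close> is the
    corresponding real basis direction.\<close>
  define e where "e = (\<lambda>i. if i < N then 1 else \<i>)"
  define y where "y = (\<lambda>j i. A j (i mod N) * e i + B j (i mod N) * cnj (e i))"
  obtain x :: "nat \<Rightarrow> real" where x: "\<exists>i<2 * N. x i \<noteq> 0"
      "\<And>j. j < 2 * M \<Longrightarrow> (\<Sum>i<2 * N. (if j < M then Re (y j i) else Im (y (j - M) i)) * x i) = 0"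
    using homogeneous_system[of "2 * M" "2 * N" "\<lambda>j i. if j < M then Re (y j i) else Im (y (j - M) i)"]
    by (auto simp: N_def)
  define \<alpha> where "\<alpha> = (\<lambda>n. Complex (x n) (x (N + n)))"
  have split: "(\<Sum>i<2 * N. g i) = (\<Sum>n<N. g n + g (N + n))" for g :: "nat \<Rightarrow> complex"
    unfolding mult_2 sum.distrib by (rule sum_lessThan_add)
  show ?thesis
  proof (intro exI[of _ \<alpha>] conjI allI impI)
    obtain i where i: "i < 2 * N" "x i \<noteq> 0"
      using x(1) by blast
    show "\<exists>n\<le>M. \<alpha> n \<noteq> 0"
    proof (cases "i < N")
      case True
      then show ?thesis
        using i by (intro exI[of _ i]) (auto simp: \<alpha>_def complex_eq_iff N_def)
    next
      case False
      then show ?thesis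
        using i by (intro exI[of _ "i - N"]) (auto simp: \<alpha>_def complex_eq_iff N_def)
    qed
  next
    fix j assume j: "j < M"
    have "(\<Sum>i<2 * N. y j i * of_real (x i)) = 0"
    proof (rule complex_eqI)
      show "Re (\<Sum>i<2 * N. y j i * of_real (x i)) = Re 0"
        using x(2)[of j] j by simp
      show "Im (\<Sum>i<2 * N. y j i * of_real (x i)) = Im 0"
        using x(2)[of "M + j"] j by simp
    qed
    also have "(\<Sum>i<2 * N. y j i * of_real (x i)) = (\<Sum>n<N. A j n * \<alpha> n + B j n * cnj (\<alpha> n))"
      unfolding split
    proof (intro sum.cong refl)
      fix n assume "n \<in> {..<N}"
      then have n: "n < N"
        by simp
      have "y j n = A j n + B j n" "y j (N + n) = A j n * \<i> - B j n * \<i>"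
        using n by (simp_all add: y_def e_def)
      moreover have "\<alpha> n = of_real (x n) + \<i> * of_real (x (N + n))"
          "cnj (\<alpha> n) = of_real (x n) - \<i> * of_real (x (N + n))"
        by (simp_all add: \<alpha>_def complex_eq_iff)
      ultimately show "y j n * of_real (x n) + y j (N + n) * of_real (x (N + n)) = A j n * \<alpha> n + B j n * cnj (\<alpha> n)"
        by (simp only:) (simp add: algebra_simps)
    qed
    also have "{..<N} = {..M}"
      by (auto simp: N_def)
    finally show "(\<Sum>n\<le>M. A j n * \<alpha> n + B j n * cnj (\<alpha> n)) = 0" .
  qed
qed

theorem extreme_imp_blaschke:
  fixes k :: "nat \<Rightarrow> int"
  assumes I: "is_inner I" and F: "F \<in> H1"
    and f: "f \<in> H1_gap (k ` {1..M})" "L1_norm f = 1" "AE z in circle. f z \<noteq> 0"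
    and eq: "AE z in circle. f z = I z * F z"
    and extreme: "extreme_point f (unit_ball (H1_gap (k ` {1..M})))"
  shows "\<exists>as. blaschke_with_zeros I as \<and> length as \<le> M"
proof -
  have I_Hinf: "I \<in> Hinf" and I_mod: "AE z in circle. cmod (I z) = 1"
    using I by (auto simp: is_inner_def)
  have f_H1: "f \<in> H1"
    using f(1) by (simp add: H1_gap_def)
  define u where "u = (\<lambda>n. shift_coeff I (Suc n))"
  define w where "w = (\<lambda>n. shift_conj I (Suc n))"
  have u: "u n \<in> Hinf" and w: "w n \<in> Hinf" "fourier_coeff (w n) 0 = 0" for n
    unfolding u_def w_def using I_Hinf
    by (auto intro: shift_coeff_Hinf shift_conj_Hinf shift_conj_coeff_0)
  define A where "A = (\<lambda>j n. fourier_coeff (\<lambda>z. u n z * F z) (k (Suc j)))"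
  define B where "B = (\<lambda>j n. fourier_coeff (\<lambda>z. w n z * f z) (k (Suc j)))"
  obtain \<alpha> where \<alpha>: "\<exists>n\<le>M. \<alpha> n \<noteq> 0" "\<And>j. j < M \<Longrightarrow> (\<Sum>n\<le>M. A j n * \<alpha> n + B j n * cnj (\<alpha> n)) = 0"
    using homogeneous_conjugate_system[of M A B] by blast
  define U where "U = (\<lambda>z. \<Sum>n\<le>M. \<alpha> n * u n z)"
  define W where "W = (\<lambda>z. \<Sum>n\<le>M. cnj (\<alpha> n) * w n z)"
  have U: "U \<in> Hinf" and W: "W \<in> Hinf"
    unfolding U_def W_def by (intro Hinf_sum Hinf_cmult u w; simp)+
  note [measurable] = Hinf_measurable[OF U] Hinf_measurable[OF W] Hinf_measurable[OF I_Hinf] H1_measurable[OF F] H1_measurable[OF f_H1]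
  have W0: "fourier_coeff W 0 = 0"
    unfolding W_def using w
    by (subst fourier_coeff_sum) (auto simp: fourier_coeff_cmult H1_integrable Hinf_imp_H1)
  have UW: "AE z in circle. I z * cnj (U z) = W z"
    using I_mod AE_space
  proof eventually_elim
    case (elim z)
    then have z: "z \<in> sphere 0 1"
      by simp
    have "I z * cnj (U z) = (\<Sum>n\<le>M. cnj (\<alpha> n) * (I z * cnj (u n z)))"
      by (simp add: U_def sum_distrib_left mult.left_commute)
    then show ?case
      using inner_mult_cnj_shift_coeff[where I = I, OF z elim(1)] by (simp add: u_def w_def W_def)
  qed
  define h where "h = (\<lambda>z. Re (W z))"
  have h_meas: "h \<in> borel_measurable circle"
    unfolding h_def by measurable
  obtain C where "AE z in circle. cmod (W z) \<le> C"
    using W by (auto simp: Hinf_def)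
  then have h_bound: "AE z in circle. \<bar>h z\<bar> \<le> C"
    by eventually_elim (auto simp: h_def intro: order_trans[OF abs_Re_le_cmod])
  \<comment> \<open>This is \<open>f * Re W\<close>, because \<open>cnj W = cnj I * U\<close> gives
    \<open>f * cnj W = F * U\<close>; in this form it is visibly analytic, and its coefficients are
    real-linear in \<open>\<alpha>\<close>.\<close>
  define G where "G = (\<lambda>z. (U z * F z + W z * f z) / 2)"
  have fh: "AE z in circle. G z = f z * of_real (h z)"
    using eq UW I_mod
  proof eventually_elim
    case (elim z)
    have one: "I z * cnj (I z) = 1"
      by (rule mult_cnj_eq_1[OF elim(3)])
    have "cnj (W z) = cnj (I z) * U z"
      unfolding elim(2)[symmetric] by simp
    then have "f z * cnj (W z) = (I z * cnj (I z)) * (U z * F z)"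
      unfolding elim(1) by (simp add: mult_ac)
    then have UF: "U z * F z = f z * cnj (W z)"
      unfolding one by simp
    have h_eq: "complex_of_real (h z) = (W z + cnj (W z)) / 2"
      by (simp add: h_def complex_eq_iff)
    show ?case
      unfolding G_def UF h_eq by (simp add: algebra_simps)
  qed
  have UF_H1: "(\<lambda>z. U z * F z) \<in> H1" and Wf_H1: "(\<lambda>z. W z * f z) \<in> H1"
    by (intro H1_mult_Hinf(1) F f_H1 U W)+
  have sum_H1: "G \<in> H1"
    unfolding G_def using H1_cmult[OF H1_add[OF UF_H1 Wf_H1], of "1 / 2"] by simp
  have coeff: "fourier_coeff G (k (Suc j)) = 0" if j: "j < M" for j
  proof -
    have "fourier_coeff G (k (Suc j)) =
        fourier_coeff (\<lambda>z. (1 / 2) * (\<Sum>n\<le>M. \<alpha> n * (u n z * F z) + cnj (\<alpha> n) * (w n z * f z))) (k (Suc j))"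
      by (simp add: G_def U_def W_def sum.distrib sum_distrib_right mult.assoc)
    also have "\<dots> = (1 / 2) * (\<Sum>n\<le>M. \<alpha> n * A j n + cnj (\<alpha> n) * B j n)"
    proof -
      have 1: "integrable circle (\<lambda>z. u n z * F z)" "integrable circle (\<lambda>z. w n z * f z)" for n
        by (intro H1_integrable H1_mult_Hinf(1) F f_H1 u w)+
      have "fourier_coeff (\<lambda>z. \<Sum>n\<le>M. \<alpha> n * (u n z * F z) + cnj (\<alpha> n) * (w n z * f z)) (k (Suc j)) =
          (\<Sum>n\<le>M. fourier_coeff (\<lambda>z. \<alpha> n * (u n z * F z) + cnj (\<alpha> n) * (w n z * f z)) (k (Suc j)))"
        by (intro fourier_coeff_sum Bochner_Integration.integrable_add integrable_mult_right 1)
      then show ?thesis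
        unfolding fourier_coeff_cmult A_def B_def by (simp add: fourier_coeff_add fourier_coeff_cmult 1)
    qed
    also have "\<dots> = 0"
      using \<alpha>(2)[OF j] by (simp add: mult.commute)
    finally show ?thesis .
  qed
  have "G \<in> H1_gap (k ` {1..M})"
  proof -
    have "fourier_coeff G (k j) = 0" if "j \<in> {1..M}" for j
      using coeff[of "j - 1"] that by auto
    then show ?thesis
      using sum_H1 by (auto simp: H1_gap_def)
  qed
  then have "(\<lambda>z. f z * of_real (h z)) \<in> H1_gap (k ` {1..M})"
    by (rule H1_gap_cong_AE[OF _ fh]) (use h_meas in measurable)
  then obtain c where "AE z in circle. h z = c"
    using extreme_pointD[OF extreme f h_meas h_bound] by blast
  \<comment> \<open>Now \<open>Re W\<close> is constant and \<open>W\<close> has mean zero. With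
    \<open>W\<close> also \<open>U\<close> vanishes, since \<open>|I| = 1\<close>, and
    \<open>U = 0\<close> is a linear relation among the first \<open>M + 1\<close> shifts.\<close>
  then have "AE z in circle. W z = 0"
    unfolding h_def by (rule AE_zero_of_const_Re[OF Hinf_imp_H1[OF W] W0])
  with UW I_mod have "AE z in circle. U z = 0"
    by eventually_elim auto
  then have "AE z in circle. (\<Sum>n<Suc M. \<alpha> n * shift_coeff I (Suc n) z) = 0"
    by (simp add: U_def u_def lessThan_Suc_atMost)
  moreover have "\<exists>n<Suc M. \<alpha> n \<noteq> 0"
    using \<alpha>(1) by (auto simp: less_Suc_eq_le)
  ultimately show ?thesis
    using dependent_shifts_blaschke[OF I, of "Suc M" \<alpha>] by simp
qed

section \<open>Real trigonometric polynomials and the matrix\<close>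

text \<open>The factor 2 makes \<open>\<gamma> l\<close> the Fourier coefficient for
  \<open>1 \<le> l \<le> m\<close>, but the zeroth coefficient becomes
  \<open>2 * Re (\<gamma> 0)\<close>. This matches the column \<open>l = 0\<close> of the matrix,
  whose entries are doubled, and explains the normalisation
  \<open>Im (\<gamma> 0) = 0\<close>.\<close>

definition real_trig :: "nat \<Rightarrow> (nat \<Rightarrow> complex) \<Rightarrow> complex \<Rightarrow> real" where
  "real_trig m \<gamma> z = 2 * Re (\<Sum>l\<le>m. \<gamma> l * z ^ l)"

lemma real_trig_continuous: "continuous_on S (real_trig m \<gamma>)"
  unfolding real_trig_def[abs_def] by (intro continuous_intros)

lemma real_trig_measurable [measurable]: "real_trig m \<gamma> \<in> borel_measurable circle"
  by (intro borel_measurable_circleI real_trig_continuous)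

lemma real_trig_cong:
  assumes "\<And>l. l \<le> m \<Longrightarrow> \<gamma> l = \<gamma>' l"
  shows "real_trig m \<gamma> = real_trig m \<gamma>'"
  using assms by (intro ext) (simp add: real_trig_def)

lemma real_trig_cmult: "real_trig m (\<lambda>l. of_real c * \<gamma> l) z = c * real_trig m \<gamma> z"
proof -
  have "(\<Sum>l\<le>m. of_real c * \<gamma> l * z ^ l) = of_real c * (\<Sum>l\<le>m. \<gamma> l * z ^ l)"
    by (simp only: sum_distrib_left mult.assoc)
  then show ?thesis
    by (simp add: real_trig_def del: Re_sum)
qed

lemma of_real_real_trig:
  assumes "z \<in> sphere 0 1"
  shows "of_real (real_trig m \<gamma> z) = (\<Sum>l\<le>m. \<gamma> l * z powi int l + cnj (\<gamma> l) * z powi (- int l))"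
proof -
  define s where "s = (\<Sum>l\<le>m. \<gamma> l * z ^ l)"
  have "complex_of_real (real_trig m \<gamma> z) = s + cnj s"
    by (simp add: real_trig_def s_def[symmetric] complex_eq_iff del: Re_sum)
  also have "cnj s = (\<Sum>l\<le>m. cnj (\<gamma> l) * cnj z powi int l)"
    by (simp add: s_def)
  also have "\<dots> = (\<Sum>l\<le>m. cnj (\<gamma> l) * z powi (- int l))"
    by (simp only: cnj_powi_sphere[OF assms])
  finally show ?thesis
    by (simp add: s_def sum.distrib)
qed

lemma integrable_real_trig_mult:
  assumes "integrable circle g"
  shows "integrable circle (\<lambda>z. of_real (real_trig m \<gamma> z) * g z :: complex)"
proof -
  obtain C where "\<And>z. z \<in> sphere 0 1 \<Longrightarrow> norm (real_trig m \<gamma> z) \<le> C"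
    by (rule continuous_circle_bound[OF real_trig_continuous[of _ m \<gamma>]]) blast
  then have "AE z in circle. norm (complex_of_real (real_trig m \<gamma> z)) \<le> C"
    by (intro AE_I2) auto
  then show ?thesis
    by (intro integrable_mult_bounded assms) auto
qed

lemma fourier_coeff_real_trig_mult:
  assumes "integrable circle g"
  shows "fourier_coeff (\<lambda>z. of_real (real_trig m \<gamma> z) * g z) k =
    (\<Sum>l\<le>m. \<gamma> l * fourier_coeff g (k - int l) + cnj (\<gamma> l) * fourier_coeff g (k + int l))"
proof -
  have "fourier_coeff (\<lambda>z. of_real (real_trig m \<gamma> z) * g z) k = fourier_coeff (\<lambda>z.
      \<Sum>l\<le>m. \<gamma> l * (z powi int l * g z) + cnj (\<gamma> l) * (z powi (- int l) * g z)) k"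
    by (intro fourier_coeff_cong)
       (simp only: of_real_real_trig sum_distrib_right distrib_right mult.assoc)
  also have "\<dots> = (\<Sum>l\<le>m. fourier_coeff (\<lambda>z. \<gamma> l * (z powi int l * g z) + cnj (\<gamma> l) * (z powi (- int l) * g z)) k)"
    by (intro fourier_coeff_sum Bochner_Integration.integrable_add integrable_mult_right integrable_powi_mult assms)
  also have "\<dots> = (\<Sum>l\<le>m. \<gamma> l * fourier_coeff g (k - int l) + cnj (\<gamma> l) * fourier_coeff g (k + int l))"
  proof (intro sum.cong refl)
    fix l
    have "fourier_coeff (\<lambda>z. \<gamma> l * (z powi int l * g z) + cnj (\<gamma> l) * (z powi (- int l) * g z)) k =
        fourier_coeff (\<lambda>z. \<gamma> l * (z powi int l * g z)) k + fourier_coeff (\<lambda>z. cnj (\<gamma> l) * (z powi (- int l) * g z)) k"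
      by (intro fourier_coeff_add integrable_mult_right integrable_powi_mult assms)
    then show "fourier_coeff (\<lambda>z. \<gamma> l * (z powi int l * g z) + cnj (\<gamma> l) * (z powi (- int l) * g z)) k =
        \<gamma> l * fourier_coeff g (k - int l) + cnj (\<gamma> l) * fourier_coeff g (k + int l)"
      by (simp only: fourier_coeff_cmult fourier_coeff_shift diff_minus_eq_add)
  qed
  finally show ?thesis .
qed

lemma fourier_coeff_real_trig:
  "fourier_coeff (\<lambda>z. of_real (real_trig m \<gamma> z)) (int j) =
    (if m < j then 0 else if j = 0 then \<gamma> 0 + cnj (\<gamma> 0) else \<gamma> j)"
proof -
  have "fourier_coeff (\<lambda>z. of_real (real_trig m \<gamma> z)) (int j) =
      fourier_coeff (\<lambda>z. of_real (real_trig m \<gamma> z) * poly 1 z) (int j)"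
    by simp
  also have "\<dots> = (\<Sum>l\<le>m. \<gamma> l * fourier_coeff (poly 1) (int j - int l) + cnj (\<gamma> l) * fourier_coeff (poly 1) (int j + int l))"
    by (rule fourier_coeff_real_trig_mult) (rule integrable_poly)
  also have "\<dots> = (\<Sum>l\<le>m. if l = j then \<gamma> j + (if j = 0 then cnj (\<gamma> 0) else 0) else 0)"
    by (intro sum.cong) (auto simp: fourier_coeff_poly)
  also have "\<dots> = (if m < j then 0 else if j = 0 then \<gamma> 0 + cnj (\<gamma> 0) else \<gamma> j)"
    by (simp add: sum.delta)
  finally show ?thesis .
qed

lemma real_trig_inject:
  assumes AE: "AE z in circle. real_trig m \<gamma> z = real_trig m \<gamma>' z"
    and Im: "Im (\<gamma> 0) = 0" "Im (\<gamma>' 0) = 0" and l: "l \<le> m"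
  shows "\<gamma> l = \<gamma>' l"
proof -
  have "fourier_coeff (\<lambda>z. of_real (real_trig m \<gamma> z)) (int l) = fourier_coeff (\<lambda>z. of_real (real_trig m \<gamma>' z)) (int l)"
    by (intro fourier_coeff_cong_AE) (use AE in auto)
  then show ?thesis
    using l Im by (auto simp: fourier_coeff_real_trig complex_eq_iff split: if_splits)
qed

text \<open>Analyticity after the shift by \<open>m\<close> removes the frequencies of
  \<open>g\<close> below \<open>- m\<close>; since \<open>g\<close> is real, conjugate symmetry
  removes those above \<open>m\<close>.\<close>

lemma real_trig_exists:
  fixes g :: "complex \<Rightarrow> real"
  assumes g: "integrable circle g" and gH: "(\<lambda>z. z powi int m * of_real (g z)) \<in> H1"
  shows "\<exists>\<gamma>. Im (\<gamma> 0) = 0 \<and> (AE z in circle. g z = real_trig m \<gamma> z)"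
proof -
  define c where "c = fourier_coeff (\<lambda>z. complex_of_real (g z))"
  \<comment> \<open>The constant term is halved because \<open>real_trig\<close> adds its
    conjugate.\<close>
  define \<gamma> where "\<gamma> = (\<lambda>l. if l = 0 then c 0 / 2 else c (int l))"
  have int: "integrable circle (\<lambda>z. complex_of_real (g z))"
    using g by simp
  have neg: "c (- k) = cnj (c k)" for k
    using fourier_coeff_cnj[of "\<lambda>z. complex_of_real (g z)" "- k"] by (simp add: c_def)
  have Im0: "Im (c 0) = 0"
    using neg[of 0] by (simp add: complex_eq_iff)
  have zero: "c k = 0" if "k < - int m" for k
    using H1_fourier_coeff[OF gH, of "k + int m"] that unfolding fourier_coeff_shift c_def by simp
  have int_trig: "integrable circle (\<lambda>z. complex_of_real (real_trig m \<gamma> z))"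
    using integrable_real_trig_mult[OF integrable_poly[of 1], of m \<gamma>] by simp
  have nonneg: "c (int j) = fourier_coeff (\<lambda>z. complex_of_real (real_trig m \<gamma> z)) (int j)" for j
  proof (cases "m < j")
    case True
    then have "cnj (c (int j)) = 0"
      using neg[of "int j"] zero[of "- int j"] by simp
    then show ?thesis
      using True by (simp add: fourier_coeff_real_trig)
  next
    case False
    then show ?thesis
      using Im0 by (auto simp: fourier_coeff_real_trig \<gamma>_def complex_eq_iff)
  qed
  have "c k = fourier_coeff (\<lambda>z. complex_of_real (real_trig m \<gamma> z)) k" for k
  proof (cases "0 \<le> k")
    case True
    then show ?thesis
      using nonneg[of "nat k"] by simp
  next
    case False
    then have "c k = cnj (c (int (nat (- k))))"
      using neg[of "- k"] by simp
    also have "\<dots> = cnj (fourier_coeff (\<lambda>z. complex_of_real (real_trig m \<gamma> z)) (- k))"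
      using False nonneg[of "nat (- k)"] by simp
    also have "\<dots> = fourier_coeff (\<lambda>z. complex_of_real (real_trig m \<gamma> z)) k"
      using fourier_coeff_cnj[of "\<lambda>z. complex_of_real (real_trig m \<gamma> z)" k] by simp
    finally show ?thesis .
  qed
  then have "AE z in circle. complex_of_real (g z) = of_real (real_trig m \<gamma> z)"
    unfolding c_def by (intro fourier_coeff_unique int int_trig)
  then have "AE z in circle. g z = real_trig m \<gamma> z"
    by eventually_elim simp
  moreover have "Im (\<gamma> 0) = 0"
    using Im0 by (simp add: \<gamma>_def)
  ultimately show ?thesis
    by blast
qed

text \<open>A real vector of dimension \<open>2 * m + 1\<close> lists the real parts of \<open>\<gamma>\<^sub>0, \<dots>, \<gamma>\<^sub>m\<close>, followed by the
  imaginary parts of \<open>\<gamma>\<^sub>1, \<dots>, \<gamma>\<^sub>m\<close>.\<close>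

definition vec_coeffs :: "nat \<Rightarrow> real Matrix.vec \<Rightarrow> nat \<Rightarrow> complex" where
  "vec_coeffs m x l = Complex (vec_index x l) (if l = 0 then 0 else vec_index x (m + l))"

lemma Im_vec_coeffs_0 [simp]: "Im (vec_coeffs m x 0) = 0"
  by (simp add: vec_coeffs_def)

lemma vec_coeffs_surj:
  assumes "Im (\<gamma> 0) = 0"
  shows "\<exists>x\<in>carrier_vec (2 * m + 1). \<forall>l\<le>m. vec_coeffs m x l = \<gamma> l"
proof (intro bexI[of _ "Matrix.vec (2 * m + 1) (\<lambda>i. if i \<le> m then Re (\<gamma> i) else Im (\<gamma> (i - m)))"] allI impI)
  fix l assume "l \<le> m"
  then show "vec_coeffs m (Matrix.vec (2 * m + 1) (\<lambda>i. if i \<le> m then Re (\<gamma> i) else Im (\<gamma> (i - m)))) l = \<gamma> l"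
    using assms by (auto simp: vec_coeffs_def complex_eq_iff)
qed simp

lemma vec_coeffs_inject:
  assumes "x \<in> carrier_vec (2 * m + 1)" "y \<in> carrier_vec (2 * m + 1)"
    and eq: "\<And>l. l \<le> m \<Longrightarrow> vec_coeffs m x l = vec_coeffs m y l"
  shows "x = y"
proof (rule eq_vecI)
  fix i assume "i < dim_vec y"
  then have i: "i < 2 * m + 1"
    using assms(2) by simp
  show "vec_index x i = vec_index y i"
  proof (cases "i \<le> m")
    case True
    then show ?thesis
      using eq[of i] by (simp add: vec_coeffs_def)
  next
    case False
    then show ?thesis
      using eq[of "i - m"] i by (simp add: vec_coeffs_def)
  qed
qed (use assms in simp)

lemma vec_coeffs_smult:
  assumes "x \<in> carrier_vec (2 * m + 1)" "l \<le> m"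
  shows "vec_coeffs m (c \<cdot>\<^sub>v x) l = of_real c * vec_coeffs m x l"
  using assms by (auto simp: vec_coeffs_def complex_eq_iff)

text \<open>With \<open>C\<close> the coefficients of \<open>F0\<close>, the number \<open>S\<close>
  is the sum of \<open>\<gamma> l * C (k - l - m) + cnj (\<gamma> l) * C (k + l - m)\<close>; the
  shift by \<open>m\<close> comes from the factor \<open>z powi m\<close>. Separating real and
  imaginary parts produces the four blocks and the minus sign in the last one.\<close>

lemma frakM_mult_vec:
  fixes F as k
  defines "m \<equiv> length as"
  assumes x: "x \<in> carrier_vec (2 * m + 1)" and F0: "integrable circle (F0 F as)" and r: "r < M"
  defines "S \<equiv> fourier_coeff (\<lambda>z. of_real (real_trig m (vec_coeffs m x) z) * (z powi int m * F0 F as z)) (k (r + 1))"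
  shows "vec_index (frakM M k F as *\<^sub>v x) r = Re S"
    and "vec_index (frakM M k F as *\<^sub>v x) (M + r) = Im S"
proof -
  let ?C = "fourier_coeff (F0 F as)"
  let ?\<gamma> = "vec_coeffs m x"
  have S: "S = (\<Sum>l\<le>m. ?\<gamma> l * ?C (k (r + 1) - int l - int m) + cnj (?\<gamma> l) * ?C (k (r + 1) + int l - int m))"
    unfolding S_def
    by (subst fourier_coeff_real_trig_mult[OF integrable_powi_mult[OF F0]]) (simp only: fourier_coeff_shift)
  have split: "(\<Sum>l\<le>m. Re (?\<gamma> l) * a l + Im (?\<gamma> l) * b l) =
      (\<Sum>l<m + 1. a l * vec_index x l) + (\<Sum>c<m. b (c + 1) * vec_index x (m + 1 + c))" for a b
  proof -
    \<comment> \<open>The term \<open>l = 0\<close> drops out because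
      \<open>Im (\<gamma> 0) = 0\<close>; hence the right-hand blocks start at
      \<open>l = 1\<close>.\<close>
    have "(\<Sum>l\<le>m. Im (?\<gamma> l) * b l) = (\<Sum>c<m. Im (?\<gamma> (Suc c)) * b (Suc c))"
      by (subst sum.atMost_shift) simp
    then show ?thesis
      by (simp add: sum.distrib vec_coeffs_def lessThan_Suc_atMost mult.commute)
  qed
  have prod: "vec_index (frakM M k F as *\<^sub>v x) i =
      (\<Sum>l<m + 1. frakM M k F as $$ (i, l) * vec_index x l) +
      (\<Sum>c<m. frakM M k F as $$ (i, m + 1 + c) * vec_index x (m + 1 + c))" if i: "i < 2 * M" for i
  proof -
    have "vec_index (frakM M k F as *\<^sub>v x) i = (\<Sum>l<(m + 1) + m. frakM M k F as $$ (i, l) * vec_index x l)"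
      using frakM_carrier[of M k F as] i x
      by (auto simp: scalar_prod_def m_def atLeast0LessThan mult_2 intro!: sum.cong)
    then show ?thesis
      by (simp only: sum_lessThan_add)
  qed
  have entry: "frakM M k F as $$ (r, l) = entry_plus (coeff_A F as) k m (r + 1) l"
      "frakM M k F as $$ (M + r, l) = entry_plus (coeff_B F as) k m (r + 1) l" if "l < m + 1" for l
    using that r by (auto simp: frakM_def Let_def block_plus_def block_minus_def m_def)
  have entry': "frakM M k F as $$ (r, m + 1 + c) = entry_minus (coeff_B F as) k m (r + 1) (c + 1)"
      "frakM M k F as $$ (M + r, m + 1 + c) = - entry_minus (coeff_A F as) k m (r + 1) (c + 1)" if "c < m" for c
    using that r by (auto simp: frakM_def Let_def block_plus_def block_minus_def m_def)
  have "vec_index (frakM M k F as *\<^sub>v x) r =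
      (\<Sum>l\<le>m. Re (?\<gamma> l) * entry_plus (coeff_A F as) k m (r + 1) l + Im (?\<gamma> l) * entry_minus (coeff_B F as) k m (r + 1) l)"
    unfolding split using prod[of r] r entry entry' by simp
  also have "\<dots> = Re S"
    unfolding S Re_sum
    by (intro sum.cong refl) (simp add: entry_plus_def entry_minus_def coeff_A_def coeff_B_def algebra_simps)
  finally show "vec_index (frakM M k F as *\<^sub>v x) r = Re S" .
  have "vec_index (frakM M k F as *\<^sub>v x) (M + r) =
      (\<Sum>l\<le>m. Re (?\<gamma> l) * entry_plus (coeff_B F as) k m (r + 1) l + Im (?\<gamma> l) * (- entry_minus (coeff_A F as) k m (r + 1) l))"
    unfolding split using prod[of "M + r"] r entry entry' by simp
  also have "\<dots> = Im S"
    unfolding S Im_sum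
    by (intro sum.cong refl) (simp add: entry_plus_def entry_minus_def coeff_A_def coeff_B_def algebra_simps)
  finally show "vec_index (frakM M k F as *\<^sub>v x) (M + r) = Im S" .
qed

lemma frakM_mult_vec_eq_0_iff:
  fixes F as k
  defines "m \<equiv> length as"
  assumes x: "x \<in> carrier_vec (2 * m + 1)" and F0: "integrable circle (F0 F as)"
  shows "frakM M k F as *\<^sub>v x = 0\<^sub>v (2 * M) \<longleftrightarrow> (\<forall>j\<in>{1..M}.
    fourier_coeff (\<lambda>z. of_real (real_trig m (vec_coeffs m x) z) * (z powi int m * F0 F as z)) (k j) = 0)"
    (is "?L \<longleftrightarrow> (\<forall>j\<in>{1..M}. ?S (k j) = 0)")
proof
  note entries = frakM_mult_vec[OF x[unfolded m_def] F0, where M = M and k = k, folded m_def]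
  {
    assume L: ?L
    show "\<forall>j\<in>{1..M}. ?S (k j) = 0"
    proof
      fix j assume j: "j \<in> {1..M}"
      then have r: "j - 1 < M" "j - 1 + 1 = j"
        by auto
      show "?S (k j) = 0"
        using entries[OF r(1)] r L by (simp add: complex_eq_iff)
    qed
  next
    assume R: "\<forall>j\<in>{1..M}. ?S (k j) = 0"
    show ?L
    proof (rule eq_vecI)
      fix i assume "i < dim_vec (0\<^sub>v (2 * M) :: real Matrix.vec)"
      then have i: "i < 2 * M"
        by simp
      have "vec_index (frakM M k F as *\<^sub>v x) i = 0"
      proof (cases "i < M")
        case True
        then show ?thesis
          using entries(1)[OF True] R by simp
      next
        case False
        then have r: "i - M < M" "M + (i - M) = i"
          using i by auto
        have "?S (k (i - M + 1)) = 0"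
          using R r(1) by simp
        then show ?thesis
          using entries(2)[OF r(1)] by (simp only: r(2)) simp
      qed
      then show "vec_index (frakM M k F as *\<^sub>v x) i = vec_index (0\<^sub>v (2 * M)) i"
        using i by simp
    qed (use frakM_carrier[of M k F as] in simp)
  }
qed

section \<open>Multipliers for a finite Blaschke inner factor\<close>

definition blaschke_denom :: "complex list \<Rightarrow> complex poly" where
  "blaschke_denom as = (\<Prod>a\<leftarrow>as. [:1, - cnj a:])"

definition blaschke_numer :: "complex list \<Rightarrow> complex poly" where
  "blaschke_numer as = (\<Prod>a\<leftarrow>as. [:- a, 1:])"

lemma poly_blaschke_denom_Nil [simp]: "poly (blaschke_denom []) z = 1"
  by (simp add: blaschke_denom_def)

lemma poly_blaschke_denom_Cons [simp]:
  "poly (blaschke_denom (a # as)) z = (1 - cnj a * z) * poly (blaschke_denom as) z"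
  by (simp add: blaschke_denom_def algebra_simps)

lemma poly_blaschke_numer_Cons [simp]:
  "poly (blaschke_numer (a # as)) z = (z - a) * poly (blaschke_numer as) z"
  by (simp add: blaschke_numer_def algebra_simps)

lemma poly_blaschke_numer_Nil [simp]: "poly (blaschke_numer []) z = 1"
  by (simp add: blaschke_numer_def)

lemma blaschke_eq_quotient:
  "blaschke as z = poly (blaschke_numer as) z / poly (blaschke_denom as) z"
  by (induction as) (simp_all add: blaschke_def)

lemma F0_eq_quotient: "F0 F as z = F z / (poly (blaschke_denom as) z)\<^sup>2"
proof -
  have "(\<Prod>a\<leftarrow>as. 1 / (1 - cnj a * z)\<^sup>2) = 1 / (poly (blaschke_denom as) z)\<^sup>2"
    by (induction as) (simp_all add: power_mult_distrib)
  then show ?thesis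
    by (simp add: F0_def)
qed

lemma blaschke_denom_nonzero:
  assumes "set as \<subseteq> ball 0 1" "z \<in> sphere 0 1"
  shows "poly (blaschke_denom as) z \<noteq> 0"
  using assms
proof (induction as)
  case (Cons a as)
  then have "1 - cnj a * z \<noteq> 0"
    by (intro one_minus_cnj_mult_nonzero) auto
  then show ?case
    using Cons by simp
qed simp

text \<open>Each factor satisfies \<open>z - a = z * cnj (1 - cnj a * z)\<close> on the circle. The
  resulting formula \<open>z ^ m * cnj D / D\<close> for the Blaschke product drives all
  computations below.\<close>

lemma poly_blaschke_numer:
  assumes "z \<in> sphere 0 1"
  shows "poly (blaschke_numer as) z = z ^ length as * cnj (poly (blaschke_denom as) z)"
proof (induction as)
  case (Cons a as)
  have "poly (blaschke_numer (a # as)) z = (z - a) * poly (blaschke_numer as) z"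
    by simp
  also have "\<dots> = z * cnj (1 - cnj a * z) * (z ^ length as * cnj (poly (blaschke_denom as) z))"
    by (simp only: sphere_minus_eq[OF assms, of a] Cons.IH)
  also have "\<dots> = z ^ length (a # as) * cnj ((1 - cnj a * z) * poly (blaschke_denom as) z)"
    by simp
  also have "(1 - cnj a * z) * poly (blaschke_denom as) z = poly (blaschke_denom (a # as)) z"
    by simp
  finally show ?case .
qed simp

lemma inverse_blaschke_denom_Hinf:
  assumes "set as \<subseteq> ball 0 1"
  shows "(\<lambda>z. 1 / poly (blaschke_denom as) z) \<in> Hinf"
  using assms
proof (induction as)
  case Nil
  show ?case
    using HinfI[OF H1_const[of 1], of 1] by simp
next
  case (Cons a as)
  then have "(\<lambda>z. 1 / (1 - cnj a * z) * (1 / poly (blaschke_denom as) z)) \<in> Hinf"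
    by (intro Hinf_mult geometric_Hinf) auto
  then show ?case
    by simp
qed

lemma F0_H1:
  assumes "F \<in> H1" "set as \<subseteq> ball 0 1"
  shows "F0 F as \<in> H1"
proof -
  let ?E = "\<lambda>z. 1 / poly (blaschke_denom as) z"
  have "(\<lambda>z. ?E z * ?E z * F z) \<in> H1"
    by (intro H1_mult_Hinf(1) Hinf_mult inverse_blaschke_denom_Hinf assms)
  then show ?thesis
    by (simp add: F0_eq_quotient[abs_def] power2_eq_square)
qed

text \<open>The real multipliers of \<open>f\<close> that stay in the space are exactly the functions \<open>multiplier x\<close>
  with \<open>x\<close> in the kernel of the matrix.\<close>

locale blaschke_outer =
  fixes M :: nat and k :: "nat \<Rightarrow> int" and f F :: "complex \<Rightarrow> complex" and as :: "complex list" and c :: complex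
  assumes f_gap: "f \<in> H1_gap (k ` {1..M})"
    and f_norm: "L1_norm f = 1"
    and outer: "is_outer F"
    and zeros: "set as \<subseteq> ball 0 1"
    and c: "cmod c = 1"
    and f_eq: "AE z in circle. f z = c * blaschke as z * F z"
begin

definition "m = length as"

definition "D = poly (blaschke_denom as)"

definition multiplier :: "real Matrix.vec \<Rightarrow> complex \<Rightarrow> real" where
  "multiplier x z = real_trig m (vec_coeffs m x) z / (cmod (D z))\<^sup>2"

lemma c_nonzero: "c \<noteq> 0"
  using c by auto

lemma D_nonzero: "z \<in> sphere 0 1 \<Longrightarrow> D z \<noteq> 0"
  unfolding D_def by (rule blaschke_denom_nonzero[OF zeros])

lemma F_H1: "F \<in> H1"
  using outer by (simp add: is_outer_def)

lemma f_measurable [measurable]: "f \<in> borel_measurable circle"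
  by (rule H1_gap_measurable[OF f_gap])

lemma blaschke_on_circle:
  assumes "z \<in> sphere 0 1"
  shows "blaschke as z = z powi int m * cnj (D z) / D z"
  by (simp add: blaschke_eq_quotient poly_blaschke_numer[OF assms] D_def m_def)

lemma cmod_blaschke:
  assumes "z \<in> sphere 0 1"
  shows "cmod (blaschke as z) = 1"
  using assms D_nonzero[OF assms] by (simp add: blaschke_on_circle norm_mult norm_divide norm_power)

lemma f_nonzero: "AE z in circle. f z \<noteq> 0"
proof -
  have "AE z in circle. F z \<noteq> 0"
    using outer by (simp add: is_outer_def)
  with f_eq show ?thesis
    using AE_space
  proof eventually_elim
    case (elim z)
    then have "blaschke as z \<noteq> 0"
      using cmod_blaschke[of z] by auto
    then show ?case
      using elim c_nonzero by simp
  qed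
qed

lemma F0_integrable: "integrable circle (F0 F as)"
  by (rule H1_integrable[OF F0_H1[OF F_H1 zeros]])

text \<open>The lowest frequency of the trigonometric polynomial is \<open>- m\<close>, and the
  factor \<open>z powi m\<close> compensates exactly for it.\<close>

lemma real_trig_F0_H1:
  "(\<lambda>z. of_real (real_trig m \<gamma> z) * (z powi int m * F0 F as z)) \<in> H1"
proof -
  note int = integrable_powi_mult[OF F0_integrable, of "int m"]
  have "fourier_coeff (\<lambda>z. of_real (real_trig m \<gamma> z) * (z powi int m * F0 F as z)) n = 0" if "n < 0" for n
    unfolding fourier_coeff_real_trig_mult[OF int] fourier_coeff_shift
    using H1_fourier_coeff[OF F0_H1[OF F_H1 zeros]] that by (intro sum.neutral) simp
  then show ?thesis
    using integrable_real_trig_mult[OF int] by (auto simp: H1_def)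
qed

lemma multiplier_continuous: "continuous_on (sphere 0 1) (multiplier x)"
  unfolding multiplier_def[abs_def]
  by (intro continuous_intros real_trig_continuous) (auto simp: D_def dest: blaschke_denom_nonzero[OF zeros] intro!: continuous_intros)

lemma multiplier_measurable [measurable]: "multiplier x \<in> borel_measurable circle"
  by (intro borel_measurable_circleI multiplier_continuous)

lemma multiplier_bounded: "\<exists>C. AE z in circle. \<bar>multiplier x z\<bar> \<le> C"
proof -
  obtain C where "\<And>z. z \<in> sphere 0 1 \<Longrightarrow> norm (multiplier x z) \<le> C"
    by (rule continuous_circle_bound[OF multiplier_continuous[of x]]) blast
  then show ?thesis
    by (intro exI[of _ C] AE_I2) auto
qed

lemma multiplier_gap_iff:
  assumes x: "x \<in> carrier_vec (2 * m + 1)"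
  shows "(\<lambda>z. f z * of_real (multiplier x z)) \<in> H1_gap (k ` {1..M}) \<longleftrightarrow>
    frakM M k F as *\<^sub>v x = 0\<^sub>v (2 * M)"
proof -
  define G where "G = (\<lambda>z. of_real (real_trig m (vec_coeffs m x) z) * (z powi int m * F0 F as z))"
  have G: "G \<in> H1"
    unfolding G_def by (rule real_trig_F0_H1)
  note [measurable] = H1_measurable[OF G]
  \<comment> \<open>The Blaschke product divided by \<open>|D|^2\<close> is
    \<open>z ^ m / D^2\<close>, and this is where the squared denominators in \<open>F0\<close> come
    from.\<close>
  have eq: "AE z in circle. f z * of_real (multiplier x z) = c * G z"
    using f_eq AE_space
  proof eventually_elim
    case (elim z)
    then have z: "z \<in> sphere 0 1"
      by simp
    show ?case
      unfolding multiplier_def G_def elim(1) blaschke_on_circle[OF z] F0_eq_quotient D_def[symmetric] of_real_divide complex_norm_square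
      using D_nonzero[OF z] by (simp add: field_simps power2_eq_square)
  qed
  have fm_meas: "(\<lambda>z. f z * of_real (multiplier x z)) \<in> borel_measurable circle"
    by measurable
  have coeff: "fourier_coeff (\<lambda>z. f z * of_real (multiplier x z)) n = c * fourier_coeff G n" for n
    using fourier_coeff_cong_AE[OF eq fm_meas, of n] by (simp add: fourier_coeff_cmult)
  have "AE z in circle. c * G z = f z * of_real (multiplier x z)"
    using eq by eventually_elim simp
  then have "(\<lambda>z. f z * of_real (multiplier x z)) \<in> H1"
    by (rule H1_cong_AE[OF H1_cmult[OF G] _ fm_meas])
  then have "(\<lambda>z. f z * of_real (multiplier x z)) \<in> H1_gap (k ` {1..M}) \<longleftrightarrow>
      (\<forall>j\<in>{1..M}. fourier_coeff G (k j) = 0)"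
    by (simp add: H1_gap_def coeff c_nonzero)
  also have "\<dots> \<longleftrightarrow> frakM M k F as *\<^sub>v x = 0\<^sub>v (2 * M)"
    unfolding G_def m_def
    by (rule frakM_mult_vec_eq_0_iff[symmetric]) (use x F0_integrable in \<open>simp_all add: m_def\<close>)
  finally show ?thesis .
qed

text \<open>With \<open>G = I * h\<close> the product \<open>F * G = f * h\<close> is analytic, so
  Smirnov's principle makes \<open>G\<close> analytic. Multiplication by \<open>D^2 / c\<close>
  turns \<open>G\<close> into \<open>z ^ m * (|D|^2 * h)\<close>, and a real function that becomes
  analytic after a shift by \<open>m\<close> is a trigonometric polynomial of degree at most
  \<open>m\<close>.\<close>

lemma multiplier_surj:
  assumes h: "h \<in> borel_measurable circle" "AE z in circle. \<bar>h z\<bar> \<le> C"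
    and fh: "(\<lambda>z. f z * of_real (h z)) \<in> H1"
  shows "\<exists>x\<in>carrier_vec (2 * m + 1). AE z in circle. h z = multiplier x z"
proof -
  define G where "G = (\<lambda>z. c * blaschke as z * of_real (h z))"
  have blaschke_meas [measurable]: "blaschke as \<in> borel_measurable circle"
    unfolding blaschke_eq_quotient[abs_def] by measurable
  note [measurable] = h(1) H1_measurable[OF F_H1]
  have G_meas: "G \<in> borel_measurable circle"
    unfolding G_def by measurable
  have "(\<lambda>z. F z * G z) \<in> H1"
  proof (rule H1_cong_AE[OF fh])
    show "AE z in circle. f z * of_real (h z) = F z * G z"
      using f_eq by eventually_elim (simp add: G_def)
  qed (use G_meas in measurable)
  moreover have "AE z in circle. cmod (G z) \<le> C"
    using h(2) AE_space by eventually_elim (simp add: G_def norm_mult c cmod_blaschke)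
  ultimately have G_H1: "G \<in> H1"
    by (intro outer_quotient_H1[OF outer G_meas])
  define g where "g = (\<lambda>z. h z * (cmod (D z))\<^sup>2)"
  have g_meas: "g \<in> borel_measurable circle"
    unfolding g_def D_def by measurable
  have "(\<lambda>z. z powi int m * of_real (g z)) \<in> H1"
  proof (rule H1_cong_AE[OF H1_cmult[OF H1_mult_poly[OF G_H1, of "blaschke_denom as * blaschke_denom as"], of "1 / c"]])
    show "AE z in circle. 1 / c * (poly (blaschke_denom as * blaschke_denom as) z * G z) = z powi int m * of_real (g z)"
      using AE_space
    proof eventually_elim
      case (elim z)
      then have z: "z \<in> sphere 0 1"
        by simp
      show ?case
        unfolding G_def g_def blaschke_on_circle[OF z] poly_mult D_def[symmetric] of_real_mult complex_norm_square
        using D_nonzero[OF z] c_nonzero by (simp add: field_simps)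
    qed
  qed (use g_meas in measurable)
  moreover have "integrable circle g"
  proof -
    have "integrable circle (\<lambda>z. (cmod (D z))\<^sup>2)"
      unfolding D_def by (intro integrable_circle_continuous continuous_intros)
    then show ?thesis
      unfolding g_def using h by (intro integrable_mult_bounded) auto
  qed
  ultimately obtain \<gamma> where \<gamma>: "Im (\<gamma> 0) = 0" "AE z in circle. g z = real_trig m \<gamma> z"
    using real_trig_exists by blast
  obtain x where x: "x \<in> carrier_vec (2 * m + 1)" "\<And>l. l \<le> m \<Longrightarrow> vec_coeffs m x l = \<gamma> l"
    using vec_coeffs_surj[where \<gamma> = \<gamma> and m = m, OF \<gamma>(1)] by blast
  have trig_eq: "real_trig m (vec_coeffs m x) = real_trig m \<gamma>"
    by (rule real_trig_cong) (rule x(2))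
  have "AE z in circle. h z = multiplier x z"
    using \<gamma>(2) AE_space
  proof eventually_elim
    case (elim z)
    then have "D z \<noteq> 0"
      using D_nonzero by simp
    then show ?case
      using elim(1) by (simp add: multiplier_def trig_eq g_def eq_divide_eq)
  qed
  then show ?thesis
    using x(1) by blast
qed

lemma multiplier_inject:
  assumes x: "x \<in> carrier_vec (2 * m + 1)" and y: "y \<in> carrier_vec (2 * m + 1)"
    and eq: "AE z in circle. multiplier x z = multiplier y z"
  shows "x = y"
proof (rule vec_coeffs_inject[OF x y])
  fix l assume l: "l \<le> m"
  have "AE z in circle. real_trig m (vec_coeffs m x) z = real_trig m (vec_coeffs m y) z"
    using eq AE_space
  proof eventually_elim
    case (elim z)
    then show ?case
      using D_nonzero[of z] by (simp add: multiplier_def)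
  qed
  then show "vec_coeffs m x l = vec_coeffs m y l"
    by (rule real_trig_inject) (use l in simp_all)
qed

lemma multiplier_smult:
  assumes "x \<in> carrier_vec (2 * m + 1)"
  shows "multiplier (t \<cdot>\<^sub>v x) z = t * multiplier x z"
proof -
  have "real_trig m (vec_coeffs m (t \<cdot>\<^sub>v x)) = real_trig m (\<lambda>l. of_real t * vec_coeffs m x l)"
    by (rule real_trig_cong) (rule vec_coeffs_smult[OF assms])
  then show ?thesis
    by (simp add: multiplier_def real_trig_cmult)
qed

theorem extreme_iff_rank:
  "extreme_point f (unit_ball (H1_gap (k ` {1..M}))) \<longleftrightarrow>
    vec_space.rank (2 * M) (frakM M k F as) = 2 * length as"
proof -
  have "(\<lambda>z. f z * of_real 1) \<in> H1"
    using f_gap by (simp add: H1_gap_def)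
  \<comment> \<open>The vector \<open>x0\<close> encodes \<open>|D|^2\<close>, the numerator of the
    constant multiplier 1. It lies in the kernel because \<open>f\<close> itself has the spectral
    gaps.\<close>
  then obtain x0 where x0: "x0 \<in> carrier_vec (2 * m + 1)" "AE z in circle. 1 = multiplier x0 z"
    using multiplier_surj[of "\<lambda>_. 1" 1] by auto
  have "AE z in circle. f z = f z * of_real (multiplier x0 z)"
    using x0(2) by eventually_elim (metis mult.right_neutral of_real_1)
  then have "(\<lambda>z. f z * of_real (multiplier x0 z)) \<in> H1_gap (k ` {1..M})"
    by (rule H1_gap_cong_AE[OF f_gap]) measurable
  then have x0_ker: "frakM M k F as *\<^sub>v x0 = 0\<^sub>v (2 * M)"
    using multiplier_gap_iff[OF x0(1)] by simp
  have x0_nz: "x0 \<noteq> 0\<^sub>v (2 * m + 1)"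
  proof
    assume x0_zero: "x0 = 0\<^sub>v (2 * m + 1)"
    have "real_trig m (vec_coeffs m x0) = real_trig m (\<lambda>l. 0)"
      by (rule real_trig_cong) (auto simp: x0_zero vec_coeffs_def complex_eq_iff)
    then have "multiplier x0 z = 0" for z
      by (simp add: multiplier_def real_trig_def)
    then have "AE z in circle. (1 :: real) = 0"
      using x0(2) by simp
    then have "(LINT z|circle. (1 :: real)) = (LINT z|circle. 0)"
      by (intro integral_cong_AE) auto
    then show False
      by simp
  qed
  have rank: "vec_space.rank (2 * M) (frakM M k F as) = 2 * length as \<longleftrightarrow>
      (\<forall>x\<in>carrier_vec (2 * m + 1). frakM M k F as *\<^sub>v x = 0\<^sub>v (2 * M) \<longrightarrow> (\<exists>t. x = t \<cdot>\<^sub>v x0))"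
    using rank_eq_iff_kernel_line[of "frakM M k F as" "2 * M" "2 * m" x0] x0(1) x0_nz x0_ker frakM_carrier[of M k F as]
    by (simp add: m_def)
  show ?thesis
    unfolding rank
  proof (intro iffI ballI impI)
    fix x
    assume extreme: "extreme_point f (unit_ball (H1_gap (k ` {1..M})))"
      and x: "x \<in> carrier_vec (2 * m + 1)" "frakM M k F as *\<^sub>v x = 0\<^sub>v (2 * M)"
    obtain C where "AE z in circle. \<bar>multiplier x z\<bar> \<le> C"
      using multiplier_bounded by blast
    moreover have "(\<lambda>z. f z * of_real (multiplier x z)) \<in> H1_gap (k ` {1..M})"
      using multiplier_gap_iff[OF x(1)] x(2) by simp
    ultimately obtain t where "AE z in circle. multiplier x z = t"
      using extreme_pointD[OF extreme f_gap f_norm f_nonzero multiplier_measurable] by blast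
    with x0(2) have "AE z in circle. multiplier x z = multiplier (t \<cdot>\<^sub>v x0) z"
      by eventually_elim (simp add: multiplier_smult[OF x0(1)])
    then have "x = t \<cdot>\<^sub>v x0"
      using x x0(1) by (intro multiplier_inject) auto
    then show "\<exists>t. x = t \<cdot>\<^sub>v x0"
      by blast
  next
    assume line: "\<forall>x\<in>carrier_vec (2 * m + 1). frakM M k F as *\<^sub>v x = 0\<^sub>v (2 * M) \<longrightarrow> (\<exists>t. x = t \<cdot>\<^sub>v x0)"
    show "extreme_point f (unit_ball (H1_gap (k ` {1..M})))"
    proof (rule extreme_pointI[OF f_gap f_norm f_nonzero])
      fix h :: "complex \<Rightarrow> real"
      assume h: "h \<in> borel_measurable circle" "AE z in circle. \<bar>h z\<bar> \<le> 1"
        and fh: "(\<lambda>z. f z * of_real (h z)) \<in> H1_gap (k ` {1..M})"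
      have "(\<lambda>z. f z * of_real (h z)) \<in> H1"
        using fh by (simp add: H1_gap_def)
      then obtain x where x: "x \<in> carrier_vec (2 * m + 1)" "AE z in circle. h z = multiplier x z"
        using multiplier_surj[OF h] by blast
      have "AE z in circle. f z * of_real (h z) = f z * of_real (multiplier x z)"
        using x(2) by eventually_elim simp
      then have "(\<lambda>z. f z * of_real (multiplier x z)) \<in> H1_gap (k ` {1..M})"
        by (rule H1_gap_cong_AE[OF fh]) measurable
      then have "frakM M k F as *\<^sub>v x = 0\<^sub>v (2 * M)"
        using multiplier_gap_iff[OF x(1)] by simp
      then obtain t where t: "x = t \<cdot>\<^sub>v x0"
        using line x(1) by blast
      have "AE z in circle. h z = t"
        using x(2) x0(2) by eventually_elim (simp add: t multiplier_smult[OF x0(1)] flip: mult.right_neutral)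
      then show "\<exists>c. AE z in circle. h z = c"
        by blast
    qed
  qed
qed

end

theorem theorem1p1:
  fixes M :: nat and k :: "nat \<Rightarrow> int" and f I F :: "complex \<Rightarrow> complex"
  assumes "\<And>j. j \<in> {1..M} \<Longrightarrow> 0 < k j"
    and "strict_mono_on {1..M} k"
    and "f \<in> H1_gap (k ` {1..M})"
    and "L1_norm f = 1"
    and "is_inner I"
    and "is_outer F"
    and "AE \<zeta> in circle. f \<zeta> = I \<zeta> * F \<zeta>"
  shows "extreme_point f (unit_ball (H1_gap (k ` {1..M}))) \<longleftrightarrow>
    (\<exists>as. blaschke_with_zeros I as \<and> length as \<le> M \<and>
          vec_space.rank (2 * M) (frakM M k F as) = 2 * length as)"
proof -
  \<comment> \<open>Stated for an arbitrary list of zeros of \<open>I\<close>, so that it applies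
    both to the list constructed from extremality and to an unknown witness of the existential
    statement.\<close>
  have extreme_iff: "extreme_point f (unit_ball (H1_gap (k ` {1..M}))) \<longleftrightarrow>
      vec_space.rank (2 * M) (frakM M k F as) = 2 * length as" if as: "blaschke_with_zeros I as" for as
  proof -
    obtain c where c: "set as \<subseteq> ball 0 1" "cmod c = 1" "AE z in circle. I z = c * blaschke as z"
      using as by (auto simp: blaschke_with_zeros_def blaschke_def)
    have "AE z in circle. f z = c * blaschke as z * F z"
      using assms(7) c(3) by eventually_elim simp
    then interpret blaschke_outer M k f F as c
      using assms c by unfold_locales auto
    show ?thesis
      by (rule extreme_iff_rank)
  qed
  have "AE z in circle. F z \<noteq> 0" "AE z in circle. cmod (I z) = 1"
    using assms(5,6) by (auto simp: is_outer_def is_inner_def)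
  with assms(7) have f_nonzero: "AE z in circle. f z \<noteq> 0"
    by eventually_elim auto
  have "F \<in> H1"
    using assms(6) by (simp add: is_outer_def)
  then show ?thesis
    using extreme_imp_blaschke[OF assms(5) _ assms(3,4) f_nonzero assms(7)] extreme_iff by blast
qed

end
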